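(* Let $S$ be a spray on a smooth manifold $M$ with canonical connection $\Gamma_S$. For a lift $\nabla$ of $\Gamma_S$ with curvature $\mathcal{R}$, and $w\in TM\setminus 0$, let ${\bf R}_w:T_{\pi(w)}M\to T_{\pi(w)}M$, ${\bf R}_w(u)=i_w^{-1}\mathcal{R}(S,u^{\mathfrak h})C$ (evaluated at $w$). Then the endomorphisms ${\bf R}_w$, $w\in TM\setminus 0$, do not depend on the choice of the lift $\nabla$ of $\Gamma_S$, but only on $S$. Furthermore, if the torsion of $\nabla$ satisfies ${\rm T}(S,Y)=0$ for all $Y\in\mathfrak{X}(TM\setminus 0)$, then for every $w\in TM\setminus 0$, every $u\in T_{\pi(w)}M$ and any lift $X\in T_w(TM\setminus 0)$ of $u$ (i.e. ${\rm d}\pi(X)=u$), $${\bf R}_w(u)=i_w^{-1}\mathcal{R}(S,X)C.$$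
   Context: Let $\pi:TM\setminus 0\to M$ be the tangent bundle with the zero section removed, $\mathscr{V}TM=\ker({\rm d}\pi)\subset T(TM\setminus 0)$ the vertical bundle, regarded as a vector bundle over $TM\setminus 0$. For $w\in TM\setminus 0$, $i_w:T_{\pi(w)}M\to\mathscr{V}_wTM$, $i_w(u)=\frac{d}{dt}|_{t=0}(w+tu)$. The canonical vector field is $C(w)=i_w(w)$, and $\mathscr{J}(X)=i_w({\rm d}\pi(X))$ for $X\in T_w(TM\setminus 0)$. A spray is a smooth vector field $S$ on $TM\setminus 0$ with $\mathscr{J}(S)=C$ and $[C,S]=S$. Its canonical connection is $\Gamma_S=-[S,\mathscr{J}]$, i.e. $\Gamma_S(Y)=\mathscr{J}[S,Y]-[S,\mathscr{J}(Y)]$; it satisfies $\Gamma_S^2={\bf I}$ and $\ker(\Gamma_S+{\bf I})=\mathscr{V}TM$. With $\mathscr{H}TM=\ker(\Gamma_S-{\bf I})$ (horizontal vectors) one has $T(TM\setminus 0)=\mathscr{H}TM\oplus\mathscr{V}TM$, with projections denoted $\mathscr{H},\mathscr{V}$; $S$ is horizontal. $u^{\mathfrak h}$ denotes the horizontal lift at $w$ of $u\in T_{\pi(w)}M$. A linear connection $\nabla$ on the vector bundle $\mathscr{V}TM\to TM\setminus 0$ is a lift of $\Gamma_S$ if $\nabla_XC=\mathscr{V}X$ for all $X\in T(TM\setminus 0)$. Its torsion is ${\rm T}(X,Y)=\nabla_X\mathscr{J}(Y)-\nabla_Y\mathscr{J}(X)-\mathscr{J}[X,Y]$, and its curvature is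 $\mathcal{R}(X,Y)\mathscr{J}(Z)=\nabla_{[X,Y]}\mathscr{J}(Z)-[\nabla_X,\nabla_Y]\mathscr{J}(Z)$, for $X,Y,Z\in\mathfrak{X}(TM\setminus 0)$. *)

theory Defs
  imports "HOL-Analysis.Analysis"
begin

section \<open>Smooth maps on open subsets of Euclidean spaces\<close>

text \<open>In finite dimension, continuity of all iterated directional derivatives, together with
  differentiability at every stage, is the usual notion of class \<open>C\<^sup>k\<close>.\<close>

fun class_C :: "nat \<Rightarrow> 'e::real_normed_vector set \<Rightarrow> ('e \<Rightarrow> 'f::real_normed_vector) \<Rightarrow> bool" where
  "class_C 0 S f \<longleftrightarrow> continuous_on S f"
| "class_C (Suc k) S f \<longleftrightarrow>
     (\<forall>x\<in>S. f differentiable (at x)) \<and>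
     (\<forall>v. class_C k S (\<lambda>x. frechet_derivative f (at x) v))"

definition class_C_inf :: "'e::real_normed_vector set \<Rightarrow> ('e \<Rightarrow> 'f::real_normed_vector) \<Rightarrow> bool" where
  "class_C_inf S f \<longleftrightarrow> (\<forall>k. class_C k S f)"


section \<open>Smooth manifolds\<close>

text \<open>A manifold is presented by an atlas, a set of charts \<open>(U, \<phi>)\<close>, where \<open>\<phi>\<close> is relevant on \<open>U\<close>
  only. The underlying set and the topology are those determined by the atlas. The inverse of a
  chart is \<open>inv_into U \<phi>\<close>.\<close>

type_synonym ('a, 'e) chart = "'a set \<times> ('a \<Rightarrow> 'e)"

definition points :: "('a, 'e) chart set \<Rightarrow> 'a set" where
  "points A = (\<Union>(U, \<phi>)\<in>A. U)"

definition atlas_open :: "('a, 'e::euclidean_space) chart set \<Rightarrow> 'a set \<Rightarrow> bool" where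
  "atlas_open A W \<longleftrightarrow> W \<subseteq> points A \<and> (\<forall>(U, \<phi>)\<in>A. open (\<phi> ` (W \<inter> U)))"

definition atlas_topology :: "('a, 'e::euclidean_space) chart set \<Rightarrow> 'a topology" where
  "atlas_topology A = topology (atlas_open A)"

definition smooth_atlas :: "('a, 'e::euclidean_space) chart set \<Rightarrow> bool" where
  "smooth_atlas A \<longleftrightarrow>
     (\<forall>(U, \<phi>)\<in>A. inj_on \<phi> U \<and> open (\<phi> ` U)) \<and>
     (\<forall>(U, \<phi>)\<in>A. \<forall>(V, \<psi>)\<in>A.
        open (\<phi> ` (U \<inter> V)) \<and> class_C_inf (\<phi> ` (U \<inter> V)) (\<psi> \<circ> inv_into U \<phi>))"

definition smooth_manifold :: "('a, 'e::euclidean_space) chart set \<Rightarrow> bool" where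
  "smooth_manifold A \<longleftrightarrow>
     smooth_atlas A \<and> Hausdorff_space (atlas_topology A) \<and> second_countable (atlas_topology A)"

lemma openin_atlas_topology:
  assumes "smooth_atlas A"
  shows "openin (atlas_topology A) = atlas_open A"
proof -
  have "atlas_open A (S \<inter> T)" if S: "atlas_open A S" and T: "atlas_open A T" for S T
    unfolding atlas_open_def
  proof (intro conjI ballI, goal_cases)
    case 1
    show ?case using S by (auto simp: atlas_open_def)
  next
    case (2 c)
    obtain U \<phi> where c: "c = (U, \<phi>)" by force
    have inj: "inj_on \<phi> U"
      using 2 assms c by (auto simp: smooth_atlas_def)
    have "\<phi> ` (S \<inter> T \<inter> U) = \<phi> ` (S \<inter> U) \<inter> \<phi> ` (T \<inter> U)"
      using inj by (auto simp: inj_on_def)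
    then show ?case
      using S T 2 c by (auto simp: atlas_open_def)
  qed
  moreover have "atlas_open A (\<Union>\<K>)" if K: "\<forall>S\<in>\<K>. atlas_open A S" for \<K>
    unfolding atlas_open_def
  proof (intro conjI ballI, goal_cases)
    case 1
    show ?case using K by (auto simp: atlas_open_def)
  next
    case (2 c)
    obtain U \<phi> where c: "c = (U, \<phi>)" by force
    have "\<phi> ` (\<Union>\<K> \<inter> U) = (\<Union>S\<in>\<K>. \<phi> ` (S \<inter> U))" by auto
    moreover have "open (\<Union>S\<in>\<K>. \<phi> ` (S \<inter> U))"
      using K 2 c by (intro open_UN) (auto simp: atlas_open_def)
    ultimately show ?case using c by auto
  qed
  ultimately have "istopology (atlas_open A)"
    by (simp add: istopology_def)
  then show ?thesis
    by (simp add: atlas_topology_def)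
qed

text \<open>Functions are total; their values off \<^term>\<open>points A\<close> are unconstrained.\<close>

definition smooth_fun :: "('a, 'e::euclidean_space) chart set \<Rightarrow> ('a \<Rightarrow> real) \<Rightarrow> bool" where
  "smooth_fun A f \<longleftrightarrow> (\<forall>(U, \<phi>)\<in>A. class_C_inf (\<phi> ` U) (f \<circ> inv_into U \<phi>))"


section \<open>Tangent vectors and vector fields\<close>

type_synonym 'a tvec = "('a \<Rightarrow> real) \<Rightarrow> real"
type_synonym 'a vfield = "'a \<Rightarrow> 'a tvec"

text \<open>Tangent vectors at \<open>p\<close> are derivations at \<open>p\<close> of the algebra of smooth functions. They are
  set to 0 on non-smooth functions, so that a derivation has exactly one representative. (The
  values of a function off \<^term>\<open>points A\<close> do not matter: if \<open>h\<close> vanishes on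
  \<^term>\<open>points A\<close>, then \<open>h = h * k\<close> with \<open>k\<close> the indicator of the complement, and Leibniz gives
  \<open>v h = 0\<close>.)\<close>

definition tangent_space :: "('a, 'e::euclidean_space) chart set \<Rightarrow> 'a \<Rightarrow> 'a tvec set" where
  "tangent_space A p = {v.
     (\<forall>f g. smooth_fun A f \<longrightarrow> smooth_fun A g \<longrightarrow> v (\<lambda>q. f q + g q) = v f + v g) \<and>
     (\<forall>c f. smooth_fun A f \<longrightarrow> v (\<lambda>q. c * f q) = c * v f) \<and>
     (\<forall>f g. smooth_fun A f \<longrightarrow> smooth_fun A g \<longrightarrow>
        v (\<lambda>q. f q * g q) = f p * v g + g p * v f) \<and>
     (\<forall>f. \<not> smooth_fun A f \<longrightarrow> v f = 0)}"

text \<open>Vector fields are extended by zero off \<^term>\<open>points A\<close>, so that equality of vector fields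
  is equality of functions.\<close>

definition vector_field :: "('a, 'e::euclidean_space) chart set \<Rightarrow> 'a vfield \<Rightarrow> bool" where
  "vector_field A X \<longleftrightarrow>
     (\<forall>p\<in>points A. X p \<in> tangent_space A p) \<and>
     (\<forall>p. p \<notin> points A \<longrightarrow> X p = (\<lambda>_. 0)) \<and>
     (\<forall>f. smooth_fun A f \<longrightarrow> smooth_fun A (\<lambda>p. X p f))"

definition lie_bracket :: "'a vfield \<Rightarrow> 'a vfield \<Rightarrow> 'a vfield" where
  "lie_bracket X Y = (\<lambda>p f. X p (\<lambda>q. Y q f) - Y p (\<lambda>q. X q f))"

definition fadd :: "'a vfield \<Rightarrow> 'a vfield \<Rightarrow> 'a vfield" where
  "fadd X Y = (\<lambda>p f. X p f + Y p f)"

definition fsub :: "'a vfield \<Rightarrow> 'a vfield \<Rightarrow> 'a vfield" where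
  "fsub X Y = (\<lambda>p f. X p f - Y p f)"

definition fmul :: "('a \<Rightarrow> real) \<Rightarrow> 'a vfield \<Rightarrow> 'a vfield" where
  "fmul h X = (\<lambda>p f. h p * X p f)"

text \<open>The value at a single vector \<open>x\<close> at \<open>p\<close> of an operator \<open>T\<close> on vector fields that is tensorial,
  i.e. for which \<open>T X p\<close> depends only on \<open>X p\<close>.\<close>

definition value_at ::
  "('a, 'e::euclidean_space) chart set \<Rightarrow> ('a vfield \<Rightarrow> 'a vfield) \<Rightarrow> 'a \<Rightarrow> 'a tvec \<Rightarrow> 'a tvec" where
  "value_at A T p x = (THE y. \<forall>X. vector_field A X \<longrightarrow> X p = x \<longrightarrow> T X p = y)"


section \<open>The slit tangent bundle\<close>

text \<open>The tangent vector at \<open>p\<close> with components \<open>a\<close> with respect to the chart \<open>(U, \<phi>)\<close>.\<close>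

definition coord_vec ::
  "('a, 'e::euclidean_space) chart set \<Rightarrow> ('a, 'e) chart \<Rightarrow> 'a \<Rightarrow> 'e \<Rightarrow> 'a tvec" where
  "coord_vec A = (\<lambda>(U, \<phi>) p a f.
     if smooth_fun A f then frechet_derivative (f \<circ> inv_into U \<phi>) (at (\<phi> p)) a else 0)"

text \<open>The chart \<open>(p, v) \<mapsto> (\<phi> p, d\<phi>\<^sub>p v)\<close> of \<open>TM \<setminus> 0\<close> induced by the chart \<open>(U, \<phi>)\<close> of \<open>M\<close>.\<close>

definition tangent_chart ::
  "('a, 'e::euclidean_space) chart set \<Rightarrow> ('a, 'e) chart \<Rightarrow> ('a \<times> 'a tvec, 'e \<times> 'e) chart" where
  "tangent_chart M = (\<lambda>(U, \<phi>).
     ({(p, v). p \<in> U \<and> v \<in> tangent_space M p \<and> v \<noteq> (\<lambda>_. 0)},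
      \<lambda>(p, v). (\<phi> p, THE a. coord_vec M (U, \<phi>) p a = v)))"

definition slit :: "('a, 'e::euclidean_space) chart set \<Rightarrow> ('a \<times> 'a tvec, 'e \<times> 'e) chart set" where
  "slit M = tangent_chart M ` M"

text \<open>The bundle projection \<open>\<pi>\<close> is \<^const>\<open>fst\<close>.\<close>

definition dpi ::
  "('a, 'e::euclidean_space) chart set \<Rightarrow> ('a \<times> 'a tvec) tvec \<Rightarrow> 'a tvec" where
  "dpi M x = (\<lambda>g. if smooth_fun M g then x (g \<circ> fst) else 0)"

definition vertical_space ::
  "('a, 'e::euclidean_space) chart set \<Rightarrow> 'a \<times> 'a tvec \<Rightarrow> ('a \<times> 'a tvec) tvec set" where
  "vertical_space M w = {x \<in> tangent_space (slit M) w. dpi M x = (\<lambda>_. 0)}"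

definition vertical_field ::
  "('a, 'e::euclidean_space) chart set \<Rightarrow> ('a \<times> 'a tvec) vfield \<Rightarrow> bool" where
  "vertical_field M V \<longleftrightarrow>
     vector_field (slit M) V \<and> (\<forall>w\<in>points (slit M). V w \<in> vertical_space M w)"

text \<open>\<open>i\<^sub>w u\<close> is the velocity at \<open>t = 0\<close> of the curve \<open>t \<mapsto> w + t u\<close> in the fibre through \<open>w\<close>.\<close>

definition ivert ::
  "('a, 'e::euclidean_space) chart set \<Rightarrow> 'a \<times> 'a tvec \<Rightarrow> 'a tvec \<Rightarrow> ('a \<times> 'a tvec) tvec" where
  "ivert M = (\<lambda>(p, v) u f.
     if smooth_fun (slit M) f then deriv (\<lambda>t. f (p, \<lambda>g. v g + t * u g)) 0 else 0)"

definition ivert_inv ::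
  "('a, 'e::euclidean_space) chart set \<Rightarrow> 'a \<times> 'a tvec \<Rightarrow> ('a \<times> 'a tvec) tvec \<Rightarrow> 'a tvec" where
  "ivert_inv M w = inv_into (tangent_space M (fst w)) (ivert M w)"

definition canonical_field ::
  "('a, 'e::euclidean_space) chart set \<Rightarrow> ('a \<times> 'a tvec) vfield" where
  "canonical_field M = (\<lambda>w. if w \<in> points (slit M) then ivert M w (snd w) else (\<lambda>_. 0))"

definition vertical_endo ::
  "('a, 'e::euclidean_space) chart set \<Rightarrow> ('a \<times> 'a tvec) vfield \<Rightarrow> ('a \<times> 'a tvec) vfield" where
  "vertical_endo M X =
     (\<lambda>w. if w \<in> points (slit M) then ivert M w (dpi M (X w)) else (\<lambda>_. 0))"


section \<open>Sprays and their canonical connection\<close>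

definition spray ::
  "('a, 'e::euclidean_space) chart set \<Rightarrow> ('a \<times> 'a tvec) vfield \<Rightarrow> bool" where
  "spray M S \<longleftrightarrow>
     vector_field (slit M) S \<and>
     vertical_endo M S = canonical_field M \<and>
     lie_bracket (canonical_field M) S = S"

definition spray_connection ::
  "('a, 'e::euclidean_space) chart set \<Rightarrow> ('a \<times> 'a tvec) vfield \<Rightarrow>
   ('a \<times> 'a tvec) vfield \<Rightarrow> ('a \<times> 'a tvec) vfield" where
  "spray_connection M S Y =
     fsub (vertical_endo M (lie_bracket S Y)) (lie_bracket S (vertical_endo M Y))"

definition horizontal_space ::
  "('a, 'e::euclidean_space) chart set \<Rightarrow> ('a \<times> 'a tvec) vfield \<Rightarrow> 'a \<times> 'a tvec \<Rightarrow>
   ('a \<times> 'a tvec) tvec set" where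
  "horizontal_space M S w =
     {x \<in> tangent_space (slit M) w. value_at (slit M) (spray_connection M S) w x = x}"

text \<open>The projection onto vertical vectors along horizontal vectors.\<close>

definition vertical_proj ::
  "('a, 'e::euclidean_space) chart set \<Rightarrow> ('a \<times> 'a tvec) vfield \<Rightarrow> 'a \<times> 'a tvec \<Rightarrow>
   ('a \<times> 'a tvec) tvec \<Rightarrow> ('a \<times> 'a tvec) tvec" where
  "vertical_proj M S w x =
     (THE v. v \<in> vertical_space M w \<and> (\<lambda>f. x f - v f) \<in> horizontal_space M S w)"

definition vertical_part ::
  "('a, 'e::euclidean_space) chart set \<Rightarrow> ('a \<times> 'a tvec) vfield \<Rightarrow>
   ('a \<times> 'a tvec) vfield \<Rightarrow> ('a \<times> 'a tvec) vfield" where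
  "vertical_part M S X =
     (\<lambda>w. if w \<in> points (slit M) then vertical_proj M S w (X w) else (\<lambda>_. 0))"

definition horizontal_lift ::
  "('a, 'e::euclidean_space) chart set \<Rightarrow> ('a \<times> 'a tvec) vfield \<Rightarrow> 'a \<times> 'a tvec \<Rightarrow>
   'a tvec \<Rightarrow> ('a \<times> 'a tvec) tvec" where
  "horizontal_lift M S w u = (THE x. x \<in> horizontal_space M S w \<and> dpi M x = u)"


section \<open>Linear connections on the vertical bundle\<close>

type_synonym 'a connection = "'a vfield \<Rightarrow> 'a vfield \<Rightarrow> 'a vfield"

definition linear_connection ::
  "('a, 'e::euclidean_space) chart set \<Rightarrow> ('a \<times> 'a tvec) connection \<Rightarrow> bool" where
  "linear_connection M D \<longleftrightarrow>
     (\<forall>X V. vector_field (slit M) X \<longrightarrow> vertical_field M V \<longrightarrow> vertical_field M (D X V)) \<and>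
     (\<forall>X Y V. vector_field (slit M) X \<longrightarrow> vector_field (slit M) Y \<longrightarrow> vertical_field M V \<longrightarrow>
        D (fadd X Y) V = fadd (D X V) (D Y V)) \<and>
     (\<forall>h X V. smooth_fun (slit M) h \<longrightarrow> vector_field (slit M) X \<longrightarrow> vertical_field M V \<longrightarrow>
        D (fmul h X) V = fmul h (D X V)) \<and>
     (\<forall>X V W. vector_field (slit M) X \<longrightarrow> vertical_field M V \<longrightarrow> vertical_field M W \<longrightarrow>
        D X (fadd V W) = fadd (D X V) (D X W)) \<and>
     (\<forall>h X V. smooth_fun (slit M) h \<longrightarrow> vector_field (slit M) X \<longrightarrow> vertical_field M V \<longrightarrow>
        D X (fmul h V) = fadd (fmul (\<lambda>w. X w h) V) (fmul h (D X V)))"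

definition lift_of_spray_connection ::
  "('a, 'e::euclidean_space) chart set \<Rightarrow> ('a \<times> 'a tvec) vfield \<Rightarrow>
   ('a \<times> 'a tvec) connection \<Rightarrow> bool" where
  "lift_of_spray_connection M S D \<longleftrightarrow>
     linear_connection M D \<and>
     (\<forall>X. vector_field (slit M) X \<longrightarrow> D X (canonical_field M) = vertical_part M S X)"

definition torsion ::
  "('a, 'e::euclidean_space) chart set \<Rightarrow> ('a \<times> 'a tvec) connection \<Rightarrow>
   ('a \<times> 'a tvec) vfield \<Rightarrow> ('a \<times> 'a tvec) vfield \<Rightarrow> ('a \<times> 'a tvec) vfield" where
  "torsion M D X Y =
     fsub (fsub (D X (vertical_endo M Y)) (D Y (vertical_endo M X)))
          (vertical_endo M (lie_bracket X Y))"

text \<open>Note the sign; \<open>V\<close> is a vertical vector field.\<close>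

definition curvature :: "'a connection \<Rightarrow> 'a vfield \<Rightarrow> 'a vfield \<Rightarrow> 'a vfield \<Rightarrow> 'a vfield" where
  "curvature D X Y V = fsub (D (lie_bracket X Y) V) (fsub (D X (D Y V)) (D Y (D X V)))"

text \<open>\<open>\<R>(S, x) C\<close> at \<open>w\<close>, for a single tangent vector \<open>x\<close> at \<open>w\<close>.\<close>

definition curvature_S_C ::
  "('a, 'e::euclidean_space) chart set \<Rightarrow> ('a \<times> 'a tvec) vfield \<Rightarrow> ('a \<times> 'a tvec) connection \<Rightarrow>
   'a \<times> 'a tvec \<Rightarrow> ('a \<times> 'a tvec) tvec \<Rightarrow> ('a \<times> 'a tvec) tvec" where
  "curvature_S_C M S D w x = value_at (slit M) (\<lambda>X. curvature D S X (canonical_field M)) w x"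

definition R_endo ::
  "('a, 'e::euclidean_space) chart set \<Rightarrow> ('a \<times> 'a tvec) vfield \<Rightarrow> ('a \<times> 'a tvec) connection \<Rightarrow>
   'a \<times> 'a tvec \<Rightarrow> 'a tvec \<Rightarrow> 'a tvec" where
  "R_endo M S D w u = ivert_inv M w (curvature_S_C M S D w (horizontal_lift M S w u))"

definition tangent_endomorphism ::
  "('a, 'e::euclidean_space) chart set \<Rightarrow> 'a \<Rightarrow> ('a tvec \<Rightarrow> 'a tvec) \<Rightarrow> bool" where
  "tangent_endomorphism M p F \<longleftrightarrow>
     (\<forall>u\<in>tangent_space M p. F u \<in> tangent_space M p) \<and>
     (\<forall>u\<in>tangent_space M p. \<forall>v\<in>tangent_space M p.
        F (\<lambda>f. u f + v f) = (\<lambda>f. F u f + F v f)) \<and>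
     (\<forall>c. \<forall>u\<in>tangent_space M p. F (\<lambda>f. c * u f) = (\<lambda>f. c * F u f))"

end

theory Submission
  imports Defs
begin

text \<open>Write \<open>J\<close> for the vertical endomorphism, \<open>\<Gamma>\<close> for the canonical connection and
  \<open>V = (I - \<Gamma>) / 2\<close>. For a lift \<open>D\<close> one has \<open>D\<^sub>X C = V X\<close> and \<open>V S = 0\<close>, so
  \<open>\<R>(S, X) C = V [S, X] - D\<^sub>S (V X)\<close>. This is tensorial in \<open>X\<close>, and when \<open>X\<close> is a horizontal field
  it equals \<open>V [S, X]\<close>, which does not involve \<open>D\<close>. If \<open>T(S, Y) = 0\<close>, then
  \<open>D\<^sub>S (J Y) = V Y + J [S, Y] = V [S, J Y]\<close>, so \<open>\<R>(S, \<cdot>) C\<close> vanishes on vertical vectors.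

  The identities \<open>\<Gamma> J = - J\<close>, \<open>J \<Gamma> = J\<close> and \<open>\<Gamma>\<^sup>2 = I\<close> are checked by letting both sides act on
  functions \<open>g \<circ> \<pi>\<close> and \<open>dg\<close>, with \<open>g\<close> smooth on \<open>M\<close>: a tangent vector of \<open>TM \<setminus> 0\<close> is determined
  by its values on these, since derivations are given by coordinate vectors (Hadamard's lemma and
  cutoff functions).\<close>

section \<open>Calculus of smooth maps\<close>

text \<open>Vectors at a single point enter the statement through definite descriptions
  (\<open>value_at\<close>, \<open>horizontal_lift\<close>, \<open>vertical_proj\<close>). To
  evaluate them, a vector is extended to a global field, and an operator that is linear over smooth
  functions is shown to depend on the value of the field only. Both steps need cutoff functions, and
  extension by zero from a chart is smooth because the manifold is Hausdorff; hence
  \<open>slit M\<close> has to be shown Hausdorff as well. An identity at one point is not enough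
  where \<open>D S\<close> differentiates: to drop \<open>D S (vpart X)\<close> the field
  \<open>X\<close> must be horizontal everywhere. On a vertical vector, tensoriality first replaces
  the field by one of the form J Y, to which the torsion condition applies. The equality V [S, J Y]
  = V Y + J [S, Y] is the definition of \<Gamma>, read as [S, J Y] = J [S, Y] - \<Gamma> Y, combined
  with V J = J and V \<Gamma> = - V.\<close>

lemma class_C_cong_on:
  assumes "open S" "\<And>x. x \<in> S \<Longrightarrow> f x = g x" "class_C k S f"
  shows "class_C k S g"
  using assms(2,3)
proof (induction k arbitrary: f g)
  case 0
  then show ?case using continuous_on_cong[of S S f g] by simp
next
  case (Suc k)
  have d: "g differentiable (at x)"
    and e: "frechet_derivative f (at x) = frechet_derivative g (at x)" if "x \<in> S" for x
  proof -
    have f: "f differentiable (at x)" using Suc.prems that by simp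
    then show "g differentiable (at x)"
      using Suc.prems(1) assms(1) that
      unfolding differentiable_def by (meson has_derivative_transform_within_open)
    show "frechet_derivative f (at x) = frechet_derivative g (at x)"
      using frechet_derivative_transform_within_open[OF f assms(1) that] Suc.prems(1) by blast
  qed
  have "class_C k S (\<lambda>x. frechet_derivative g (at x) v)" for v
    by (rule Suc.IH[of "\<lambda>x. frechet_derivative f (at x) v"]) (use e Suc.prems in auto)
  then show ?case using d by simp
qed

text \<open>Lets later proofs supply an explicit derivative formula: uniqueness of the derivative
  identifies it with \<open>frechet_derivative\<close>, and as \<open>S\<close> is open the two may
  be exchanged inside \<open>class_C\<close>.\<close>

lemma class_C_SucI:
  assumes "open S" "\<And>x. x \<in> S \<Longrightarrow> (f has_derivative f' x) (at x)"
    and "\<And>v. class_C k S (\<lambda>x. f' x v)"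
  shows "class_C (Suc k) S f"
proof -
  have "class_C k S (\<lambda>x. frechet_derivative f (at x) v)" for v
  proof (rule class_C_cong_on[OF assms(1) _ assms(3)])
    show "f' x v = frechet_derivative f (at x) v" if "x \<in> S" for x
      using frechet_derivative_at[OF assms(2)[OF that]] by simp
  qed
  then show ?thesis using assms(2) by (auto simp: differentiable_def)
qed

lemma class_C_SucD:
  assumes "class_C (Suc k) S f" "x \<in> S"
  shows "(f has_derivative frechet_derivative f (at x)) (at x)"
  using assms by (simp add: frechet_derivative_works)

lemma class_C_Suc_imp: "class_C (Suc k) S f \<Longrightarrow> class_C k S f"
proof (induction k arbitrary: f)
  case 0
  then show ?case
    by (auto intro!: continuous_at_imp_continuous_on differentiable_imp_continuous_within)
next
  case (Suc k)
  have "class_C k S (\<lambda>x. frechet_derivative f (at x) v)" for v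
    using Suc.IH[of "\<lambda>x. frechet_derivative f (at x) v"] Suc.prems by (auto simp del: class_C.simps(1))
  then show ?case using Suc.prems by simp
qed

lemma class_C_subset: "class_C k S f \<Longrightarrow> T \<subseteq> S \<Longrightarrow> class_C k T f"
  by (induction k arbitrary: f) (auto intro: continuous_on_subset)

lemma class_C_continuous_on: "class_C k S f \<Longrightarrow> continuous_on S f"
  by (induction k) (auto dest: class_C_Suc_imp simp del: class_C.simps(2))

lemma class_C_local:
  assumes "\<And>x. x \<in> S \<Longrightarrow> \<exists>T. open T \<and> x \<in> T \<and> class_C k T f"
  shows "class_C k S f"
  using assms
proof (induction k arbitrary: f)
  case 0
  show ?case
  proof (simp, rule continuous_at_imp_continuous_on, rule ballI)
    fix x assume "x \<in> S"
    then obtain T where "open T" "x \<in> T" "continuous_on T f" using 0 by auto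
    then show "isCont f x" by (simp add: continuous_on_eq_continuous_at)
  qed
next
  case (Suc k)
  have "class_C k S (\<lambda>x. frechet_derivative f (at x) v)" for v
  proof (rule Suc.IH)
    fix x assume "x \<in> S"
    then show "\<exists>T. open T \<and> x \<in> T \<and> class_C k T (\<lambda>x. frechet_derivative f (at x) v)"
      using Suc.prems by (metis class_C.simps(2))
  qed
  moreover have "f differentiable (at x)" if "x \<in> S" for x
    using Suc.prems[OF that] by auto
  ultimately show ?case by simp
qed

lemma class_C_const: "class_C k S (\<lambda>x. c)"
  by (induction k arbitrary: c) (simp_all add: frechet_derivative_const)

lemma class_C_bounded_linear: "bounded_linear f \<Longrightarrow> class_C k S f"
proof (cases k)
  case (Suc j)
  assume f: "bounded_linear f"
  then have "frechet_derivative f (at x) = f" for x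
    by (metis bounded_linear_imp_has_derivative frechet_derivative_at)
  then show ?thesis using Suc f by (simp add: class_C_const bounded_linear_imp_differentiable)
qed (simp add: linear_continuous_on)

lemma class_C_add:
  assumes "open S" "class_C k S f" "class_C k S g"
  shows "class_C k S (\<lambda>x. f x + g x)"
  using assms(2,3)
proof (induction k arbitrary: f g)
  case (Suc k)
  show ?case
  proof (rule class_C_SucI[OF assms(1)])
    show "((\<lambda>x. f x + g x) has_derivative
        (\<lambda>v. frechet_derivative f (at x) v + frechet_derivative g (at x) v)) (at x)" if "x \<in> S" for x
      using Suc.prems[THEN class_C_SucD, OF that] by (rule has_derivative_add)
    show "class_C k S (\<lambda>x. frechet_derivative f (at x) v + frechet_derivative g (at x) v)" for v
      using Suc.IH Suc.prems by simp
  qed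
qed (auto intro: continuous_intros)

lemma class_C_sum:
  assumes "open S" "\<And>i. i \<in> I \<Longrightarrow> class_C k S (f i)"
  shows "class_C k S (\<lambda>x. \<Sum>i\<in>I. f i x)"
  using assms(2)
  by (induction I rule: infinite_finite_induct) (simp_all add: class_C_const class_C_add assms(1))

lemma class_C_bilinear:
  assumes "bounded_bilinear P" "open S" "class_C k S f" "class_C k S g"
  shows "class_C k S (\<lambda>x. P (f x) (g x))"
  using assms(3,4)
proof (induction k arbitrary: f g)
  case 0
  then show ?case using assms(1) by (simp add: bounded_bilinear.continuous_on)
next
  case (Suc k)
  show ?case
  proof (rule class_C_SucI[OF assms(2)])
    show "((\<lambda>x. P (f x) (g x)) has_derivative (\<lambda>v. P (f x) (frechet_derivative g (at x) v)
        + P (frechet_derivative f (at x) v) (g x))) (at x)" if "x \<in> S" for x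
      using assms(1) Suc.prems[THEN class_C_SucD, OF that] by (rule bounded_bilinear.FDERIV)
    show "class_C k S (\<lambda>x. P (f x) (frechet_derivative g (at x) v)
        + P (frechet_derivative f (at x) v) (g x))" for v
      using Suc.prems Suc.prems[THEN class_C_Suc_imp]
      by (intro class_C_add[OF assms(2)] Suc.IH) simp_all
  qed
qed

lemma linear_eq_sum_Basis:
  fixes f :: "'e::euclidean_space \<Rightarrow> 'f::real_vector"
  assumes "linear f"
  shows "f v = (\<Sum>i\<in>Basis. (v \<bullet> i) *\<^sub>R f i)"
proof -
  have "f v = f (\<Sum>i\<in>Basis. (v \<bullet> i) *\<^sub>R i)" by (simp add: euclidean_representation)
  then show ?thesis using assms by (simp add: linear_sum linear_scale)
qed

text \<open>The chain rule differentiates \<open>g\<close> in the direction Df(x) v, which moves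
  with \<open>x\<close>, while \<open>class_C\<close> controls fixed directions only. Expanding that
  direction in \<open>Basis\<close> leaves the fixed directions \<open>i\<close>, to which the
  induction hypothesis applies.\<close>

lemma class_C_compose:
  fixes g :: "'e::euclidean_space \<Rightarrow> 'f::real_normed_vector"
  assumes "open S" "open T" "class_C k S f" "class_C k T g" "f ` S \<subseteq> T"
  shows "class_C k S (\<lambda>x. g (f x))"
  using assms(3,4)
proof (induction k arbitrary: g)
  case 0
  then show ?case using continuous_on_compose2[of T g S f] assms(5) by simp
next
  case (Suc k)
  have f: "class_C k S f" using Suc.prems(1) by (rule class_C_Suc_imp)
  have T: "f x \<in> T" if "x \<in> S" for x using that assms(5) by auto
  show ?case
  proof (rule class_C_SucI[OF assms(1)])
    show "((\<lambda>x. g (f x)) has_derivative (\<lambda>v. \<Sum>i\<in>Basis. (frechet_derivative f (at x) v \<bullet> i)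
         *\<^sub>R frechet_derivative g (at (f x)) i)) (at x)" if "x \<in> S" for x
    proof -
      note g = class_C_SucD[OF Suc.prems(2) T[OF that]]
      have "((\<lambda>x. g (f x)) has_derivative
         (\<lambda>v. frechet_derivative g (at (f x)) (frechet_derivative f (at x) v))) (at x)"
        by (rule has_derivative_compose[OF class_C_SucD[OF Suc.prems(1) that] g])
      then show ?thesis
        by (rule has_derivative_eq_rhs) (rule ext, rule linear_eq_sum_Basis[OF has_derivative_linear[OF g]])
    qed
    show "class_C k S (\<lambda>x. \<Sum>i\<in>Basis. (frechet_derivative f (at x) v \<bullet> i)
         *\<^sub>R frechet_derivative g (at (f x)) i)" for v
    proof (intro class_C_sum[OF assms(1)] class_C_bilinear[OF bounded_bilinear_scaleR assms(1)])
      show "class_C k S (\<lambda>x. frechet_derivative f (at x) v \<bullet> i)" for i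
        using Suc.prems(1)
        by (intro class_C_bilinear[OF bounded_bilinear_inner assms(1)] class_C_const) simp
      show "class_C k S (\<lambda>x. frechet_derivative g (at (f x)) i)" for i
        using Suc.prems(2) by (intro Suc.IH[OF f]) simp
    qed
  qed
qed

text \<open>The derivative - (1/f) Df (1/f) contains 1/f itself, so the induction hypothesis at
  level \<open>k\<close> feeds level \<open>Suc k\<close>.\<close>

lemma class_C_inverse:
  fixes f :: "'e::real_normed_vector \<Rightarrow> real"
  assumes "open S" "class_C k S f" "\<And>x. x \<in> S \<Longrightarrow> f x \<noteq> 0"
  shows "class_C k S (\<lambda>x. inverse (f x))"
  using assms(2)
proof (induction k)
  case 0
  then show ?case using assms(3) by (auto intro: continuous_intros)
next
  case (Suc k)
  note mult = class_C_bilinear[OF bounded_bilinear_mult assms(1)]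
  show ?case
  proof (rule class_C_SucI[OF assms(1)])
    show "((\<lambda>x. inverse (f x)) has_derivative
        (\<lambda>v. - 1 * (inverse (f x) * frechet_derivative f (at x) v * inverse (f x)))) (at x)"
      if "x \<in> S" for x
      using Deriv.has_derivative_inverse[OF assms(3)[OF that] class_C_SucD[OF Suc.prems that]] by simp
    show "class_C k S (\<lambda>x. - 1 * (inverse (f x) * frechet_derivative f (at x) v * inverse (f x)))" for v
      using Suc.prems Suc.IH[OF class_C_Suc_imp[OF Suc.prems]] by (intro mult class_C_const) simp_all
  qed
qed

lemma class_C_infD: "class_C_inf S f \<Longrightarrow> class_C k S f"
  by (simp add: class_C_inf_def)

lemma class_C_inf_cong_on:
  "open S \<Longrightarrow> (\<And>x. x \<in> S \<Longrightarrow> f x = g x) \<Longrightarrow> class_C_inf S f \<Longrightarrow> class_C_inf S g"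
  unfolding class_C_inf_def using class_C_cong_on by blast

lemma class_C_inf_has_derivative:
  "class_C_inf S f \<Longrightarrow> x \<in> S \<Longrightarrow> (f has_derivative frechet_derivative f (at x)) (at x)"
  unfolding class_C_inf_def using class_C_SucD by blast

lemma class_C_inf_linear_derivative:
  "class_C_inf S f \<Longrightarrow> x \<in> S \<Longrightarrow> linear (frechet_derivative f (at x))"
  by (rule has_derivative_linear[OF class_C_inf_has_derivative])

lemma class_C_inf_continuous_on: "class_C_inf S f \<Longrightarrow> continuous_on S f"
  using class_C_infD[of S f 0] by simp

lemma class_C_inf_directional:
  "class_C_inf S f \<Longrightarrow> class_C_inf S (\<lambda>x. frechet_derivative f (at x) v)"
  unfolding class_C_inf_def by (metis class_C.simps(2))

lemma class_C_inf_subset: "class_C_inf S f \<Longrightarrow> T \<subseteq> S \<Longrightarrow> class_C_inf T f"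
  unfolding class_C_inf_def using class_C_subset by blast

lemma class_C_inf_local:
  assumes "\<And>x. x \<in> S \<Longrightarrow> \<exists>T. open T \<and> x \<in> T \<and> class_C_inf T f"
  shows "class_C_inf S f"
  unfolding class_C_inf_def
proof
  show "class_C k S f" for k
    by (rule class_C_local) (use assms class_C_infD in blast)
qed

lemma class_C_inf_const: "class_C_inf S (\<lambda>x. c)"
  by (simp add: class_C_inf_def class_C_const)

lemma class_C_inf_bounded_linear: "bounded_linear f \<Longrightarrow> class_C_inf S f"
  by (simp add: class_C_inf_def class_C_bounded_linear)

lemma class_C_inf_id: "class_C_inf S (\<lambda>x. x)"
  by (rule class_C_inf_bounded_linear[OF bounded_linear_ident])

lemma class_C_inf_add:
  "open S \<Longrightarrow> class_C_inf S f \<Longrightarrow> class_C_inf S g \<Longrightarrow> class_C_inf S (\<lambda>x. f x + g x)"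
  by (simp add: class_C_inf_def class_C_add)

lemma class_C_inf_sum:
  "open S \<Longrightarrow> (\<And>i. i \<in> I \<Longrightarrow> class_C_inf S (f i)) \<Longrightarrow> class_C_inf S (\<lambda>x. \<Sum>i\<in>I. f i x)"
  by (simp add: class_C_inf_def class_C_sum)

lemma class_C_inf_bilinear:
  "bounded_bilinear P \<Longrightarrow> open S \<Longrightarrow> class_C_inf S f \<Longrightarrow> class_C_inf S g \<Longrightarrow>
   class_C_inf S (\<lambda>x. P (f x) (g x))"
  by (simp add: class_C_inf_def class_C_bilinear)

lemmas class_C_inf_inner = class_C_inf_bilinear[OF bounded_bilinear_inner]
  and class_C_inf_mult = class_C_inf_bilinear[OF bounded_bilinear_mult]
  and class_C_inf_scaleR = class_C_inf_bilinear[OF bounded_bilinear_scaleR]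

lemma class_C_inf_compose:
  fixes g :: "'e::euclidean_space \<Rightarrow> 'f::real_normed_vector"
  assumes "open S" "open T" "class_C_inf S f" "class_C_inf T g" "f ` S \<subseteq> T"
  shows "class_C_inf S (\<lambda>x. g (f x))"
  unfolding class_C_inf_def
  using class_C_compose[OF assms(1,2) class_C_infD[OF assms(3)] class_C_infD[OF assms(4)] assms(5)]
  by blast

lemma class_C_inf_linear_compose:
  fixes f :: "'d::real_normed_vector \<Rightarrow> 'e::euclidean_space"
  assumes "open S" "class_C_inf S f" "bounded_linear L"
  shows "class_C_inf S (\<lambda>x. L (f x))"
  using class_C_inf_compose[OF assms(1) open_UNIV assms(2) class_C_inf_bounded_linear[OF assms(3)]]
  by simp

lemma class_C_inf_diff:
  fixes f :: "'d::real_normed_vector \<Rightarrow> 'e::euclidean_space"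
  assumes "open S" "class_C_inf S f" "class_C_inf S g"
  shows "class_C_inf S (\<lambda>x. f x - g x)"
  using class_C_inf_add[OF assms(1,2) class_C_inf_linear_compose[OF assms(1,3), of uminus]]
  by (simp add: bounded_linear_minus bounded_linear_ident)

lemma class_C_inf_Pair:
  fixes f :: "'d::real_normed_vector \<Rightarrow> 'e::euclidean_space" and g :: "'d \<Rightarrow> 'f::euclidean_space"
  assumes "open S" "class_C_inf S f" "class_C_inf S g"
  shows "class_C_inf S (\<lambda>x. (f x, g x))"
proof -
  have "bounded_linear (\<lambda>x::'e. (x, 0::'f))" "bounded_linear (\<lambda>x::'f. (0::'e, x))"
    by (auto intro: bounded_linear_Pair bounded_linear_ident bounded_linear_zero)
  from class_C_inf_add[OF assms(1) class_C_inf_linear_compose[OF assms(1,2) this(1)]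
      class_C_inf_linear_compose[OF assms(1,3) this(2)]]
  show ?thesis by simp
qed

lemma class_C_inf_componentwise:
  fixes f :: "'d::real_normed_vector \<Rightarrow> 'e::euclidean_space"
  assumes "open S" "\<And>i. i \<in> Basis \<Longrightarrow> class_C_inf S (\<lambda>x. f x \<bullet> i)"
  shows "class_C_inf S f"
proof -
  have "class_C_inf S (\<lambda>x. \<Sum>i\<in>Basis. (f x \<bullet> i) *\<^sub>R i)"
    using assms by (intro class_C_inf_sum class_C_inf_scaleR class_C_inf_const)
  then show ?thesis by (simp add: euclidean_representation)
qed

lemma class_C_inf_inverse:
  fixes f :: "'e::real_normed_vector \<Rightarrow> real"
  assumes "open S" "class_C_inf S f" "\<And>x. x \<in> S \<Longrightarrow> f x \<noteq> 0"
  shows "class_C_inf S (\<lambda>x. inverse (f x))"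
  using assms by (simp add: class_C_inf_def class_C_inverse)

text \<open>For directions \<open>k x\<close> that vary with the point, as in the transition maps of
  the tangent bundle and in the coordinate form of \<open>vertical_endo\<close>.\<close>

lemma class_C_inf_derivative:
  fixes f :: "'e::euclidean_space \<Rightarrow> 'f::real_normed_vector"
  assumes "open S" "open T" "class_C_inf T f" "class_C_inf S h" "class_C_inf S k" "h ` S \<subseteq> T"
  shows "class_C_inf S (\<lambda>x. frechet_derivative f (at (h x)) (k x))"
proof (rule class_C_inf_cong_on[OF assms(1)])
  show "class_C_inf S (\<lambda>x. \<Sum>i\<in>Basis. (k x \<bullet> i) *\<^sub>R frechet_derivative f (at (h x)) i)"
    using assms
    by (intro class_C_inf_sum class_C_inf_scaleR class_C_inf_inner class_C_inf_const
        class_C_inf_compose[OF assms(1,2,4) class_C_inf_directional]) auto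
  show "(\<Sum>i\<in>Basis. (k x \<bullet> i) *\<^sub>R frechet_derivative f (at (h x)) i) =
      frechet_derivative f (at (h x)) (k x)" if "x \<in> S" for x
    by (rule linear_eq_sum_Basis[OF class_C_inf_linear_derivative[OF assms(3)], symmetric])
      (use that assms(6) in blast)
qed

section \<open>Smooth bump functions\<close>

text \<open>The functions exp(-1/t) / t^n for t > 0, extended by 0. Derivatives of members of this
  family are combinations of members with larger \<open>n\<close>, which turns smoothness into an
  induction over the order with \<open>n\<close> arbitrary.\<close>

definition flat :: "nat \<Rightarrow> real \<Rightarrow> real" where
  "flat n t = (if t > 0 then inverse t ^ n * exp (- inverse t) else 0)"

text \<open>On the right of 0, the substitution s = 1/t turns the limit into that of s^n exp(-s) at
  infinity; on the left the function is 0.\<close>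

lemma flat_tendsto_0: "(flat n \<longlongrightarrow> 0) (at 0)"
proof -
  have "((\<lambda>s::real. s ^ n * exp (- s)) \<longlongrightarrow> 0) at_top"
    using tendsto_power_div_exp_0[of n] by (simp add: exp_minus field_simps)
  from filterlim_compose[OF this filterlim_inverse_at_top_right]
  have "(flat n \<longlongrightarrow> 0) (at_right 0)"
    by (rule Lim_transform_eventually) (auto simp: flat_def eventually_at_right_less eventually_at_filter)
  moreover have "(flat n \<longlongrightarrow> 0) (at_left 0)"
    by (rule Lim_transform_eventually[OF tendsto_const]) (auto simp: flat_def eventually_at_filter)
  ultimately show ?thesis by (simp add: filterlim_at_split)
qed

lemma flat_has_derivative:
  "(flat n has_real_derivative flat (n + 2) t - real n * flat (n + 1) t) (at t)"
proof -
  consider "t > 0" | "t < 0" | "t = 0" by linarith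
  then show ?thesis
  proof cases
    case 1
    have "((\<lambda>t. inverse t ^ n) has_real_derivative - (real n * inverse t ^ (n + 1))) (at t)"
    proof -
      have "((\<lambda>t. inverse t ^ n) has_real_derivative
          real n * (- (inverse t ^ Suc (Suc 0)) * inverse t ^ (n - Suc 0))) (at t)"
        by (rule DERIV_power[OF DERIV_inverse]) (use 1 in simp)
      then show ?thesis by (cases n) (simp_all add: algebra_simps)
    qed
    moreover have "((\<lambda>t. exp (- inverse t)) has_real_derivative
        exp (- inverse t) * inverse t ^ 2) (at t)"
      using 1 by (auto intro!: derivative_eq_intros simp: power2_eq_square)
    ultimately have "((\<lambda>t. inverse t ^ n * exp (- inverse t)) has_real_derivative
        - (real n * inverse t ^ (n + 1)) * exp (- inverse t)
        + exp (- inverse t) * inverse t ^ 2 * inverse t ^ n) (at t)"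
      by (rule DERIV_mult)
    then have "((\<lambda>t. inverse t ^ n * exp (- inverse t)) has_real_derivative
        flat (n + 2) t - real n * flat (n + 1) t) (at t)"
      using 1 by (simp add: flat_def algebra_simps power2_eq_square)
    then show ?thesis
      by (rule has_field_derivative_transform_within_open[of _ _ _ "{0<..}"]) (use 1 in \<open>auto simp: flat_def\<close>)
  next
    case 2
    have "((\<lambda>t. 0) has_real_derivative flat (n + 2) t - real n * flat (n + 1) t) (at t)"
      using 2 by (simp add: flat_def)
    then show ?thesis
      by (rule has_field_derivative_transform_within_open[of _ _ _ "{..<0}"]) (use 2 in \<open>auto simp: flat_def\<close>)
  next
    case 3
    \<comment> \<open>The difference quotient of \<open>flat n\<close> at 0 is
      \<open>flat (Suc n)\<close>, so the limit above gives the derivative.\<close>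
    have "((\<lambda>h. (flat n (0 + h) - flat n 0) / h) \<longlongrightarrow> 0) (at 0)"
      by (rule Lim_transform_eventually[OF flat_tendsto_0[of "Suc n"]])
        (auto simp: flat_def eventually_at_filter field_simps)
    then show ?thesis using 3 by (simp add: DERIV_def flat_def)
  qed
qed

lemma class_C_inf_flat: "class_C_inf UNIV (flat n)"
proof -
  have "class_C k UNIV (flat n)" for k
  proof (induction k arbitrary: n)
    case 0
    show ?case
      using flat_has_derivative by (auto intro!: continuous_at_imp_continuous_on DERIV_isCont)
  next
    case (Suc k)
    show ?case
    proof (rule class_C_SucI)
      show "(flat n has_derivative (\<lambda>v. (flat (n + 2) t + (- real n) * flat (n + 1) t) * v)) (at t)" for t
        using flat_has_derivative[of n t] by (simp add: has_field_derivative_def)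
      show "class_C k UNIV (\<lambda>t. (flat (n + 2) t + (- real n) * flat (n + 1) t) * v)" for v
        using Suc by (intro class_C_bilinear[OF bounded_bilinear_mult] class_C_add class_C_const) auto
    qed simp
  qed
  then show ?thesis by (simp add: class_C_inf_def)
qed

lemma smooth_bump_exists:
  fixes x0 :: "'e::euclidean_space"
  assumes "r > 0"
  obtains b :: "'e \<Rightarrow> real" where
    "class_C_inf UNIV b" "\<And>x. x \<in> ball x0 (r / 2) \<Longrightarrow> b x = 1" "\<And>x. x \<notin> cball x0 r \<Longrightarrow> b x = 0"
proof
  \<comment> \<open>A smooth step, 0 for t \<le> 0 and 1 for t \<ge> 1. Its denominator is positive
    because t and 1 - t are never both \<le> 0.\<close>
  define H where "H t = flat 0 t * inverse (flat 0 t + flat 0 (1 - t))" for t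
  \<comment> \<open>The value is \<le> 0 outside the ball of radius \<open>r\<close>. The factor 2
    makes it \<ge> 1 wherever the squared distance is at most half of the square of
    \<open>r\<close>, which covers the ball of radius r/2.\<close>
  define q where "q x = 2 / r\<^sup>2 * (r\<^sup>2 - (x - x0) \<bullet> (x - x0))" for x
  have pos: "flat 0 t + flat 0 (1 - t) \<noteq> 0" for t
    by (smt (verit) exp_gt_zero flat_def mult_pos_pos power_0 zero_less_one)
  have s: "class_C_inf UNIV (\<lambda>t. flat 0 (1 - t))"
    using class_C_inf_compose[OF open_UNIV open_UNIV
        class_C_inf_diff[OF open_UNIV class_C_inf_const class_C_inf_id] class_C_inf_flat] by simp
  have H: "class_C_inf UNIV H"
    unfolding H_def using pos
    by (intro class_C_inf_mult class_C_inf_inverse class_C_inf_add class_C_inf_flat s) auto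
  have q: "class_C_inf UNIV q"
    unfolding q_def
    by (intro class_C_inf_mult class_C_inf_diff class_C_inf_inner class_C_inf_const class_C_inf_id) auto
  show "class_C_inf UNIV (\<lambda>x. H (q x))"
    using class_C_inf_compose[OF open_UNIV open_UNIV q H] by simp
  have H0: "H t = 0" if "t \<le> 0" for t using that by (simp add: H_def flat_def)
  have H1: "H t = 1" if "t \<ge> 1" for t using that by (simp add: H_def flat_def)
  have d: "(x - x0) \<bullet> (x - x0) = (dist x0 x)\<^sup>2" for x
    by (simp add: dot_square_norm dist_norm norm_minus_commute)
  show "H (q x) = 1" if "x \<in> ball x0 (r / 2)" for x
  proof (rule H1)
    have "(dist x0 x)\<^sup>2 \<le> (r / 2)\<^sup>2" using that by (intro power_mono) auto
    then have "4 * (dist x0 x)\<^sup>2 \<le> r\<^sup>2" by (simp add: power_divide)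
    then have "2 * (dist x0 x)\<^sup>2 \<le> r\<^sup>2" using zero_le_power2[of "dist x0 x"] by linarith
    then show "1 \<le> q x" using assms by (simp add: q_def d field_simps)
  qed
  show "H (q x) = 0" if "x \<notin> cball x0 r" for x
  proof (rule H0)
    have "r\<^sup>2 \<le> (dist x0 x)\<^sup>2" using that assms by (intro power_mono) auto
    then show "q x \<le> 0" unfolding q_def d by (intro mult_nonneg_nonpos) auto
  qed
qed

text \<open>\<open>N\<close> and the complement of \<open>K\<close> cover the space, and on the
  latter the product is identically 0, whatever \<open>h\<close> does outside
  \<open>N\<close>.\<close>

lemma class_C_inf_bump_mult:
  fixes b :: "'e::euclidean_space \<Rightarrow> real"
  assumes "class_C_inf UNIV b" "\<And>x. x \<notin> K \<Longrightarrow> b x = 0" "closed K" "K \<subseteq> N" "open N"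
    and "class_C_inf N h"
  shows "class_C_inf S (\<lambda>x. b x * h x)"
proof (rule class_C_inf_local)
  fix x
  show "\<exists>T. open T \<and> x \<in> T \<and> class_C_inf T (\<lambda>x. b x * h x)"
  proof (cases "x \<in> N")
    case True
    have "class_C_inf N (\<lambda>x. b x * h x)"
      using class_C_inf_subset[OF assms(1)] assms(5,6) by (intro class_C_inf_mult) auto
    then show ?thesis using True assms(5) by blast
  next
    case False
    have "class_C_inf (- K) (\<lambda>x. b x * h x)"
      by (rule class_C_inf_cong_on[OF _ _ class_C_inf_const[of _ 0]]) (use assms(2,3) in auto)
    then show ?thesis using False assms(3,4) by (intro exI[of _ "- K"]) auto
  qed
qed

section \<open>Parameter integrals and Hadamard's lemma\<close>

text \<open>Differentiation under the integral sign replaces \<open>g\<close> by its derivative in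
  the direction \<open>(v, 0)\<close>, again an integrand of this kind but one class lower. The open
  set \<open>W\<close> leaves room around the compact parameter interval, since
  \<open>class_C\<close> asks for derivatives in all variables.\<close>

lemma class_C_param_integral:
  fixes g :: "'e::euclidean_space \<times> real \<Rightarrow> real"
  assumes "open S" "convex S" "open W" "S \<times> {0..1} \<subseteq> W" "class_C k W g"
  shows "class_C k S (\<lambda>x. integral {0..1} (\<lambda>t. g (x, t)))"
  using assms(5)
proof (induction k arbitrary: g)
  case 0
  have "continuous_on (S \<times> cbox 0 1) (\<lambda>(x, t). g (x, t))"
    using 0 assms(4) by (auto intro: continuous_on_subset)
  then show ?case using integral_continuous_on_param by fastforce
next
  case (Suc k)
  let ?D = "\<lambda>x t v. frechet_derivative g (at (x, t)) (v, 0)"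
  \<comment> \<open>The Leibniz rule wants the derivative as a continuous map into bounded linear
    maps; its continuity is reduced to that of directional derivatives.\<close>
  define B where "B x t = Blinfun (?D x t)" for x t
  have W: "(x, t) \<in> W" if "x \<in> S" "t \<in> {0..1}" for x t using that assms(4) by auto
  have der: "((\<lambda>x. g (x, t)) has_derivative ?D x t) (at x)" if "x \<in> S" "t \<in> {0..1}" for x t
    by (rule has_derivative_compose[of "\<lambda>x. (x, t)" "\<lambda>v. (v, 0)" x UNIV g,
          OF _ class_C_SucD[OF Suc.prems W[OF that]]])
      (auto intro!: derivative_eq_intros)
  have B: "blinfun_apply (B x t) = ?D x t" if "x \<in> S" "t \<in> {0..1}" for x t
    unfolding B_def
    by (rule bounded_linear_Blinfun_apply[OF has_derivative_bounded_linear[OF der[OF that]]])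
  have cont_D: "continuous_on (S \<times> {0..1}) (\<lambda>(x, t). ?D x t v)" for v
  proof -
    have "class_C k W (\<lambda>y. frechet_derivative g (at y) (v, 0))" using Suc.prems by simp
    then have "continuous_on W (\<lambda>y. frechet_derivative g (at y) (v, 0))" by (rule class_C_continuous_on)
    then show ?thesis using assms(4) by (auto simp: case_prod_beta' intro: continuous_on_subset)
  qed
  have cont_B: "continuous_on (S \<times> {0..1}) (\<lambda>(x, t). B x t)"
  proof (rule continuous_on_blinfun_componentwise)
    show "continuous_on (S \<times> {0..1}) (\<lambda>z. blinfun_apply (case z of (x, t) \<Rightarrow> B x t) i)" for i
      by (rule continuous_on_eq[OF cont_D[of i]]) (auto simp: B)
  qed
  have cont_g: "continuous_on {0..1} (\<lambda>t. g (x, t))" if "x \<in> S" for x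
    by (rule continuous_on_compose2[OF class_C_continuous_on[OF Suc.prems]])
      (use that W in \<open>auto intro!: continuous_intros\<close>)
  have leib: "((\<lambda>x. integral {0..1} (\<lambda>t. g (x, t))) has_derivative integral {0..1} (B x)) (at x)"
    if "x \<in> S" for x
  proof -
    have "((\<lambda>x. integral (cbox 0 1) (\<lambda>t. g (x, t))) has_derivative integral (cbox 0 1) (B x))
        (at x within S)"
    proof (rule leibniz_rule[OF _ _ _ that assms(2)])
      show "((\<lambda>x. g (x, t)) has_derivative blinfun_apply (B x t)) (at x within S)"
        if "x \<in> S" "t \<in> cbox 0 1" for x t
        using der[of x t] B[of x t] that by (simp add: has_derivative_at_withinI)
      show "(\<lambda>t. g (x, t)) integrable_on cbox 0 1" if "x \<in> S" for x
        using integrable_continuous_real[OF cont_g[OF that]] by simp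
    qed (use cont_B in simp)
    then show ?thesis by (simp add: at_within_open[OF that assms(1)])
  qed
  have eval: "blinfun_apply (integral {0..1} (B x)) v = integral {0..1} (\<lambda>t. ?D x t v)"
    if "x \<in> S" for x v
  proof -
    have "continuous_on {0..1} (B x)"
      using continuous_on_compose2[OF cont_B, of "{0..1}" "\<lambda>t. (x, t)"] that
        continuous_on_Pair[OF continuous_on_const continuous_on_id, of "{0..1}" x]
      by (auto simp: id_def)
    then have "B x integrable_on {0..1}" by (rule integrable_continuous_real)
    then have "blinfun_apply (integral {0..1} (B x)) v = integral {0..1} (\<lambda>t. blinfun_apply (B x t) v)"
      by (rule blinfun_apply_integral)
    also have "\<dots> = integral {0..1} (\<lambda>t. ?D x t v)"
      by (rule integral_cong) (simp add: B that)
    finally show ?thesis .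
  qed
  show ?case
  proof (rule class_C_SucI[OF assms(1) leib])
    show "class_C k S (\<lambda>x. blinfun_apply (integral {0..1} (B x)) v)" for v
    proof (rule class_C_cong_on[OF assms(1)])
      show "class_C k S (\<lambda>x. integral {0..1} (\<lambda>t. ?D x t v))"
        using Suc.IH[of "\<lambda>y. frechet_derivative g (at y) (v, 0)"] Suc.prems by simp
    qed (simp add: eval)
  qed
qed

text \<open>Fundamental theorem of calculus along the segment from \<open>x0\<close> to
  \<open>x\<close>: \<open>h i x\<close> is the average of the \<open>i\<close>-th partial
  derivative over that segment, hence smooth in \<open>x\<close> as a parameter integral.\<close>

lemma hadamard:
  fixes f :: "'e::euclidean_space \<Rightarrow> real"
  assumes "r > 0" "class_C_inf (ball x0 r) f"
  obtains h where "\<And>i. i \<in> Basis \<Longrightarrow> class_C_inf (ball x0 r) (h i)"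
    and "\<And>i. i \<in> Basis \<Longrightarrow> h i x0 = frechet_derivative f (at x0) i"
    and "\<And>x. x \<in> ball x0 r \<Longrightarrow> f x = f x0 + (\<Sum>i\<in>Basis. ((x - x0) \<bullet> i) * h i x)"
proof
  define l where "l = (\<lambda>(x, t::real). x0 + t *\<^sub>R (x - x0))"
  \<comment> \<open>An open neighbourhood of the ball times [0, 1] on which the integrand is smooth
    in both variables.\<close>
  define W where "W = l -` ball x0 r"
  define h where "h i x = integral {0..1} (\<lambda>t. frechet_derivative f (at (l (x, t))) i)" for i x
  have l: "class_C_inf UNIV l"
    unfolding l_def case_prod_beta'
    by (intro class_C_inf_add class_C_inf_scaleR class_C_inf_diff class_C_inf_const
        class_C_inf_bounded_linear bounded_linear_fst bounded_linear_snd open_UNIV)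
  have W: "open W"
    unfolding W_def by (rule open_vimage[OF open_ball class_C_inf_continuous_on[OF l]])
  have seg: "l (x, t) \<in> ball x0 r" if "x \<in> ball x0 r" "t \<in> {0..1}" for x t
  proof -
    have "dist x0 (l (x, t)) = t * dist x0 x"
      using that by (simp add: l_def dist_norm norm_minus_commute)
    also have "\<dots> \<le> 1 * dist x0 x" using that by (intro mult_right_mono) auto
    finally show ?thesis using that by simp
  qed
  show "class_C_inf (ball x0 r) (h i)" if "i \<in> Basis" for i
  proof -
    have "class_C_inf W (\<lambda>y. frechet_derivative f (at (l y)) i)"
      by (rule class_C_inf_compose[OF W open_ball class_C_inf_subset[OF l] class_C_inf_directional[OF assms(2)]])
        (auto simp: W_def)
    moreover have "ball x0 r \<times> {0..1} \<subseteq> W" using seg by (auto simp: W_def)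
    ultimately show ?thesis
      unfolding class_C_inf_def h_def
      using class_C_param_integral[OF open_ball convex_ball W] by blast
  qed
  show "h i x0 = frechet_derivative f (at x0) i" for i
    by (simp add: h_def l_def)
  show "f x = f x0 + (\<Sum>i\<in>Basis. ((x - x0) \<bullet> i) * h i x)" if x: "x \<in> ball x0 r" for x
  proof -
    let ?d = "\<lambda>t i. frechet_derivative f (at (l (x, t))) i"
    have "((\<lambda>t. f (l (x, t))) has_vector_derivative ?d t (x - x0)) (at t within {0..1})"
      if "t \<in> {0..1}" for t
    proof -
      have "((\<lambda>t. l (x, t)) has_derivative (\<lambda>s. s *\<^sub>R (x - x0))) (at t within {0..1})"
        unfolding l_def by (auto intro!: derivative_eq_intros)
      from has_derivative_compose[OF this class_C_inf_has_derivative[OF assms(2) seg[OF x that]]]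
      show ?thesis
        by (simp add: has_vector_derivative_def linear_scale
            [OF class_C_inf_linear_derivative[OF assms(2) seg[OF x that]]])
    qed
    then have "((\<lambda>t. ?d t (x - x0)) has_integral (f (l (x, 1)) - f (l (x, 0)))) {0..1}"
      by (intro fundamental_theorem_of_calculus) auto
    then have "f x - f x0 = integral {0..1} (\<lambda>t. ?d t (x - x0))"
      by (simp add: integral_unique l_def)
    also have "\<dots> = integral {0..1} (\<lambda>t. \<Sum>i\<in>Basis. ((x - x0) \<bullet> i) * ?d t i)"
      using linear_eq_sum_Basis[OF class_C_inf_linear_derivative[OF assms(2) seg[OF x]], of _ "x - x0"]
      by (intro integral_cong) simp
    also have "\<dots> = (\<Sum>i\<in>Basis. integral {0..1} (\<lambda>t. ((x - x0) \<bullet> i) * ?d t i))"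
    proof (rule integral_sum)
      show "(\<lambda>t. ((x - x0) \<bullet> i) * ?d t i) integrable_on {0..1}" for i
      proof (rule integrable_continuous_real, intro continuous_intros)
        show "continuous_on {0..1} (\<lambda>t. ?d t i)"
        proof (rule continuous_on_compose2[OF class_C_inf_continuous_on
                [OF class_C_inf_directional[OF assms(2)]], of _ "\<lambda>t. l (x, t)"])
          show "continuous_on {0..1} (\<lambda>t. l (x, t))"
            unfolding l_def by (auto intro!: continuous_intros)
        qed (use seg x in auto)
      qed
    qed simp
    finally show ?thesis by (simp add: h_def)
  qed
qed

section \<open>Tangent vectors and vector fields on a Hausdorff manifold\<close>

lemma tangent_spaceD:
  assumes "v \<in> tangent_space A p"
  shows tangent_add: "smooth_fun A f \<Longrightarrow> smooth_fun A g \<Longrightarrow> v (\<lambda>q. f q + g q) = v f + v g"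
    and tangent_scale: "smooth_fun A f \<Longrightarrow> v (\<lambda>q. c * f q) = c * v f"
    and tangent_mult: "smooth_fun A f \<Longrightarrow> smooth_fun A g \<Longrightarrow>
      v (\<lambda>q. f q * g q) = f p * v g + g p * v f"
    and tangent_nonsmooth: "\<not> smooth_fun A f \<Longrightarrow> v f = 0"
  using assms by (auto simp: tangent_space_def)

lemma zero_in_tangent_space: "(\<lambda>_. 0) \<in> tangent_space A p"
  by (simp add: tangent_space_def)

lemma tangent_space_add:
  "v \<in> tangent_space A p \<Longrightarrow> w \<in> tangent_space A p \<Longrightarrow> (\<lambda>f. v f + w f) \<in> tangent_space A p"
  by (simp add: tangent_space_def algebra_simps)

lemma tangent_space_scale: "v \<in> tangent_space A p \<Longrightarrow> (\<lambda>f. c * v f) \<in> tangent_space A p"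
  by (simp add: tangent_space_def algebra_simps)

lemma tangent_space_diff:
  "v \<in> tangent_space A p \<Longrightarrow> w \<in> tangent_space A p \<Longrightarrow> (\<lambda>f. v f - w f) \<in> tangent_space A p"
  using tangent_space_add[OF _ tangent_space_scale[of w A p "- 1"], of v] by simp

lemma smooth_fun_const: "smooth_fun A (\<lambda>_. c)"
  by (auto simp: smooth_fun_def comp_def class_C_inf_const)

lemma tangent_zero:
  assumes "v \<in> tangent_space A p"
  shows "v (\<lambda>_. 0) = 0"
  using tangent_scale[OF assms smooth_fun_const, of 0] by simp

lemma tangent_const:
  assumes "v \<in> tangent_space A p"
  shows "v (\<lambda>_. c) = 0"
proof -
  have "v (\<lambda>_. 1) = 0"
    using tangent_mult[OF assms smooth_fun_const smooth_fun_const, of 1 1] by simp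
  then show ?thesis using tangent_scale[OF assms smooth_fun_const, of c 1] by simp
qed

lemma vector_field_tangent: "vector_field A X \<Longrightarrow> p \<in> points A \<Longrightarrow> X p \<in> tangent_space A p"
  and vector_field_outside: "vector_field A X \<Longrightarrow> p \<notin> points A \<Longrightarrow> X p = (\<lambda>_. 0)"
  and vector_field_smooth: "vector_field A X \<Longrightarrow> smooth_fun A f \<Longrightarrow> smooth_fun A (\<lambda>p. X p f)"
  by (auto simp: vector_field_def)

lemma vector_field_zero: "vector_field A (\<lambda>_ _. 0)"
  by (simp add: vector_field_def zero_in_tangent_space smooth_fun_const)

text \<open>Linearity over smooth functions, the algebraic form of tensoriality. It implies the
  pointwise dependence that \<open>value_at\<close> presupposes; see
  \<open>tensorial_cong_at\<close>.\<close>

definition tensorial :: "('a, 'e::euclidean_space) chart set \<Rightarrow> ('a vfield \<Rightarrow> 'a vfield) \<Rightarrow> bool" where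
  "tensorial A T \<longleftrightarrow>
     (\<forall>X Y. vector_field A X \<longrightarrow> vector_field A Y \<longrightarrow> T (fadd X Y) = fadd (T X) (T Y)) \<and>
     (\<forall>h X. smooth_fun A h \<longrightarrow> vector_field A X \<longrightarrow> T (fmul h X) = fmul h (T X))"

lemma tensorialD:
  assumes "tensorial A T"
  shows tensorial_add: "vector_field A X \<Longrightarrow> vector_field A Y \<Longrightarrow> T (fadd X Y) = fadd (T X) (T Y)"
    and tensorial_mul: "smooth_fun A h \<Longrightarrow> vector_field A X \<Longrightarrow> T (fmul h X) = fmul h (T X)"
  using assms by (auto simp: tensorial_def)

text \<open>Interpreted both for \<open>M\<close> and for \<open>slit M\<close>. Hausdorffness
  enters through \<open>closedin_chart_compact\<close>, on which extension by zero rests.\<close>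

locale hausdorff_atlas =
  fixes A :: "('a, 'e::euclidean_space) chart set"
  assumes atlas: "smooth_atlas A"
    and hausdorff: "Hausdorff_space (atlas_topology A)"
begin

lemma chart_inj: "(U, \<phi>) \<in> A \<Longrightarrow> inj_on \<phi> U"
  and chart_open: "(U, \<phi>) \<in> A \<Longrightarrow> open (\<phi> ` U)"
  and chart_overlap_open: "(U, \<phi>) \<in> A \<Longrightarrow> (V, \<psi>) \<in> A \<Longrightarrow> open (\<phi> ` (U \<inter> V))"
  using atlas by (force simp: smooth_atlas_def)+

lemma chart_transition:
  "(U, \<phi>) \<in> A \<Longrightarrow> (V, \<psi>) \<in> A \<Longrightarrow> class_C_inf (\<phi> ` (U \<inter> V)) (\<lambda>x. \<psi> (inv_into U \<phi> x))"
  using atlas by (force simp: smooth_atlas_def comp_def)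

lemma chart_inv: "(U, \<phi>) \<in> A \<Longrightarrow> q \<in> U \<Longrightarrow> inv_into U \<phi> (\<phi> q) = q"
  by (simp add: chart_inj)

lemma chart_subset: "(U, \<phi>) \<in> A \<Longrightarrow> U \<subseteq> points A"
  by (auto simp: points_def)

lemma pointsE:
  assumes "p \<in> points A"
  obtains U \<phi> where "(U, \<phi>) \<in> A" "p \<in> U"
  using assms by (auto simp: points_def)

lemma smooth_funD:
  "smooth_fun A f \<Longrightarrow> (U, \<phi>) \<in> A \<Longrightarrow> class_C_inf (\<phi> ` U) (\<lambda>x. f (inv_into U \<phi> x))"
  by (auto simp: smooth_fun_def comp_def)

lemma smooth_funI:
  "(\<And>U \<phi>. (U, \<phi>) \<in> A \<Longrightarrow> class_C_inf (\<phi> ` U) (\<lambda>x. f (inv_into U \<phi> x))) \<Longrightarrow> smooth_fun A f"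
  by (auto simp: smooth_fun_def comp_def)

lemma smooth_fun_add: "smooth_fun A f \<Longrightarrow> smooth_fun A g \<Longrightarrow> smooth_fun A (\<lambda>q. f q + g q)"
  by (rule smooth_funI) (intro class_C_inf_add chart_open smooth_funD)

lemma smooth_fun_mult: "smooth_fun A f \<Longrightarrow> smooth_fun A g \<Longrightarrow> smooth_fun A (\<lambda>q. f q * g q)"
  by (rule smooth_funI) (intro class_C_inf_mult chart_open smooth_funD)

lemma smooth_fun_scale: "smooth_fun A f \<Longrightarrow> smooth_fun A (\<lambda>q. c * f q)"
  by (intro smooth_fun_mult smooth_fun_const)

lemma smooth_fun_diff: "smooth_fun A f \<Longrightarrow> smooth_fun A g \<Longrightarrow> smooth_fun A (\<lambda>q. f q - g q)"
  using smooth_fun_add[OF _ smooth_fun_scale[of g "- 1"], of f] by simp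

lemma smooth_fun_sum:
  "(\<And>i. i \<in> I \<Longrightarrow> smooth_fun A (f i)) \<Longrightarrow> smooth_fun A (\<lambda>q. \<Sum>i\<in>I. f i q)"
  by (rule smooth_funI) (intro class_C_inf_sum chart_open smooth_funD)

lemma tangent_minus:
  assumes "v \<in> tangent_space A p" "smooth_fun A f" "smooth_fun A g"
  shows "v (\<lambda>q. f q - g q) = v f - v g"
  using tangent_add[OF assms(1,2) smooth_fun_scale[OF assms(3)], of "- 1"]
    tangent_scale[OF assms(1,3), of "- 1"] by simp

lemma tangent_sum:
  assumes "v \<in> tangent_space A p" "\<And>i. i \<in> I \<Longrightarrow> smooth_fun A (f i)"
  shows "v (\<lambda>q. \<Sum>i\<in>I. f i q) = (\<Sum>i\<in>I. v (f i))"
  using assms(2)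
proof (induction I rule: infinite_finite_induct)
  case (insert i I)
  then show ?case
    using tangent_add[OF assms(1) insert.prems[of i] smooth_fun_sum[of I f]] by simp
qed (use tangent_zero[OF assms(1)] in simp_all)

section \<open>Algebra and Lie brackets of vector fields\<close>

lemma vector_field_fadd: "vector_field A X \<Longrightarrow> vector_field A Y \<Longrightarrow> vector_field A (fadd X Y)"
  by (simp add: vector_field_def fadd_def tangent_space_add smooth_fun_add)

lemma vector_field_fsub: "vector_field A X \<Longrightarrow> vector_field A Y \<Longrightarrow> vector_field A (fsub X Y)"
  by (simp add: vector_field_def fsub_def tangent_space_diff smooth_fun_diff)

lemma vector_field_fmul: "smooth_fun A h \<Longrightarrow> vector_field A X \<Longrightarrow> vector_field A (fmul h X)"
  by (simp add: vector_field_def fmul_def tangent_space_scale smooth_fun_mult)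

text \<open>Applying Leibniz twice produces the cross terms (X f) (Y g) and (X g) (Y f); their sum
  is symmetric in \<open>X\<close> and \<open>Y\<close> and cancels in the commutator.\<close>

lemma vector_field_lie_bracket:
  assumes X: "vector_field A X" and Y: "vector_field A Y"
  shows "vector_field A (lie_bracket X Y)"
proof -
  have "lie_bracket X Y p \<in> tangent_space A p" if p: "p \<in> points A" for p
  proof -
    \<comment> \<open>The inner functions must coincide on the whole type before the outer vector is
      applied to them; off \<open>points A\<close> both sides are 0 because \<open>Z\<close>
      is.\<close>
    have fn: "(\<lambda>q. Z q (\<lambda>q. f q + g q)) = (\<lambda>q. Z q f + Z q g)"
      "(\<lambda>q. Z q (\<lambda>q. c * f q)) = (\<lambda>q. c * Z q f)"
      "(\<lambda>q. Z q (\<lambda>q. f q * g q)) = (\<lambda>q. f q * Z q g + g q * Z q f)"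
      if "vector_field A Z" "smooth_fun A f" "smooth_fun A g" for Z f g c
    proof -
      have *: "Z q (\<lambda>q. f q + g q) = Z q f + Z q g \<and> Z q (\<lambda>q. c * f q) = c * Z q f \<and>
          Z q (\<lambda>q. f q * g q) = f q * Z q g + g q * Z q f" for q
        using vector_field_tangent[OF that(1), of q] vector_field_outside[OF that(1), of q] that(2,3)
        by (cases "q \<in> points A") (simp_all add: tangent_add tangent_scale tangent_mult)
      show "(\<lambda>q. Z q (\<lambda>q. f q + g q)) = (\<lambda>q. Z q f + Z q g)"
        "(\<lambda>q. Z q (\<lambda>q. c * f q)) = (\<lambda>q. c * Z q f)"
        "(\<lambda>q. Z q (\<lambda>q. f q * g q)) = (\<lambda>q. f q * Z q g + g q * Z q f)"
        using * by auto
    qed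
    have nonsmooth: "(\<lambda>q. Z q f) = (\<lambda>_. 0)" if "vector_field A Z" "\<not> smooth_fun A f" for Z f
      using vector_field_tangent[OF that(1)] vector_field_outside[OF that(1)]
      by (metis tangent_nonsmooth[OF _ that(2)])
    note t = vector_field_tangent[OF X p] vector_field_tangent[OF Y p]
    note s = vector_field_smooth[OF X] vector_field_smooth[OF Y]
    show ?thesis
      unfolding tangent_space_def lie_bracket_def mem_Collect_eq
    proof (intro conjI allI impI)
      fix f g c assume f: "smooth_fun A f" and g: "smooth_fun A g"
      show "X p (\<lambda>q. Y q (\<lambda>q. f q + g q)) - Y p (\<lambda>q. X q (\<lambda>q. f q + g q)) =
          X p (\<lambda>q. Y q f) - Y p (\<lambda>q. X q f) + (X p (\<lambda>q. Y q g) - Y p (\<lambda>q. X q g))"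
        using f g by (simp add: fn[OF X f g] fn[OF Y f g] t[THEN tangent_add] s)
      show "X p (\<lambda>q. Y q (\<lambda>q. f q * g q)) - Y p (\<lambda>q. X q (\<lambda>q. f q * g q)) =
          f p * (X p (\<lambda>q. Y q g) - Y p (\<lambda>q. X q g)) + g p * (X p (\<lambda>q. Y q f) - Y p (\<lambda>q. X q f))"
        using f g by (simp add: fn[OF X f g] fn[OF Y f g] t[THEN tangent_add] t[THEN tangent_mult]
            s smooth_fun_mult algebra_simps)
    next
      fix c f assume f: "smooth_fun A f"
      show "X p (\<lambda>q. Y q (\<lambda>q. c * f q)) - Y p (\<lambda>q. X q (\<lambda>q. c * f q)) =
          c * (X p (\<lambda>q. Y q f) - Y p (\<lambda>q. X q f))"
        using f by (simp add: fn[OF X f f] fn[OF Y f f] t[THEN tangent_scale] s algebra_simps)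
    next
      fix f assume "\<not> smooth_fun A f"
      from nonsmooth[OF X this] nonsmooth[OF Y this]
      have "X p (\<lambda>q. Y q f) = X p (\<lambda>_. 0)" "Y p (\<lambda>q. X q f) = Y p (\<lambda>_. 0)"
        by (simp_all only:)
      then show "X p (\<lambda>q. Y q f) - Y p (\<lambda>q. X q f) = 0"
        by (simp only: t[THEN tangent_zero] diff_self)
    qed
  qed
  moreover have "smooth_fun A (\<lambda>p. lie_bracket X Y p f)" if "smooth_fun A f" for f
    unfolding lie_bracket_def
    by (rule smooth_fun_diff[OF vector_field_smooth[OF X vector_field_smooth[OF Y that]]
          vector_field_smooth[OF Y vector_field_smooth[OF X that]]])
  moreover have "lie_bracket X Y p = (\<lambda>_. 0)" if "p \<notin> points A" for p
    using vector_field_outside[OF X that] vector_field_outside[OF Y that] by (simp add: lie_bracket_def)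
  ultimately show ?thesis by (simp add: vector_field_def)
qed

text \<open>The second summand comes from Leibniz for the outer \<open>X\<close>. It is what has to
  cancel whenever an operator built from brackets with a spray is shown to be tensorial.\<close>

lemma lie_bracket_fmul:
  assumes X: "vector_field A X" and Y: "vector_field A Y" and h: "smooth_fun A h"
  shows "lie_bracket X (fmul h Y) = fadd (fmul h (lie_bracket X Y)) (fmul (\<lambda>p. X p h) Y)"
proof (intro ext)
  fix p f
  show "lie_bracket X (fmul h Y) p f = fadd (fmul h (lie_bracket X Y)) (fmul (\<lambda>p. X p h) Y) p f"
  proof (cases "p \<in> points A \<and> smooth_fun A f")
    case True
    then show ?thesis
      using tangent_mult[OF vector_field_tangent[OF X] h vector_field_smooth[OF Y]]
      by (simp add: lie_bracket_def fmul_def fadd_def algebra_simps)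
  next
    case False
    have "Y q f = 0 \<and> X q f = 0" if "\<not> smooth_fun A f" for q
      using that vector_field_tangent[OF X] vector_field_outside[OF X]
        vector_field_tangent[OF Y] vector_field_outside[OF Y] tangent_nonsmooth by metis
    then show ?thesis
      using False vector_field_outside[OF X] vector_field_outside[OF Y]
        tangent_zero[OF vector_field_tangent[OF X]] tangent_zero[OF vector_field_tangent[OF Y]]
      by (cases "p \<in> points A") (auto simp: lie_bracket_def fmul_def fadd_def)
  qed
qed

lemma lie_bracket_fadd:
  assumes X: "vector_field A X" and Y: "vector_field A Y" and Z: "vector_field A Z"
  shows "lie_bracket X (fadd Y Z) = fadd (lie_bracket X Y) (lie_bracket X Z)"
proof (intro ext)
  fix p f
  show "lie_bracket X (fadd Y Z) p f = fadd (lie_bracket X Y) (lie_bracket X Z) p f"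
  proof (cases "p \<in> points A \<and> smooth_fun A f")
    case True
    then show ?thesis
      using tangent_add[OF vector_field_tangent[OF X] vector_field_smooth[OF Y] vector_field_smooth[OF Z]]
      by (simp add: lie_bracket_def fadd_def)
  next
    case False
    have "Y q f = 0 \<and> X q f = 0 \<and> Z q f = 0" if "\<not> smooth_fun A f" for q
      using that vector_field_tangent[OF X] vector_field_outside[OF X]
        vector_field_tangent[OF Y] vector_field_outside[OF Y]
        vector_field_tangent[OF Z] vector_field_outside[OF Z] tangent_nonsmooth by metis
    then show ?thesis
      using False vector_field_outside[OF X] vector_field_outside[OF Y] vector_field_outside[OF Z]
        tangent_zero[OF vector_field_tangent[OF X]]
      by (cases "p \<in> points A") (auto simp: lie_bracket_def fadd_def)
  qed
qed

section \<open>Topology of the atlas and cutoff functions\<close>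

lemma openin_atlas: "openin (atlas_topology A) = atlas_open A"
  by (rule openin_atlas_topology[OF atlas])

lemma topspace_atlas: "topspace (atlas_topology A) = points A"
proof -
  have "points A \<inter> U = U" if "(U, \<phi>) \<in> A" for U \<phi> using chart_subset[OF that] by auto
  then have "atlas_open A (points A)" using chart_open by (auto simp: atlas_open_def)
  then show ?thesis by (auto simp: topspace_def openin_atlas atlas_open_def)
qed

text \<open>The inverse chart is continuous, so the image is compact, and compact sets in a
  Hausdorff space are closed.\<close>

lemma closedin_chart_compact:
  assumes c: "(U, \<phi>) \<in> A" and K: "compact K" "K \<subseteq> \<phi> ` U"
  shows "closedin (atlas_topology A) (inv_into U \<phi> ` K)"
proof -
  have "continuous_map (subtopology euclidean (\<phi> ` U)) (atlas_topology A) (inv_into U \<phi>)"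
    unfolding continuous_map_def
  proof (intro conjI allI impI)
    show "inv_into U \<phi> \<in> topspace (subtopology euclidean (\<phi> ` U)) \<rightarrow> topspace (atlas_topology A)"
      using chart_subset[OF c] by (auto simp: topspace_atlas chart_inv[OF c])
    fix W assume "openin (atlas_topology A) W"
    then have "open (\<phi> ` (W \<inter> U))" using c by (auto simp: openin_atlas atlas_open_def)
    moreover have "{x \<in> topspace (subtopology euclidean (\<phi> ` U)). inv_into U \<phi> x \<in> W} = \<phi> ` (W \<inter> U)"
      by (auto simp: chart_inv[OF c])
    ultimately show "openin (subtopology euclidean (\<phi> ` U))
        {x \<in> topspace (subtopology euclidean (\<phi> ` U)). inv_into U \<phi> x \<in> W}"
      by (auto intro: open_subset)
  qed
  then have "compactin (atlas_topology A) (inv_into U \<phi> ` K)"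
    using K by (intro image_compactin[of "subtopology euclidean (\<phi> ` U)"]) (auto simp: compactin_subtopology)
  then show ?thesis by (rule compactin_imp_closedin[OF hausdorff])
qed

text \<open>Near a point of \<open>U\<close> the function is \<open>G\<close> composed with a
  transition map. Near a point outside \<open>U\<close> it vanishes on the complement of the part of
  \<open>U\<close> that corresponds to \<open>K\<close>; that this complement is open is where the
  Hausdorff property is used.\<close>

lemma smooth_fun_chart_extension:
  assumes c: "(U, \<phi>) \<in> A" and K: "compact K" "K \<subseteq> \<phi> ` U"
    and G: "class_C_inf (\<phi> ` U) G" "\<And>x. x \<notin> K \<Longrightarrow> G x = 0"
  shows "smooth_fun A (\<lambda>q. if q \<in> U then G (\<phi> q) else 0)" (is "smooth_fun A ?f")
proof (rule smooth_funI, rule class_C_inf_local)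
  fix V \<psi> y assume d: "(V, \<psi>) \<in> A" and "y \<in> \<psi> ` V"
  then obtain q where q: "q \<in> V" "y = \<psi> q" by auto
  show "\<exists>T. open T \<and> y \<in> T \<and> class_C_inf T (\<lambda>x. ?f (inv_into V \<psi> x))"
  proof (cases "q \<in> U")
    case True
    have "class_C_inf (\<psi> ` (V \<inter> U)) (\<lambda>x. G (\<phi> (inv_into V \<psi> x)))"
      by (rule class_C_inf_compose[OF chart_overlap_open[OF d c] chart_open[OF c] chart_transition[OF d c] G(1)])
        (auto simp: chart_inv[OF d])
    then have "class_C_inf (\<psi> ` (V \<inter> U)) (\<lambda>x. ?f (inv_into V \<psi> x))"
      by (rule class_C_inf_cong_on[OF chart_overlap_open[OF d c], rotated]) (auto simp: chart_inv[OF d])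
    then show ?thesis using chart_overlap_open[OF d c] True q by blast
  next
    case False
    let ?L = "inv_into U \<phi> ` K"
    let ?T = "\<psi> ` ((points A - ?L) \<inter> V)"
    have "openin (atlas_topology A) (points A - ?L)"
      using closedin_chart_compact[OF c K] by (simp add: closedin_def topspace_atlas)
    then have T: "open ?T" using d by (auto simp: openin_atlas atlas_open_def)
    have "?L \<subseteq> U" using K(2) by (auto simp: chart_inv[OF c])
    then have "y \<in> ?T" using q False chart_subset[OF d] by auto
    moreover have "class_C_inf ?T (\<lambda>x. ?f (inv_into V \<psi> x))"
    proof (rule class_C_inf_cong_on[OF T _ class_C_inf_const[of _ 0]])
      fix x assume "x \<in> ?T"
      then obtain p where p: "p \<in> V" "p \<notin> ?L" "x = \<psi> p" by auto
      have "\<phi> p \<notin> K" if "p \<in> U" using p(2) that by (metis chart_inv[OF c] imageI)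
      then show "0 = ?f (inv_into V \<psi> x)" using p G(2) by (simp add: chart_inv[OF d])
    qed
    ultimately show ?thesis using T by blast
  qed
qed

text \<open>The last clause quantifies over \<open>h\<close>, so that one \<open>b\<close> can
  multiply several functions, such as all the coefficients of a vector field.\<close>

lemma cutoff_exists:
  assumes c: "(U, \<phi>) \<in> A" and N: "open N" "N \<subseteq> \<phi> ` U" "x0 \<in> N"
  obtains b \<delta> where "\<delta> > 0" "ball x0 \<delta> \<subseteq> N" "\<And>x. x \<in> ball x0 \<delta> \<Longrightarrow> b x = 1" "\<And>x. x \<notin> N \<Longrightarrow> b x = 0"
    "\<And>h. class_C_inf N h \<Longrightarrow> smooth_fun A (\<lambda>q. if q \<in> U then b (\<phi> q) * h (\<phi> q) else 0)"
proof -
  obtain r where r: "r > 0" "cball x0 r \<subseteq> N"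
    using N(1,3) open_contains_cball by blast
  obtain b :: "'e \<Rightarrow> real" where b: "class_C_inf UNIV b" "\<And>x. x \<in> ball x0 (r / 2) \<Longrightarrow> b x = 1"
      "\<And>x. x \<notin> cball x0 r \<Longrightarrow> b x = 0"
    using smooth_bump_exists[OF r(1)] by blast
  show ?thesis
  proof
    show "r / 2 > 0" using r(1) by simp
    have "ball x0 (r / 2) \<subseteq> cball x0 r" using r(1) by auto
    then show "ball x0 (r / 2) \<subseteq> N" using r(2) by blast
    show "b x = 1" if "x \<in> ball x0 (r / 2)" for x by (rule b(2)[OF that])
    show "b x = 0" if "x \<notin> N" for x using b(3) r(2) that by blast
    show "smooth_fun A (\<lambda>q. if q \<in> U then b (\<phi> q) * h (\<phi> q) else 0)" if "class_C_inf N h" for h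
    proof (rule smooth_fun_chart_extension[OF c, of "cball x0 r" "\<lambda>x. b x * h x"])
      show "class_C_inf (\<phi> ` U) (\<lambda>x. b x * h x)"
        by (rule class_C_inf_bump_mult[OF b(1,3) closed_cball r(2) N(1) that])
    qed (use b(3) r(2) N(2) in auto)
  qed
qed

text \<open>Applied to these globally smooth functions, a tangent vector near the given point
  returns its components; see \<open>coord_vec_coordinate\<close>.\<close>

lemma coordinate_functions:
  assumes c: "(U, \<phi>) \<in> A" and N: "open N" "N \<subseteq> \<phi> ` U" "x0 \<in> N"
  obtains g B where "open B" "x0 \<in> B" "B \<subseteq> N" "\<And>i. smooth_fun A (g i)"
    "\<And>x i. x \<in> B \<Longrightarrow> g i (inv_into U \<phi> x) = x \<bullet> i"
proof -
  obtain b \<delta> where b: "\<delta> > 0" "ball x0 \<delta> \<subseteq> N" "\<And>x. x \<in> ball x0 \<delta> \<Longrightarrow> b x = 1" "\<And>x. x \<notin> N \<Longrightarrow> b x = 0"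
    "\<And>h. class_C_inf N h \<Longrightarrow> smooth_fun A (\<lambda>q. if q \<in> U then b (\<phi> q) * h (\<phi> q) else 0)"
    by (rule cutoff_exists[OF c N]) blast
  show ?thesis
  proof
    show "smooth_fun A (\<lambda>q. if q \<in> U then b (\<phi> q) * (\<phi> q \<bullet> i) else 0)" for i
      by (rule b(5)) (intro class_C_inf_inner class_C_inf_id class_C_inf_const N(1))
    show "(if inv_into U \<phi> x \<in> U then b (\<phi> (inv_into U \<phi> x)) * (\<phi> (inv_into U \<phi> x) \<bullet> i) else 0) = x \<bullet> i"
      if "x \<in> ball x0 \<delta>" for x i
    proof -
      have "x \<in> \<phi> ` U" using that b(2) N(2) by blast
      then show ?thesis using b(3)[OF that] by (auto simp: chart_inv[OF c])
    qed
  qed (use b in auto)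
qed

section \<open>Coordinate vectors and components\<close>

lemma coord_vec_apply:
  "smooth_fun A f \<Longrightarrow>
     coord_vec A (U, \<phi>) p a f = frechet_derivative (\<lambda>x. f (inv_into U \<phi> x)) (at (\<phi> p)) a"
  by (simp add: coord_vec_def comp_def)

lemma coord_vec_nonsmooth: "\<not> smooth_fun A f \<Longrightarrow> coord_vec A (U, \<phi>) p a f = 0"
  by (simp add: coord_vec_def)

lemma coord_vec_has_derivative:
  assumes "(U, \<phi>) \<in> A" "p \<in> U" "smooth_fun A f"
  shows "((\<lambda>x. f (inv_into U \<phi> x)) has_derivative (\<lambda>a. coord_vec A (U, \<phi>) p a f)) (at (\<phi> p))"
  using class_C_inf_has_derivative[OF smooth_funD[OF assms(3,1)]] assms(2)
  by (simp add: coord_vec_apply[OF assms(3)])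

lemma coord_vec_eqI:
  assumes "smooth_fun A f" "((\<lambda>x. f (inv_into U \<phi> x)) has_derivative D) (at (\<phi> p))"
  shows "coord_vec A (U, \<phi>) p a f = D a"
  using frechet_derivative_at[OF assms(2)] by (simp add: coord_vec_apply[OF assms(1)])

lemma coord_vec_linear:
  assumes "(U, \<phi>) \<in> A" "p \<in> U"
  shows "linear (\<lambda>a. coord_vec A (U, \<phi>) p a f)"
proof (cases "smooth_fun A f")
  case True
  then show ?thesis using has_derivative_linear[OF coord_vec_has_derivative[OF assms]] by blast
qed (simp add: coord_vec_nonsmooth linear_zero)

lemma coord_vec_add:
  "(U, \<phi>) \<in> A \<Longrightarrow> p \<in> U \<Longrightarrow>
    coord_vec A (U, \<phi>) p (a + b) = (\<lambda>f. coord_vec A (U, \<phi>) p a f + coord_vec A (U, \<phi>) p b f)"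
  using linear_add[OF coord_vec_linear] by blast

lemma coord_vec_scale:
  "(U, \<phi>) \<in> A \<Longrightarrow> p \<in> U \<Longrightarrow>
    coord_vec A (U, \<phi>) p (c *\<^sub>R a) = (\<lambda>f. c * coord_vec A (U, \<phi>) p a f)"
  using linear_scale[OF coord_vec_linear] by fastforce

lemma coord_vec_zero: "(U, \<phi>) \<in> A \<Longrightarrow> p \<in> U \<Longrightarrow> coord_vec A (U, \<phi>) p 0 = (\<lambda>_. 0)"
  using linear_0[OF coord_vec_linear] by blast

lemma coord_vec_in_tangent_space:
  assumes c: "(U, \<phi>) \<in> A" "p \<in> U"
  shows "coord_vec A (U, \<phi>) p a \<in> tangent_space A p"
  unfolding tangent_space_def mem_Collect_eq
proof (intro conjI allI impI)
  fix f g assume f: "smooth_fun A f" and g: "smooth_fun A g"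
  note d = coord_vec_has_derivative[OF c f] coord_vec_has_derivative[OF c g]
  show "coord_vec A (U, \<phi>) p a (\<lambda>q. f q + g q) = coord_vec A (U, \<phi>) p a f + coord_vec A (U, \<phi>) p a g"
    by (rule coord_vec_eqI[OF smooth_fun_add[OF f g] has_derivative_add[OF d]])
  show "coord_vec A (U, \<phi>) p a (\<lambda>q. f q * g q) =
      f p * coord_vec A (U, \<phi>) p a g + g p * coord_vec A (U, \<phi>) p a f"
    using coord_vec_eqI[OF smooth_fun_mult[OF f g] has_derivative_mult[OF d], of a]
    by (simp add: chart_inv[OF c])
next
  fix s f assume f: "smooth_fun A f"
  show "coord_vec A (U, \<phi>) p a (\<lambda>q. s * f q) = s * coord_vec A (U, \<phi>) p a f"
    by (rule coord_vec_eqI[OF smooth_fun_scale[OF f]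
          has_derivative_mult_right[OF coord_vec_has_derivative[OF c f]]])
qed (simp add: coord_vec_nonsmooth)

lemma coord_vec_coordinate:
  assumes c: "(U, \<phi>) \<in> A" "q \<in> U" and B: "open B" "\<phi> q \<in> B"
    and g: "smooth_fun A g" "\<And>x. x \<in> B \<Longrightarrow> g (inv_into U \<phi> x) = x \<bullet> i"
  shows "coord_vec A (U, \<phi>) q a g = a \<bullet> i"
proof (rule coord_vec_eqI[OF g(1)])
  have "((\<lambda>x. x \<bullet> i) has_derivative (\<lambda>a. a \<bullet> i)) (at (\<phi> q))"
    by (auto intro!: derivative_eq_intros)
  then show "((\<lambda>x. g (inv_into U \<phi> x)) has_derivative (\<lambda>a. a \<bullet> i)) (at (\<phi> q))"
    by (rule has_derivative_transform_within_open[OF _ B]) (simp add: g(2))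
qed

lemma coord_vec_inject:
  assumes c: "(U, \<phi>) \<in> A" "p \<in> U"
  shows "coord_vec A (U, \<phi>) p a = coord_vec A (U, \<phi>) p b \<longleftrightarrow> a = b"
proof
  assume eq: "coord_vec A (U, \<phi>) p a = coord_vec A (U, \<phi>) p b"
  obtain g B where g: "open B" "\<phi> p \<in> B" "\<And>i. smooth_fun A (g i)"
    "\<And>x i. x \<in> B \<Longrightarrow> g i (inv_into U \<phi> x) = x \<bullet> i"
    using coordinate_functions[OF c(1) chart_open[OF c(1)] order_refl imageI[OF c(2)]] by metis
  show "a = b"
    using coord_vec_coordinate[OF c g(1,2) g(3,4)] eq by (metis euclidean_eqI)
qed simp

text \<open>Hadamard's lemma writes \<open>f - f p\<close> near \<open>p\<close> as a combination of the coordinates vanishing at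
  \<open>p\<close>; multiplying by the square of a cutoff function makes all factors globally smooth.\<close>

lemma tangent_vector_coord_vec:
  assumes c: "(U, \<phi>) \<in> A" "p \<in> U" and v: "v \<in> tangent_space A p"
  obtains a where "v = coord_vec A (U, \<phi>) p a"
proof -
  let ?x0 = "\<phi> p"
  obtain r where r: "r > 0" "ball ?x0 r \<subseteq> \<phi> ` U"
    using chart_open[OF c(1)] c(2) open_contains_ball by blast
  obtain b \<delta> where b: "\<delta> > 0" "\<And>x. x \<in> ball ?x0 \<delta> \<Longrightarrow> b x = 1" "\<And>x. x \<notin> ball ?x0 r \<Longrightarrow> b x = 0"
    "\<And>h. class_C_inf (ball ?x0 r) h \<Longrightarrow> smooth_fun A (\<lambda>q. if q \<in> U then b (\<phi> q) * h (\<phi> q) else 0)"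
    by (rule cutoff_exists[OF c(1) open_ball r(2), of ?x0]) (use r(1) in auto)
  have b1: "b ?x0 = 1" using b(1,2) by simp
  define ext where "ext h q = (if q \<in> U then b (\<phi> q) * h (\<phi> q) else 0)" for h q
  have ext: "smooth_fun A (ext h)" if "class_C_inf (ball ?x0 r) h" for h
    using b(4)[OF that] by (simp add: ext_def[abs_def])
  have ext_p: "ext h p = h ?x0" for h using c(2) b1 by (simp add: ext_def)
  define e where "e = ext (\<lambda>_. 1)"
  have e: "smooth_fun A e" "e p = 1" unfolding e_def using ext[OF class_C_inf_const] ext_p by simp_all
  define k where "k i = ext (\<lambda>x. (x - ?x0) \<bullet> i)" for i
  have k: "smooth_fun A (k i)" "k i p = 0" for i
    unfolding k_def ext_p by (auto intro!: ext class_C_inf_inner class_C_inf_diff class_C_inf_id class_C_inf_const)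
  define a where "a = (\<Sum>i\<in>Basis. v (k i) *\<^sub>R i)"
  have "v f = coord_vec A (U, \<phi>) p a f" for f
  proof (cases "smooth_fun A f")
    case False
    then show ?thesis using tangent_nonsmooth[OF v] by (simp add: coord_vec_nonsmooth)
  next
    case f: True
    let ?F = "\<lambda>x. f (inv_into U \<phi> x)"
    have F: "class_C_inf (ball ?x0 r) ?F" by (rule class_C_inf_subset[OF smooth_funD[OF f c(1)] r(2)])
    obtain h where h: "\<And>i. i \<in> Basis \<Longrightarrow> class_C_inf (ball ?x0 r) (h i)"
      "\<And>i. i \<in> Basis \<Longrightarrow> h i ?x0 = frechet_derivative ?F (at ?x0) i"
      "\<And>x. x \<in> ball ?x0 r \<Longrightarrow> ?F x = ?F ?x0 + (\<Sum>i\<in>Basis. ((x - ?x0) \<bullet> i) * h i x)"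
      using hadamard[OF r(1) F] by blast
    have eq: "(\<lambda>q. (e q * e q) * f q) = (\<lambda>q. f p * (e q * e q) + (\<Sum>i\<in>Basis. k i q * ext (h i) q))"
    proof
      fix q
      show "(e q * e q) * f q = f p * (e q * e q) + (\<Sum>i\<in>Basis. k i q * ext (h i) q)"
      proof (cases "q \<in> U \<and> \<phi> q \<in> ball ?x0 r")
        case True
        then have "f q = f p + (\<Sum>i\<in>Basis. ((\<phi> q - ?x0) \<bullet> i) * h i (\<phi> q))"
          using h(3)[of "\<phi> q"] c by (simp add: chart_inv[OF c(1)])
        then show ?thesis using True
          by (simp add: e_def k_def ext_def algebra_simps sum_distrib_left)
      next
        case False
        then show ?thesis using b(3) by (auto simp: e_def k_def ext_def)
      qed
    qed
    have ee: "smooth_fun A (\<lambda>q. e q * e q)" by (intro smooth_fun_mult e)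
    have kh: "smooth_fun A (\<lambda>q. k i q * ext (h i) q)" if "i \<in> Basis" for i
      by (intro smooth_fun_mult k ext h that)
    \<comment> \<open>The value of \<open>v\<close> on \<open>e * e\<close> is not computed: it
      occurs with the factor \<open>f p\<close> on both sides and cancels.\<close>
    have "v (\<lambda>q. (e q * e q) * f q) = v f + f p * v (\<lambda>q. e q * e q)"
      using tangent_mult[OF v ee f] e(2) by simp
    moreover have "v (\<lambda>q. f p * (e q * e q) + (\<Sum>i\<in>Basis. k i q * ext (h i) q)) =
        f p * v (\<lambda>q. e q * e q) + (\<Sum>i\<in>Basis. v (\<lambda>q. k i q * ext (h i) q))"
      using tangent_add[OF v smooth_fun_scale[OF ee]
            smooth_fun_sum[of Basis "\<lambda>i q. k i q * ext (h i) q", OF kh], of "f p"]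
        tangent_scale[OF v ee] tangent_sum[of v p Basis "\<lambda>i q. k i q * ext (h i) q", OF v kh]
      by simp
    moreover have "v (\<lambda>q. k i q * ext (h i) q) = v (k i) * frechet_derivative ?F (at ?x0) i"
      if "i \<in> Basis" for i
      using tangent_mult[OF v k(1) ext[OF h(1)[OF that]]] k(2) h(2)[OF that] by (simp add: ext_p)
    ultimately have "v f = (\<Sum>i\<in>Basis. v (k i) * frechet_derivative ?F (at ?x0) i)"
      using eq by simp
    also have "\<dots> = frechet_derivative ?F (at ?x0) a"
      using class_C_inf_linear_derivative[OF F] r(1)
      by (simp add: a_def linear_sum linear_scale)
    finally show ?thesis by (simp add: coord_vec_apply[OF f])
  qed
  then show ?thesis using that by blast
qed

text \<open>Locally the components of \<open>X\<close> are the functions X (g i) for the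
  \<open>g\<close> of \<open>coordinate_functions\<close>, and \<open>X\<close> maps smooth
  functions to smooth functions.\<close>

lemma vector_field_components:
  assumes c: "(U, \<phi>) \<in> A" and X: "vector_field A X"
  obtains \<xi> where "class_C_inf (\<phi> ` U) \<xi>" "\<And>q. q \<in> U \<Longrightarrow> X q = coord_vec A (U, \<phi>) q (\<xi> (\<phi> q))"
proof -
  have "\<exists>a. X q = coord_vec A (U, \<phi>) q a" if "q \<in> U" for q
    using tangent_vector_coord_vec[OF c that vector_field_tangent[OF X]] chart_subset[OF c] that by blast
  then obtain \<eta> where \<eta>: "\<And>q. q \<in> U \<Longrightarrow> X q = coord_vec A (U, \<phi>) q (\<eta> q)" by metis
  define \<xi> where "\<xi> x = \<eta> (inv_into U \<phi> x)" for x
  have "class_C_inf (\<phi> ` U) \<xi>"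
  proof (rule class_C_inf_local)
    fix x0 assume x0: "x0 \<in> \<phi> ` U"
    obtain g B where g: "open B" "x0 \<in> B" "B \<subseteq> \<phi> ` U" "\<And>i. smooth_fun A (g i)"
      "\<And>x i. x \<in> B \<Longrightarrow> g i (inv_into U \<phi> x) = x \<bullet> i"
      using coordinate_functions[OF c chart_open[OF c] order_refl x0] by metis
    have "class_C_inf B \<xi>"
    proof (rule class_C_inf_componentwise[OF g(1)])
      fix i :: 'e
      show "class_C_inf B (\<lambda>x. \<xi> x \<bullet> i)"
      proof (rule class_C_inf_cong_on[OF g(1)])
        show "class_C_inf B (\<lambda>x. X (inv_into U \<phi> x) (g i))"
          by (rule class_C_inf_subset[OF smooth_funD[OF vector_field_smooth[OF X g(4)] c] g(3)])
        fix x assume x: "x \<in> B"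
        then obtain q where q: "q \<in> U" "x = \<phi> q" using g(3) by auto
        then show "X (inv_into U \<phi> x) (g i) = \<xi> x \<bullet> i"
          using coord_vec_coordinate[OF c q(1) g(1) _ g(4,5)] x by (simp add: \<xi>_def \<eta> chart_inv[OF c])
      qed
    qed
    then show "\<exists>T. open T \<and> x0 \<in> T \<and> class_C_inf T \<xi>" using g by blast
  qed
  moreover have "X q = coord_vec A (U, \<phi>) q (\<xi> (\<phi> q))" if "q \<in> U" for q
    using \<eta>[OF that] by (simp add: \<xi>_def chart_inv[OF c that])
  ultimately show ?thesis using that by blast
qed

section \<open>Extension of tangent vectors and tensorial operators\<close>

lemma vector_field_cutoff:
  assumes c: "(U, \<phi>) \<in> A" and N: "N \<subseteq> \<phi> ` U"
    and b: "\<And>h. class_C_inf N h \<Longrightarrow> smooth_fun A (\<lambda>q. if q \<in> U then b (\<phi> q) * h (\<phi> q) else 0)"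
  shows "vector_field A (\<lambda>q f. if q \<in> U then b (\<phi> q) * coord_vec A (U, \<phi>) q a f else 0)"
  unfolding vector_field_def
proof (intro conjI ballI allI impI)
  show "(\<lambda>f. if p \<in> U then b (\<phi> p) * coord_vec A (U, \<phi>) p a f else 0) \<in> tangent_space A p" for p
    by (cases "p \<in> U") (auto simp: zero_in_tangent_space coord_vec_in_tangent_space[OF c] intro: tangent_space_scale)
  show "(\<lambda>f. if p \<in> U then b (\<phi> p) * coord_vec A (U, \<phi>) p a f else 0) = (\<lambda>_. 0)" if "p \<notin> points A" for p
  proof -
    have "p \<notin> U" using that chart_subset[OF c] by blast
    then show ?thesis by simp
  qed
  show "smooth_fun A (\<lambda>q. if q \<in> U then b (\<phi> q) * coord_vec A (U, \<phi>) q a f else 0)"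
    if "smooth_fun A f" for f
    unfolding coord_vec_apply[OF that]
    by (rule b[OF class_C_inf_subset[OF class_C_inf_directional[OF smooth_funD[OF that c]] N]])
qed

text \<open>The coordinate field with the constant components of \<open>x\<close>, multiplied by a
  cutoff that is 1 at \<open>p\<close>.\<close>

lemma vector_field_extension:
  assumes "p \<in> points A" "x \<in> tangent_space A p"
  obtains X where "vector_field A X" "X p = x"
proof -
  obtain U \<phi> where c: "(U, \<phi>) \<in> A" "p \<in> U" using pointsE[OF assms(1)] .
  obtain a where a: "x = coord_vec A (U, \<phi>) p a" using tangent_vector_coord_vec[OF c assms(2)] .
  obtain b \<delta> where b: "\<delta> > 0" "\<And>x. x \<in> ball (\<phi> p) \<delta> \<Longrightarrow> b x = (1::real)"
    "\<And>h. class_C_inf (\<phi> ` U) h \<Longrightarrow> smooth_fun A (\<lambda>q. if q \<in> U then b (\<phi> q) * h (\<phi> q) else 0)"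
    by (rule cutoff_exists[OF c(1) chart_open[OF c(1)] order_refl imageI[OF c(2)]]) blast
  show ?thesis
    by (rule that[OF vector_field_cutoff[OF c(1) order_refl b(3)]]) (use a b(1,2) c(2) in auto)
qed

lemma vector_field_sum:
  "finite I \<Longrightarrow> (\<And>i. i \<in> I \<Longrightarrow> vector_field A (E i)) \<Longrightarrow> vector_field A (\<lambda>p f. \<Sum>i\<in>I. E i p f)"
proof (induction I rule: finite_induct)
  case (insert i I)
  have "(\<lambda>p f. \<Sum>j\<in>insert i I. E j p f) = fadd (E i) (\<lambda>p f. \<Sum>j\<in>I. E j p f)"
    using insert.hyps by (simp add: fadd_def)
  then show ?case using insert by (simp add: vector_field_fadd)
qed (simp add: vector_field_zero)

lemma tensorial_zero:
  assumes "tensorial A T"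
  shows "T (\<lambda>_ _. 0) = (\<lambda>_ _. 0)"
  using tensorial_mul[OF assms smooth_fun_const vector_field_zero, of 0] by (simp add: fmul_def)

lemma tensorial_sum:
  assumes T: "tensorial A T"
  shows "finite I \<Longrightarrow> (\<And>i. i \<in> I \<Longrightarrow> vector_field A (E i)) \<Longrightarrow>
    T (\<lambda>p f. \<Sum>i\<in>I. E i p f) = (\<lambda>p f. \<Sum>i\<in>I. T (E i) p f)"
proof (induction I rule: finite_induct)
  case (insert i I)
  have "(\<lambda>p f. \<Sum>j\<in>insert i I. E j p f) = fadd (E i) (\<lambda>p f. \<Sum>j\<in>I. E j p f)"
    using insert.hyps by (simp add: fadd_def)
  then show ?case
    using insert tensorial_add[OF T, of "E i" "\<lambda>p f. \<Sum>j\<in>I. E j p f"]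
    by (simp add: vector_field_sum fadd_def)
qed (use tensorial_zero[OF T] in simp)

text \<open>Near \<open>p\<close> a field is a combination \<open>\<Sum>i. X (g i) \<sqdot> E i\<close> of cut-off coordinate fields whose
  coefficients vanish wherever \<open>X\<close> does.\<close>

lemma tensorial_vanishes:
  assumes T: "tensorial A T" and X: "vector_field A X" and p: "p \<in> points A" and Xp: "X p = (\<lambda>_. 0)"
  shows "T X p = (\<lambda>_. 0)"
proof -
  obtain U \<phi> where c: "(U, \<phi>) \<in> A" "p \<in> U" using pointsE[OF p] .
  obtain g B where g: "open B" "\<phi> p \<in> B" "B \<subseteq> \<phi> ` U" "\<And>i. smooth_fun A (g i)"
      "\<And>x i. x \<in> B \<Longrightarrow> g i (inv_into U \<phi> x) = x \<bullet> i"
    using coordinate_functions[OF c(1) chart_open[OF c(1)] order_refl imageI[OF c(2)]] by metis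
  obtain b \<delta> where b: "\<delta> > 0" "\<And>x. x \<in> ball (\<phi> p) \<delta> \<Longrightarrow> b x = (1::real)" "\<And>x. x \<notin> B \<Longrightarrow> b x = 0"
    "\<And>h. class_C_inf B h \<Longrightarrow> smooth_fun A (\<lambda>q. if q \<in> U then b (\<phi> q) * h (\<phi> q) else 0)"
    by (rule cutoff_exists[OF c(1) g(1,3,2)]) blast
  define e where "e q = (if q \<in> U then b (\<phi> q) else 0)" for q
  have e: "smooth_fun A e" "e p = 1"
    using b(4)[OF class_C_inf_const[of _ 1]] b(1,2) c(2) by (simp_all add: e_def[abs_def] cong: if_cong)
  define E where "E i q f = (if q \<in> U then b (\<phi> q) * coord_vec A (U, \<phi>) q i f else 0)" for i q f
  have E: "vector_field A (E i)" for i
    unfolding E_def[abs_def] by (rule vector_field_cutoff[OF c(1) g(3) b(4)])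
  have Xg: "smooth_fun A (\<lambda>q. X q (g i))" for i by (rule vector_field_smooth[OF X g(4)])
  \<comment> \<open>One cutoff, inside \<open>E i\<close>, suffices: the coefficients X (g i) are
    smooth everywhere, and where they need not be components of \<open>X\<close>, that is outside
    \<open>B\<close>, both sides are 0.\<close>
  have "fmul e X = (\<lambda>q f. \<Sum>i\<in>Basis. fmul (\<lambda>q. X q (g i)) (E i) q f)"
  proof (intro ext)
    fix q f
    show "fmul e X q f = (\<Sum>i\<in>Basis. fmul (\<lambda>q. X q (g i)) (E i) q f)"
    proof (cases "q \<in> U \<and> \<phi> q \<in> B")
      case True
      obtain a where a: "X q = coord_vec A (U, \<phi>) q a"
        using tangent_vector_coord_vec[OF c(1) _ vector_field_tangent[OF X]] True chart_subset[OF c(1)] by blast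
      have "X q (g i) = a \<bullet> i" for i
        unfolding a using coord_vec_coordinate[OF c(1) _ g(1) _ g(4,5)] True by blast
      then have "(\<Sum>i\<in>Basis. fmul (\<lambda>q. X q (g i)) (E i) q f) =
          b (\<phi> q) * (\<Sum>i\<in>Basis. (a \<bullet> i) *\<^sub>R coord_vec A (U, \<phi>) q i f)"
        using True by (simp add: fmul_def E_def sum_distrib_left algebra_simps)
      also have "\<dots> = b (\<phi> q) * X q f"
        using linear_eq_sum_Basis[OF coord_vec_linear[OF c(1), of q f], of a] True a by simp
      finally show ?thesis using True by (simp add: fmul_def e_def)
    next
      case False
      then show ?thesis using b(3) by (auto simp: fmul_def e_def E_def)
    qed
  qed
  then have "fmul e (T X) = (\<lambda>q f. \<Sum>i\<in>Basis. fmul (\<lambda>q. X q (g i)) (T (E i)) q f)"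
    using tensorial_mul[OF T e(1) X] tensorial_mul[OF T Xg E]
      tensorial_sum[OF T finite_Basis, where E = "\<lambda>i. fmul (\<lambda>q. X q (g i)) (E i)"]
    by (simp add: vector_field_fmul Xg E)
  then have "fmul e (T X) p = (\<lambda>f. \<Sum>i\<in>Basis. fmul (\<lambda>q. X q (g i)) (T (E i)) p f)" by simp
  then show ?thesis using e(2) Xp by (simp add: fmul_def)
qed

lemma fsub_eq_fadd: "fsub X Y = fadd X (fmul (\<lambda>_. - 1) Y)"
  by (simp add: fsub_def fadd_def fmul_def)

lemma tensorial_fsub:
  assumes "tensorial A T" "vector_field A X" "vector_field A Y"
  shows "T (fsub X Y) = fsub (T X) (T Y)"
  using assms by (simp add: fsub_eq_fadd tensorial_add tensorial_mul vector_field_fmul smooth_fun_const)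

lemma tensorial_cong_at:
  assumes "tensorial A T" "vector_field A X" "vector_field A Y" "p \<in> points A" "X p = Y p"
  shows "T X p = T Y p"
proof -
  have "T (fsub X Y) p = (\<lambda>_. 0)"
    by (rule tensorial_vanishes[OF assms(1) vector_field_fsub[OF assms(2,3)] assms(4)])
      (simp add: fsub_def assms(5))
  then have "T X p f - T Y p f = 0" for f
    using tensorial_fsub[OF assms(1-3)] by (simp add: fsub_def fun_eq_iff)
  then show ?thesis by (simp add: fun_eq_iff)
qed

lemma value_at_eq:
  assumes "tensorial A T" "vector_field A X" "p \<in> points A"
  shows "value_at A T p (X p) = T X p"
  unfolding value_at_def
proof (rule the_equality)
  show "\<forall>Y. vector_field A Y \<longrightarrow> Y p = X p \<longrightarrow> T Y p = T X p"
    using tensorial_cong_at[OF assms(1) _ assms(2,3)] by blast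
  show "y = T X p" if "\<forall>Y. vector_field A Y \<longrightarrow> Y p = X p \<longrightarrow> T Y p = y" for y
    using that assms(2) by blast
qed

text \<open>Smoothness does not constrain values off \<^term>\<open>points A\<close>, so the indicator function \<open>k\<close> of
  the complement is smooth, and \<open>f - g = (f - g) * k\<close>.\<close>

lemma tangent_cong:
  assumes p: "p \<in> points A" and v: "v \<in> tangent_space A p"
    and f: "smooth_fun A f" and g: "smooth_fun A g" and eq: "\<And>q. q \<in> points A \<Longrightarrow> f q = g q"
  shows "v f = v g"
proof -
  define k :: "'a \<Rightarrow> real" where "k q = (if q \<in> points A then 0 else 1)" for q
  have k: "smooth_fun A k"
  proof (rule smooth_funI)
    fix U \<phi> assume c: "(U, \<phi>) \<in> A"
    show "class_C_inf (\<phi> ` U) (\<lambda>x. k (inv_into U \<phi> x))"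
      by (rule class_C_inf_cong_on[OF chart_open[OF c] _ class_C_inf_const[of _ 0]])
        (use chart_subset[OF c] in \<open>auto simp: k_def chart_inv[OF c]\<close>)
  qed
  have "(\<lambda>q. f q - g q) = (\<lambda>q. (f q - g q) * k q)" using eq by (auto simp: k_def)
  then have "v (\<lambda>q. f q - g q) = v (\<lambda>q. (f q - g q) * k q)" by simp
  also have "\<dots> = 0"
    using tangent_mult[OF v smooth_fun_diff[OF f g] k] p eq[OF p] by (simp add: k_def)
  finally show ?thesis using tangent_minus[OF v f g] by simp
qed

lemma vector_field_const: "vector_field A X \<Longrightarrow> X p (\<lambda>_. c) = 0"
  using tangent_const[OF vector_field_tangent] vector_field_outside by (cases "p \<in> points A") fastforce+

lemma lie_bracket_zero: "vector_field A X \<Longrightarrow> lie_bracket X (\<lambda>_ _. 0) = (\<lambda>_ _. 0)"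
  by (simp add: lie_bracket_def vector_field_const)

end

section \<open>The slit tangent bundle\<close>

text \<open>Continuity of a chart, in the form in which it separates points of one fibre of
  \<open>slit M\<close>. It assumes \<open>smooth_atlas\<close> only, because it serves to prove the
  Hausdorff property.\<close>

lemma atlas_open_chart_preimage:
  assumes "smooth_atlas A" "(U, \<phi>) \<in> A" "open N"
  shows "atlas_open A {q \<in> U. \<phi> q \<in> N}"
  unfolding atlas_open_def
proof (intro conjI ballI, goal_cases)
  case 1
  show ?case using assms(2) by (auto simp: points_def)
next
  case (2 d)
  obtain V \<psi> where d: "d = (V, \<psi>)" by force
  have *: "open (\<psi> ` (V \<inter> U))" "class_C_inf (\<psi> ` (V \<inter> U)) (\<phi> \<circ> inv_into V \<psi>)" "inj_on \<psi> V"
    using assms 2 d by (force simp: smooth_atlas_def)+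
  have "open (\<psi> ` (V \<inter> U) \<inter> (\<phi> \<circ> inv_into V \<psi>) -` N)"
    by (rule continuous_open_preimage[OF class_C_inf_continuous_on[OF *(2)] *(1) assms(3)])
  moreover have "\<psi> ` ({q \<in> U. \<phi> q \<in> N} \<inter> V) = \<psi> ` (V \<inter> U) \<inter> (\<phi> \<circ> inv_into V \<psi>) -` N"
    using *(3) by (auto simp: comp_def)
  ultimately show ?case using d by simp
qed

lemma slit_point_iff:
  "(p, v) \<in> points (slit M) \<longleftrightarrow> p \<in> points M \<and> v \<in> tangent_space M p \<and> v \<noteq> (\<lambda>_. 0)"
  by (force simp: points_def slit_def tangent_chart_def)

text \<open>The complete lift of \<open>g\<close>: its differential, read as a function on the total
  space that is linear along the fibres.\<close>

definition differential_fun :: "('a \<Rightarrow> real) \<Rightarrow> 'a \<times> 'a tvec \<Rightarrow> real" where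
  "differential_fun g w = snd w g"

locale slit_bundle = M: hausdorff_atlas M
  for M :: "('a, 'e::euclidean_space) chart set"
begin

text \<open>\<open>tdom\<close> and \<open>tmap\<close> are the domain and the map of
  \<open>tangent_chart\<close>, named apart so that each is written in terms of the inducing chart
  of \<open>M\<close>.\<close>

definition tdom :: "'a set \<Rightarrow> ('a \<times> 'a tvec) set" where
  "tdom U = {(p, v). p \<in> U \<and> v \<in> tangent_space M p \<and> v \<noteq> (\<lambda>_. 0)}"

definition tmap :: "'a set \<Rightarrow> ('a \<Rightarrow> 'e) \<Rightarrow> 'a \<times> 'a tvec \<Rightarrow> 'e \<times> 'e" where
  "tmap U \<phi> = (\<lambda>(p, v). (\<phi> p, THE a. coord_vec M (U, \<phi>) p a = v))"

lemma slitE: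
  assumes "c \<in> slit M"
  obtains U \<phi> where "(U, \<phi>) \<in> M" "c = (tdom U, tmap U \<phi>)"
  using assms by (force simp: slit_def tangent_chart_def tdom_def tmap_def)

lemma tchart_in_slit: "(U, \<phi>) \<in> M \<Longrightarrow> (tdom U, tmap U \<phi>) \<in> slit M"
  by (force simp: slit_def tangent_chart_def tdom_def tmap_def)

lemma tmap_coord_vec:
  "(U, \<phi>) \<in> M \<Longrightarrow> p \<in> U \<Longrightarrow> tmap U \<phi> (p, coord_vec M (U, \<phi>) p a) = (\<phi> p, a)"
  by (simp add: tmap_def M.coord_vec_inject)

lemma tdomI:
  assumes "(U, \<phi>) \<in> M" "p \<in> U" "a \<noteq> 0"
  shows "(p, coord_vec M (U, \<phi>) p a) \<in> tdom U"
  using assms M.coord_vec_in_tangent_space[OF assms(1,2)] M.coord_vec_inject[OF assms(1,2), of a 0]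
  by (simp add: tdom_def M.coord_vec_zero[OF assms(1,2)])

lemma tdomE:
  assumes "(U, \<phi>) \<in> M" "w \<in> tdom U"
  obtains p a where "p \<in> U" "a \<noteq> 0" "w = (p, coord_vec M (U, \<phi>) p a)"
proof -
  obtain p v where w: "w = (p, v)" "p \<in> U" "v \<in> tangent_space M p" "v \<noteq> (\<lambda>_. 0)"
    using assms(2) by (auto simp: tdom_def)
  obtain a where "v = coord_vec M (U, \<phi>) p a" using M.tangent_vector_coord_vec[OF assms(1) w(2,3)] .
  moreover from this have "a \<noteq> 0" using w(4) M.coord_vec_zero[OF assms(1) w(2)] by auto
  ultimately show ?thesis using that[OF w(2)] w(1) by simp
qed

lemma slit_pointE:
  assumes "w \<in> points (slit M)"
  obtains U \<phi> p a where "(U, \<phi>) \<in> M" "p \<in> U" "a \<noteq> 0" "w = (p, coord_vec M (U, \<phi>) p a)" "w \<in> tdom U"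
proof -
  obtain p v where w: "w = (p, v)" by force
  then obtain U \<phi> where c: "(U, \<phi>) \<in> M" "p \<in> U" using assms M.pointsE by (auto simp: slit_point_iff)
  then have "w \<in> tdom U" using assms w by (simp add: tdom_def slit_point_iff)
  then show ?thesis using that[OF c(1)] tdomE[OF c(1)] by metis
qed

text \<open>The set \<open>W\<close> of base points is kept free so that one computation serves a
  full chart domain, an overlap of two charts and the preimage of an open set of
  \<open>M\<close>.\<close>

lemma tmap_image_overlap:
  assumes "(U, \<phi>) \<in> M"
  shows "tmap U \<phi> ` (tdom U \<inter> {w. fst w \<in> W}) = \<phi> ` (U \<inter> W) \<times> (- {0})"
proof -
  have "(\<phi> p, a) \<in> tmap U \<phi> ` (tdom U \<inter> {w. fst w \<in> W})" if "p \<in> U" "p \<in> W" "a \<noteq> 0" for p a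
    using tmap_coord_vec[OF assms that(1), of a] tdomI[OF assms that(1,3)] that(2) by force
  moreover have "tmap U \<phi> w \<in> \<phi> ` (U \<inter> W) \<times> (- {0})" if w: "w \<in> tdom U" "fst w \<in> W" for w
  proof -
    obtain p a where "p \<in> U" "a \<noteq> 0" "w = (p, coord_vec M (U, \<phi>) p a)" using tdomE[OF assms w(1)] .
    then show ?thesis using w(2) by (simp add: tmap_coord_vec[OF assms])
  qed
  ultimately show ?thesis by (intro subset_antisym) (blast, force)
qed

lemma tmap_image: "(U, \<phi>) \<in> M \<Longrightarrow> tmap U \<phi> ` tdom U = \<phi> ` U \<times> (- {0})"
  using tmap_image_overlap[of U \<phi> UNIV] by simp

lemma tdom_inter: "tdom U \<inter> tdom V = tdom U \<inter> {w. fst w \<in> V}"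
  by (auto simp: tdom_def)

lemma tmap_inj:
  assumes "(U, \<phi>) \<in> M"
  shows "inj_on (tmap U \<phi>) (tdom U)"
proof (rule inj_onI)
  fix w w' assume w: "w \<in> tdom U" "w' \<in> tdom U" "tmap U \<phi> w = tmap U \<phi> w'"
  obtain p a where p: "p \<in> U" "w = (p, coord_vec M (U, \<phi>) p a)" using tdomE[OF assms w(1)] by metis
  obtain q b where q: "q \<in> U" "w' = (q, coord_vec M (U, \<phi>) q b)" using tdomE[OF assms w(2)] by metis
  have "\<phi> p = \<phi> q \<and> a = b" using w(3) p q by (simp add: tmap_coord_vec[OF assms])
  then show "w = w'" using p q M.chart_inj[OF assms] by (auto simp: inj_on_def)
qed

lemma tmap_inv:
  assumes "(U, \<phi>) \<in> M" "x \<in> \<phi> ` U" "a \<noteq> 0"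
  shows "inv_into (tdom U) (tmap U \<phi>) (x, a) =
    (inv_into U \<phi> x, coord_vec M (U, \<phi>) (inv_into U \<phi> x) a)"
proof -
  obtain p where p: "p \<in> U" "x = \<phi> p" using assms(2) by auto
  show ?thesis
    using inv_into_f_f[OF tmap_inj[OF assms(1)] tdomI[OF assms(1) p(1) assms(3)]] p
    by (simp add: tmap_coord_vec[OF assms(1)] M.chart_inv[OF assms(1)])
qed

text \<open>Chain rule for \<open>f\<close>, read in the chart \<open>(V, \<psi>)\<close>, composed
  with the transition map.\<close>

lemma coord_vec_change:
  assumes c: "(U, \<phi>) \<in> M" and d: "(V, \<psi>) \<in> M" and p: "p \<in> U" "p \<in> V"
  shows "coord_vec M (U, \<phi>) p a =
    coord_vec M (V, \<psi>) p (frechet_derivative (\<lambda>x. \<psi> (inv_into U \<phi> x)) (at (\<phi> p)) a)"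
proof
  fix f
  show "coord_vec M (U, \<phi>) p a f =
    coord_vec M (V, \<psi>) p (frechet_derivative (\<lambda>x. \<psi> (inv_into U \<phi> x)) (at (\<phi> p)) a) f"
  proof (cases "smooth_fun M f")
    case True
    let ?\<tau> = "\<lambda>x. \<psi> (inv_into U \<phi> x)"
    have \<tau>: "?\<tau> (\<phi> p) = \<psi> p" by (simp add: M.chart_inv[OF c p(1)])
    have "(?\<tau> has_derivative frechet_derivative ?\<tau> (at (\<phi> p))) (at (\<phi> p))"
      by (rule class_C_inf_has_derivative[OF M.chart_transition[OF c d]]) (use p in auto)
    from has_derivative_compose[OF this, of "\<lambda>y. f (inv_into V \<psi> y)"]
    have "((\<lambda>x. f (inv_into V \<psi> (?\<tau> x))) has_derivative
        (\<lambda>a. coord_vec M (V, \<psi>) p (frechet_derivative ?\<tau> (at (\<phi> p)) a) f)) (at (\<phi> p))"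
      using M.coord_vec_has_derivative[OF d p(2) True] by (simp add: \<tau>)
    then have "((\<lambda>x. f (inv_into U \<phi> x)) has_derivative
        (\<lambda>a. coord_vec M (V, \<psi>) p (frechet_derivative ?\<tau> (at (\<phi> p)) a) f)) (at (\<phi> p))"
      by (rule has_derivative_transform_within_open[OF _ M.chart_overlap_open[OF c d]])
        (use p in \<open>auto simp: M.chart_inv[OF c] M.chart_inv[OF d]\<close>)
    then show ?thesis by (rule M.coord_vec_eqI[OF True])
  qed (simp add: coord_vec_def)
qed

text \<open>In induced coordinates a change of charts is (x, a) \<mapsto> (\<tau> x, D\<tau>(x) a),
  with \<tau> the transition map of \<open>M\<close>.\<close>

lemma smooth_atlas_slit: "smooth_atlas (slit M)"
proof -
  have "inj_on \<Phi> TU \<and> open (\<Phi> ` TU)" if t: "(TU, \<Phi>) \<in> slit M" for TU \<Phi>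
  proof -
    obtain U \<phi> where c: "(U, \<phi>) \<in> M" "(TU, \<Phi>) = (tdom U, tmap U \<phi>)" using slitE[OF t] .
    then show ?thesis
      using tmap_inj[OF c(1)] tmap_image[OF c(1)] M.chart_open[OF c(1)] by (auto intro!: open_Times)
  qed
  moreover have "open (\<Phi> ` (TU \<inter> TV)) \<and> class_C_inf (\<Phi> ` (TU \<inter> TV)) (\<Psi> \<circ> inv_into TU \<Phi>)"
    if t: "(TU, \<Phi>) \<in> slit M" "(TV, \<Psi>) \<in> slit M" for TU \<Phi> TV \<Psi>
  proof -
    obtain U \<phi> where c: "(U, \<phi>) \<in> M" "(TU, \<Phi>) = (tdom U, tmap U \<phi>)" using slitE[OF t(1)] .
    obtain V \<psi> where d: "(V, \<psi>) \<in> M" "(TV, \<Psi>) = (tdom V, tmap V \<psi>)" using slitE[OF t(2)] .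
    have im: "\<Phi> ` (TU \<inter> TV) = \<phi> ` (U \<inter> V) \<times> (- {0})"
      using c d tmap_image_overlap[OF c(1), of V] by (simp add: tdom_inter)
    have op: "open (\<phi> ` (U \<inter> V) \<times> (- {0 :: 'e}))"
      by (rule open_Times[OF M.chart_overlap_open[OF c(1) d(1)]]) auto
    let ?\<tau> = "\<lambda>x. \<psi> (inv_into U \<phi> x)"
    have f: "class_C_inf (\<phi> ` (U \<inter> V) \<times> (- {0 :: 'e})) fst" "class_C_inf (\<phi> ` (U \<inter> V) \<times> (- {0 :: 'e})) snd"
      by (auto intro: class_C_inf_bounded_linear bounded_linear_fst bounded_linear_snd)
    have s: "class_C_inf (\<phi> ` (U \<inter> V) \<times> (- {0 :: 'e}))
        (\<lambda>y. (?\<tau> (fst y), frechet_derivative ?\<tau> (at (fst y)) (snd y)))"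
      by (intro class_C_inf_Pair op class_C_inf_compose[OF op M.chart_overlap_open[OF c(1) d(1)] f(1)]
          class_C_inf_derivative[OF op M.chart_overlap_open[OF c(1) d(1)] _ f]
          M.chart_transition[OF c(1) d(1)]) auto
    have "class_C_inf (\<phi> ` (U \<inter> V) \<times> (- {0 :: 'e})) (\<Psi> \<circ> inv_into TU \<Phi>)"
    proof (rule class_C_inf_cong_on[OF op _ s])
      fix y assume "y \<in> \<phi> ` (U \<inter> V) \<times> (- {0 :: 'e})"
      then obtain p a where p: "p \<in> U" "p \<in> V" "a \<noteq> 0" "y = (\<phi> p, a)" by auto
      have "inv_into TU \<Phi> y = (p, coord_vec M (U, \<phi>) p a)"
        using tmap_inv[OF c(1) imageI[OF p(1)] p(3)] p c(2) by (simp add: M.chart_inv[OF c(1)])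
      then show "(?\<tau> (fst y), frechet_derivative ?\<tau> (at (fst y)) (snd y)) = (\<Psi> \<circ> inv_into TU \<Phi>) y"
        using d(2) p by (simp add: coord_vec_change[OF c(1) d(1)] tmap_coord_vec[OF d(1)] M.chart_inv[OF c(1)])
    qed
    then show ?thesis using op by (simp add: im)
  qed
  ultimately show ?thesis by (auto simp: smooth_atlas_def)
qed

text \<open>Points over different base points are separated by preimages of disjoint open sets of
  \<open>M\<close>. Points of the same fibre lie in a common chart domain and are separated in its
  Euclidean image.\<close>

lemma Hausdorff_slit: "Hausdorff_space (atlas_topology (slit M))"
proof -
  let ?X = "atlas_topology (slit M)"
  note op = openin_atlas_topology[OF smooth_atlas_slit]
  have top: "topspace ?X \<subseteq> points (slit M)"
    by (auto simp: topspace_def op atlas_open_def)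
  have "\<exists>W1 W2. openin ?X W1 \<and> openin ?X W2 \<and> w1 \<in> W1 \<and> w2 \<in> W2 \<and> disjnt W1 W2"
    if w1: "w1 \<in> points (slit M)" and w2: "w2 \<in> points (slit M)" and ne: "w1 \<noteq> w2" for w1 w2
  proof (cases "fst w1 = fst w2")
    case False
    have "fst w1 \<in> points M" "fst w2 \<in> points M"
      using w1 w2 slit_point_iff by (metis prod.collapse)+
    then have "\<exists>O1 O2. openin (atlas_topology M) O1 \<and> openin (atlas_topology M) O2 \<and>
        fst w1 \<in> O1 \<and> fst w2 \<in> O2 \<and> disjnt O1 O2"
      using M.hausdorff False unfolding Hausdorff_space_def M.topspace_atlas by simp
    then obtain O1 O2 where O: "openin (atlas_topology M) O1" "openin (atlas_topology M) O2"
        "fst w1 \<in> O1" "fst w2 \<in> O2" "disjnt O1 O2"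
      by blast
    have "openin ?X {w \<in> points (slit M). fst w \<in> W}" if W: "openin (atlas_topology M) W" for W
      unfolding op atlas_open_def
    proof (intro conjI ballI, goal_cases)
      case 1
      show ?case by blast
    next
      case (2 d)
      obtain U \<phi> where c: "(U, \<phi>) \<in> M" "d = (tdom U, tmap U \<phi>)" using slitE[OF 2] .
      have "{w \<in> points (slit M). fst w \<in> W} \<inter> tdom U = tdom U \<inter> {w. fst w \<in> W}"
        using M.chart_subset[OF c(1)] by (auto simp: tdom_def slit_point_iff)
      moreover have "open (\<phi> ` (U \<inter> W))"
        using W c(1) by (auto simp: M.openin_atlas atlas_open_def Int_commute)
      moreover have "open (- {0 :: 'e})" by auto
      ultimately show ?case using c(2) tmap_image_overlap[OF c(1), of W] by (simp add: open_Times)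
    qed
    then show ?thesis using O w1 w2
      by (intro exI[of _ "{w \<in> points (slit M). fst w \<in> O1}"] exI[of _ "{w \<in> points (slit M). fst w \<in> O2}"])
        (auto simp: disjnt_def)
  next
    case True
    obtain U \<phi> where c: "(U, \<phi>) \<in> M" "w1 \<in> tdom U" using slit_pointE[OF w1] by metis
    have w2U: "w2 \<in> tdom U"
      using c(2) w2 True by (cases w1, cases w2) (auto simp: tdom_def slit_point_iff)
    have "tmap U \<phi> w1 \<noteq> tmap U \<phi> w2"
      using tmap_inj[OF c(1)] c(2) w2U ne by (auto simp: inj_on_def)
    from hausdorff[OF this] obtain O1 O2
      where O: "open O1" "open O2" "tmap U \<phi> w1 \<in> O1" "tmap U \<phi> w2 \<in> O2" "O1 \<inter> O2 = {}"
      by blast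
    note pre = atlas_open_chart_preimage[OF smooth_atlas_slit tchart_in_slit[OF c(1)]]
    have "openin ?X {w \<in> tdom U. tmap U \<phi> w \<in> O1}" "openin ?X {w \<in> tdom U. tmap U \<phi> w \<in> O2}"
      unfolding op using pre O(1,2) by blast+
    moreover have "w1 \<in> {w \<in> tdom U. tmap U \<phi> w \<in> O1}" "w2 \<in> {w \<in> tdom U. tmap U \<phi> w \<in> O2}"
      using O(3,4) c(2) w2U by simp_all
    moreover have "disjnt {w \<in> tdom U. tmap U \<phi> w \<in> O1} {w \<in> tdom U. tmap U \<phi> w \<in> O2}"
      using O(5) unfolding disjnt_def by blast
    ultimately show ?thesis by blast
  qed
  then show ?thesis using top unfolding Hausdorff_space_def by blast
qed

sublocale T: hausdorff_atlas "slit M"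
  by unfold_locales (rule smooth_atlas_slit Hausdorff_slit)+

section \<open>Functions and tangent vectors of the slit bundle in coordinates\<close>

lemma slit_smooth_funI:
  assumes "\<And>U \<phi>. (U, \<phi>) \<in> M \<Longrightarrow> class_C_inf (\<phi> ` U \<times> (- {0})) (\<lambda>y. F U \<phi> (fst y) (snd y))"
    and "\<And>U \<phi> p a. (U, \<phi>) \<in> M \<Longrightarrow> p \<in> U \<Longrightarrow> a \<noteq> 0 \<Longrightarrow> f (p, coord_vec M (U, \<phi>) p a) = F U \<phi> (\<phi> p) a"
  shows "smooth_fun (slit M) f"
proof (rule T.smooth_funI)
  fix TU \<Phi> assume t: "(TU, \<Phi>) \<in> slit M"
  obtain U \<phi> where c: "(U, \<phi>) \<in> M" "(TU, \<Phi>) = (tdom U, tmap U \<phi>)" using slitE[OF t] .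
  have op: "open (\<phi> ` U \<times> (- {0 :: 'e}))" by (intro open_Times M.chart_open[OF c(1)]) auto
  have "class_C_inf (\<phi> ` U \<times> (- {0 :: 'e})) (\<lambda>y. f (inv_into TU \<Phi> y))"
  proof (rule class_C_inf_cong_on[OF op _ assms(1)[OF c(1)]])
    fix y assume "y \<in> \<phi> ` U \<times> (- {0 :: 'e})"
    then obtain p a where p: "p \<in> U" "a \<noteq> 0" "y = (\<phi> p, a)" by auto
    show "F U \<phi> (fst y) (snd y) = f (inv_into TU \<Phi> y)"
      using tmap_inv[OF c(1) imageI[OF p(1)] p(2)] p c(2) assms(2)[OF c(1) p(1,2)]
      by (simp add: M.chart_inv[OF c(1)])
  qed
  then show "class_C_inf (\<Phi> ` TU) (\<lambda>y. f (inv_into TU \<Phi> y))" using c(2) tmap_image[OF c(1)] by simp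
qed

lemma smooth_fun_fst:
  assumes g: "smooth_fun M g"
  shows "smooth_fun (slit M) (g \<circ> fst)"
proof (rule slit_smooth_funI)
  fix U \<phi> assume c: "(U, \<phi>) \<in> M"
  have op: "open (\<phi> ` U \<times> (- {0 :: 'e}))" by (intro open_Times M.chart_open[OF c]) auto
  show "class_C_inf (\<phi> ` U \<times> (- {0 :: 'e})) (\<lambda>y. g (inv_into U \<phi> (fst y)))"
    by (rule class_C_inf_compose[OF op M.chart_open[OF c]
          class_C_inf_bounded_linear[OF bounded_linear_fst] M.smooth_funD[OF g c]]) auto
  show "(g \<circ> fst) (p, coord_vec M (U, \<phi>) p a) = g (inv_into U \<phi> (\<phi> p))" if "p \<in> U" for p a
    using that by (simp add: M.chart_inv[OF c])
qed

lemma smooth_fun_differential: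
  assumes g: "smooth_fun M g"
  shows "smooth_fun (slit M) (differential_fun g)"
proof (rule slit_smooth_funI)
  fix U \<phi> assume c: "(U, \<phi>) \<in> M"
  have op: "open (\<phi> ` U \<times> (- {0 :: 'e}))" by (intro open_Times M.chart_open[OF c]) auto
  show "class_C_inf (\<phi> ` U \<times> (- {0 :: 'e}))
      (\<lambda>y. frechet_derivative (\<lambda>x. g (inv_into U \<phi> x)) (at (fst y)) (snd y))"
    by (rule class_C_inf_derivative[OF op M.chart_open[OF c] M.smooth_funD[OF g c]
          class_C_inf_bounded_linear[OF bounded_linear_fst] class_C_inf_bounded_linear[OF bounded_linear_snd]]) auto
  show "differential_fun g (p, coord_vec M (U, \<phi>) p a) =
      frechet_derivative (\<lambda>x. g (inv_into U \<phi> x)) (at (\<phi> p)) a" for p a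
    by (simp add: differential_fun_def M.coord_vec_apply[OF g])
qed

text \<open>In \<open>tcoord U \<phi> w (a, b)\<close> the component \<open>a\<close> is the part
  along the base and \<open>b\<close> the part along the fibre.\<close>

abbreviation tcoord :: "'a set \<Rightarrow> ('a \<Rightarrow> 'e) \<Rightarrow> 'a \<times> 'a tvec \<Rightarrow> 'e \<times> 'e \<Rightarrow> ('a \<times> 'a tvec) tvec" where
  "tcoord U \<phi> \<equiv> coord_vec (slit M) (tdom U, tmap U \<phi>)"

lemma dpi_tcoord:
  assumes c: "(U, \<phi>) \<in> M" and w: "w \<in> tdom U"
  shows "dpi M (tcoord U \<phi> w (a, b)) = coord_vec M (U, \<phi>) (fst w) a"
proof
  fix g
  obtain p a0 where p: "p \<in> U" "a0 \<noteq> 0" "w = (p, coord_vec M (U, \<phi>) p a0)" using tdomE[OF c w] .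
  show "dpi M (tcoord U \<phi> w (a, b)) g = coord_vec M (U, \<phi>) (fst w) a g"
  proof (cases "smooth_fun M g")
    case True
    have "((\<lambda>y. g (inv_into U \<phi> (fst y))) has_derivative
        (\<lambda>y. coord_vec M (U, \<phi>) p (fst y) g)) (at (\<phi> p, a0))"
      by (rule has_derivative_compose[OF has_derivative_fst[OF has_derivative_ident],
          of "\<lambda>x. g (inv_into U \<phi> x)"]) (simp add: M.coord_vec_has_derivative[OF c p(1) True])
    then have "((\<lambda>y. (g \<circ> fst) (inv_into (tdom U) (tmap U \<phi>) y)) has_derivative
        (\<lambda>y. coord_vec M (U, \<phi>) p (fst y) g)) (at (\<phi> p, a0))"
    proof (rule has_derivative_transform_within_open[of _ _ _ _ "\<phi> ` U \<times> (- {0})"])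
      show "open (\<phi> ` U \<times> (- {0 :: 'e}))" by (intro open_Times M.chart_open[OF c]) auto
      show "(\<phi> p, a0) \<in> \<phi> ` U \<times> (- {0})" using p by simp
      show "g (inv_into U \<phi> (fst y)) = (g \<circ> fst) (inv_into (tdom U) (tmap U \<phi>) y)"
        if "y \<in> \<phi> ` U \<times> (- {0})" for y
      proof -
        have "fst y \<in> \<phi> ` U" "snd y \<noteq> 0" using that by auto
        from tmap_inv[OF c this] show ?thesis by simp
      qed
    qed
    then show ?thesis
      using T.coord_vec_eqI[OF smooth_fun_fst[OF True]] True p
      by (simp add: dpi_def tmap_coord_vec[OF c])
  qed (simp add: dpi_def coord_vec_def)
qed

lemma ivert_has_derivative:
  assumes c: "(U, \<phi>) \<in> M" and w: "w \<in> tdom U" and f: "smooth_fun (slit M) f"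
  shows "((\<lambda>t. f (fst w, \<lambda>g. snd w g + t * coord_vec M (U, \<phi>) (fst w) b g))
    has_real_derivative tcoord U \<phi> w (0, b) f) (at 0)"
proof -
  obtain p a where p: "p \<in> U" "a \<noteq> 0" "w = (p, coord_vec M (U, \<phi>) p a)" using tdomE[OF c w] .
  let ?F = "\<lambda>y. f (inv_into (tdom U) (tmap U \<phi>) y)"
  have F: "(?F has_derivative (\<lambda>y. tcoord U \<phi> w y f)) (at (\<phi> p, a))"
    using T.coord_vec_has_derivative[OF tchart_in_slit[OF c] w f] p by (simp add: tmap_coord_vec[OF c])
  have "((\<lambda>t. (\<phi> p, a + t *\<^sub>R b)) has_derivative (\<lambda>t. (0, t *\<^sub>R b))) (at 0)"
    by (auto intro!: derivative_eq_intros)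
  from has_derivative_compose[OF this, of ?F]
  have "((\<lambda>t. ?F (\<phi> p, a + t *\<^sub>R b)) has_derivative (\<lambda>t. tcoord U \<phi> w (0, t *\<^sub>R b) f)) (at 0)"
    using F by simp
  moreover have "tcoord U \<phi> w (0, t *\<^sub>R b) f = tcoord U \<phi> w (0, b) f * t" for t
    using fun_cong[OF T.coord_vec_scale[OF tchart_in_slit[OF c] w, of t "(0, b)"], of f]
    by (simp add: mult.commute)
  ultimately have "((\<lambda>t. ?F (\<phi> p, a + t *\<^sub>R b)) has_real_derivative tcoord U \<phi> w (0, b) f) (at 0)"
    by (simp add: has_field_derivative_def)
  then show ?thesis
  proof (rule has_field_derivative_transform_within_open)
    \<comment> \<open>The line \<open>a + t *\<^sub>R b\<close> may run through 0 and so leave the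
      slit bundle; the two expressions are compared only for those \<open>t\<close> at which it does
      not, an open set containing 0.\<close>
    show "open ((\<lambda>t::real. a + t *\<^sub>R b) -` (- {0}))"
      by (rule open_vimage) (auto intro!: continuous_intros)
    show "0 \<in> (\<lambda>t::real. a + t *\<^sub>R b) -` (- {0})" using p by simp
    show "?F (\<phi> p, a + t *\<^sub>R b) = f (fst w, \<lambda>g. snd w g + t * coord_vec M (U, \<phi>) (fst w) b g)"
      if "t \<in> (\<lambda>t::real. a + t *\<^sub>R b) -` (- {0})" for t
      using that p
      by (simp add: tmap_inv[OF c] M.chart_inv[OF c] M.coord_vec_add[OF c] M.coord_vec_scale[OF c])
  qed
qed

lemma ivert_coord_vec:
  assumes c: "(U, \<phi>) \<in> M" and w: "w \<in> tdom U"
  shows "ivert M w (coord_vec M (U, \<phi>) (fst w) b) = tcoord U \<phi> w (0, b)"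
proof
  fix f
  show "ivert M w (coord_vec M (U, \<phi>) (fst w) b) f = tcoord U \<phi> w (0, b) f"
    using DERIV_imp_deriv[OF ivert_has_derivative[OF c w, of f b]]
    by (cases "smooth_fun (slit M) f") (simp_all add: ivert_def case_prod_beta' coord_vec_def)
qed

lemma ivert_fst:
  assumes "smooth_fun M g"
  shows "ivert M w u (g \<circ> fst) = 0"
  using smooth_fun_fst[OF assms] by (simp add: ivert_def case_prod_beta')

text \<open>Along the curve that defines \<open>ivert\<close>, the function dg is affine in
  \<open>t\<close> with slope \<open>u g\<close>. So dg recovers \<open>u\<close> from the vertical
  vector, whereas \<open>g \<circ> fst\<close> is constant on fibres and sees nothing.\<close>

lemma ivert_differential:
  assumes "smooth_fun M g"
  shows "ivert M w u (differential_fun g) = u g"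
proof -
  have "((\<lambda>t. snd w g + t * u g) has_real_derivative u g) (at 0)"
    by (auto intro!: derivative_eq_intros)
  then show ?thesis
    using smooth_fun_differential[OF assms]
    by (simp add: ivert_def case_prod_beta' differential_fun_def DERIV_imp_deriv)
qed

lemma dpi_apply: "smooth_fun M g \<Longrightarrow> dpi M x g = x (g \<circ> fst)"
  by (simp add: dpi_def)

lemma slit_tangentE:
  assumes "w \<in> points (slit M)" "x \<in> tangent_space (slit M) w"
  obtains U \<phi> a b where "(U, \<phi>) \<in> M" "w \<in> tdom U" "fst w \<in> U" "x = tcoord U \<phi> w (a, b)"
proof -
  obtain U \<phi> where c: "(U, \<phi>) \<in> M" "w \<in> tdom U" using slit_pointE[OF assms(1)] by metis
  obtain y where "x = tcoord U \<phi> w y"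
    using T.tangent_vector_coord_vec[OF tchart_in_slit[OF c(1)] c(2) assms(2)] .
  moreover have "fst w \<in> U" using c(2) by (auto simp: tdom_def)
  ultimately show ?thesis using that c by (metis prod.collapse)
qed

lemma base_tangentE:
  assumes "w \<in> points (slit M)" "u \<in> tangent_space M (fst w)"
  obtains U \<phi> b where "(U, \<phi>) \<in> M" "w \<in> tdom U" "u = coord_vec M (U, \<phi>) (fst w) b"
proof -
  obtain U \<phi> where c: "(U, \<phi>) \<in> M" "w \<in> tdom U" using slit_pointE[OF assms(1)] by metis
  have "fst w \<in> U" using c(2) by (auto simp: tdom_def)
  then show ?thesis using that c M.tangent_vector_coord_vec[OF c(1) _ assms(2)] by metis
qed

lemma dpi_in_tangent_space:
  assumes "w \<in> points (slit M)" "x \<in> tangent_space (slit M) w"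
  shows "dpi M x \<in> tangent_space M (fst w)"
proof -
  obtain U \<phi> a b where c: "(U, \<phi>) \<in> M" "w \<in> tdom U" "fst w \<in> U" "x = tcoord U \<phi> w (a, b)"
    using slit_tangentE[OF assms] .
  then show ?thesis using M.coord_vec_in_tangent_space[OF c(1,3)] by (simp add: dpi_tcoord)
qed

lemma dpi_surj:
  assumes "w \<in> points (slit M)" "u \<in> tangent_space M (fst w)"
  obtains x where "x \<in> tangent_space (slit M) w" "dpi M x = u"
proof -
  obtain U \<phi> b where c: "(U, \<phi>) \<in> M" "w \<in> tdom U" "u = coord_vec M (U, \<phi>) (fst w) b"
    using base_tangentE[OF assms] .
  then show ?thesis
    using that[of "tcoord U \<phi> w (b, 0)"] dpi_tcoord[OF c(1,2)]
      T.coord_vec_in_tangent_space[OF tchart_in_slit[OF c(1)] c(2)] by blast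
qed

lemma ivert_in_tangent_space:
  assumes "w \<in> points (slit M)" "u \<in> tangent_space M (fst w)"
  shows "ivert M w u \<in> tangent_space (slit M) w"
proof -
  obtain U \<phi> b where c: "(U, \<phi>) \<in> M" "w \<in> tdom U" "u = coord_vec M (U, \<phi>) (fst w) b"
    using base_tangentE[OF assms] .
  then show ?thesis
    using T.coord_vec_in_tangent_space[OF tchart_in_slit[OF c(1)] c(2)] by (simp add: ivert_coord_vec)
qed

lemma dpi_ivert: "dpi M (ivert M w u) = (\<lambda>_. 0)"
  by (auto simp: dpi_def ivert_fst)

text \<open>In induced coordinates the kernel of \<open>dpi\<close> consists of the vectors (0, b),
  and these are the values of \<open>ivert\<close>.\<close>

lemma vertical_space_eq:
  assumes "w \<in> points (slit M)"
  shows "vertical_space M w = ivert M w ` tangent_space M (fst w)"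
proof -
  have "x \<in> ivert M w ` tangent_space M (fst w)"
    if x: "x \<in> tangent_space (slit M) w" "dpi M x = (\<lambda>_. 0)" for x
  proof -
    obtain U \<phi> a b where c: "(U, \<phi>) \<in> M" "w \<in> tdom U" "fst w \<in> U" "x = tcoord U \<phi> w (a, b)"
      using slit_tangentE[OF assms x(1)] .
    have "coord_vec M (U, \<phi>) (fst w) a = coord_vec M (U, \<phi>) (fst w) 0"
      using x(2) c dpi_tcoord[OF c(1,2)] by (simp add: M.coord_vec_zero)
    then have "a = 0" using M.coord_vec_inject[OF c(1,3)] by blast
    then have "x = ivert M w (coord_vec M (U, \<phi>) (fst w) b)" using c by (simp add: ivert_coord_vec)
    then show ?thesis using M.coord_vec_in_tangent_space[OF c(1,3)] by blast
  qed
  then show ?thesis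
    using ivert_in_tangent_space[OF assms] by (auto simp: vertical_space_def dpi_ivert)
qed

text \<open>The difference of the two vectors kills all \<open>g \<circ> fst\<close>, hence is of
  the form \<open>ivert M w u\<close>; evaluating it on dg gives \<open>u g\<close>, which is
  therefore 0.\<close>

lemma tangent_test_eq:
  assumes w: "w \<in> points (slit M)" and x: "x \<in> tangent_space (slit M) w" and y: "y \<in> tangent_space (slit M) w"
    and fst: "\<And>g. smooth_fun M g \<Longrightarrow> x (g \<circ> fst) = y (g \<circ> fst)"
    and diff: "\<And>g. smooth_fun M g \<Longrightarrow> x (differential_fun g) = y (differential_fun g)"
  shows "x = y"
proof -
  have z: "(\<lambda>f. x f - y f) \<in> tangent_space (slit M) w" by (rule tangent_space_diff[OF x y])
  have "dpi M (\<lambda>f. x f - y f) = (\<lambda>_. 0)" using fst by (auto simp: dpi_def)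
  then obtain u where u: "u \<in> tangent_space M (fst w)" "(\<lambda>f. x f - y f) = ivert M w u"
    using z vertical_space_eq[OF w] by (auto simp: vertical_space_def)
  have "u g = 0" for g
  proof (cases "smooth_fun M g")
    case True
    then show ?thesis
      using ivert_differential[OF True, of w u] fun_cong[OF u(2), of "differential_fun g"] diff[OF True] by simp
  qed (rule tangent_nonsmooth[OF u(1)])
  then have "u = (\<lambda>_. 0)" by auto
  moreover have "ivert M w (\<lambda>_. 0) f = 0" for f by (simp add: ivert_def case_prod_beta')
  ultimately have "x f - y f = 0" for f using fun_cong[OF u(2), of f] by simp
  then show ?thesis by (simp add: fun_eq_iff)
qed

lemma ivert_inject:
  assumes "u \<in> tangent_space M (fst w)" "v \<in> tangent_space M (fst w)" "ivert M w u = ivert M w v"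
  shows "u = v"
proof
  show "u g = v g" for g
    using ivert_differential[of g w u] ivert_differential[of g w v] assms
      tangent_nonsmooth[OF assms(1)] tangent_nonsmooth[OF assms(2)] by (cases "smooth_fun M g") auto
qed

lemma ivert_add:
  assumes w: "w \<in> points (slit M)" and u: "u \<in> tangent_space M (fst w)" "v \<in> tangent_space M (fst w)"
  shows "ivert M w (\<lambda>g. u g + v g) = (\<lambda>f. ivert M w u f + ivert M w v f)"
  by (rule tangent_test_eq[OF w ivert_in_tangent_space[OF w tangent_space_add[OF u]]
        tangent_space_add[OF u[THEN ivert_in_tangent_space[OF w]]]])
    (simp_all add: ivert_fst ivert_differential)

lemma ivert_scale:
  assumes w: "w \<in> points (slit M)" and u: "u \<in> tangent_space M (fst w)"
  shows "ivert M w (\<lambda>g. c * u g) = (\<lambda>f. c * ivert M w u f)"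
  by (rule tangent_test_eq[OF w ivert_in_tangent_space[OF w tangent_space_scale[OF u]]
        tangent_space_scale[OF ivert_in_tangent_space[OF w u]]])
    (simp_all add: ivert_fst ivert_differential)

lemma ivert_inv_ivert:
  assumes "u \<in> tangent_space M (fst w)"
  shows "ivert_inv M w (ivert M w u) = u"
  unfolding ivert_inv_def
  by (rule inv_into_f_f[OF _ assms]) (auto intro: inj_onI ivert_inject)

section \<open>The vertical endomorphism on vector fields\<close>

abbreviation "vf \<equiv> vector_field (slit M)"
abbreviation "J \<equiv> vertical_endo M"

lemma vf_test_eq:
  assumes X: "vf X" and Y: "vf Y"
    and "\<And>g w. smooth_fun M g \<Longrightarrow> X w (g \<circ> fst) = Y w (g \<circ> fst)"
    and "\<And>g w. smooth_fun M g \<Longrightarrow> X w (differential_fun g) = Y w (differential_fun g)"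
  shows "X = Y"
proof
  show "X w = Y w" for w
    using tangent_test_eq[OF _ vector_field_tangent[OF X] vector_field_tangent[OF Y] assms(3,4)]
      vector_field_outside[OF X, of w] vector_field_outside[OF Y, of w] by (cases "w \<in> points (slit M)") auto
qed

text \<open>In induced coordinates the field with components (a, b) goes to the one with components
  (0, a), so smooth components stay smooth.\<close>

lemma vf_vertical_endo:
  assumes X: "vf X"
  shows "vf (J X)"
  unfolding vector_field_def
proof (intro conjI ballI allI impI)
  show "J X w \<in> tangent_space (slit M) w" if "w \<in> points (slit M)" for w
    using that ivert_in_tangent_space[OF that dpi_in_tangent_space[OF that vector_field_tangent[OF X that]]]
    by (simp add: vertical_endo_def)
  show "J X w = (\<lambda>_. 0)" if "w \<notin> points (slit M)" for w using that by (simp add: vertical_endo_def)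
  fix f assume f: "smooth_fun (slit M) f"
  show "smooth_fun (slit M) (\<lambda>w. J X w f)"
  proof (rule T.smooth_funI)
    fix TU \<Phi> assume t: "(TU, \<Phi>) \<in> slit M"
    obtain U \<phi> where c: "(U, \<phi>) \<in> M" "TU = tdom U" "\<Phi> = tmap U \<phi>" using slitE[OF t] by blast
    obtain \<xi> where \<xi>: "class_C_inf (\<Phi> ` TU) \<xi>" "\<And>w. w \<in> TU \<Longrightarrow> X w = coord_vec (slit M) (TU, \<Phi>) w (\<xi> (\<Phi> w))"
      using T.vector_field_components[OF t X] by blast
    have op: "open (\<Phi> ` TU)" by (rule T.chart_open[OF t])
    have b: "bounded_linear (\<lambda>y::'e \<times> 'e. (0::'e, fst y))"
      by (intro bounded_linear_Pair bounded_linear_zero bounded_linear_fst)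
    have "class_C_inf (\<Phi> ` TU)
        (\<lambda>y. frechet_derivative (\<lambda>y. f (inv_into TU \<Phi> y)) (at y) (0, fst (\<xi> y)))"
      by (rule class_C_inf_derivative[OF op op T.smooth_funD[OF f t] class_C_inf_id
            class_C_inf_linear_compose[OF op \<xi>(1) b]]) auto
    then show "class_C_inf (\<Phi> ` TU) (\<lambda>y. J X (inv_into TU \<Phi> y) f)"
    proof (rule class_C_inf_cong_on[OF op, rotated])
      fix y assume "y \<in> \<Phi> ` TU"
      then obtain w where w: "w \<in> TU" "y = \<Phi> w" by auto
      obtain a b where ab: "\<xi> (\<Phi> w) = (a, b)" by force
      have "J X w = tcoord U \<phi> w (0, a)"
        using w(1) \<xi>(2)[OF w(1)] ab c T.chart_subset[OF t] ivert_coord_vec[OF c(1), of w a]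
        by (auto simp: vertical_endo_def dpi_tcoord)
      then show "frechet_derivative (\<lambda>y. f (inv_into TU \<Phi> y)) (at y) (0, fst (\<xi> y)) = J X (inv_into TU \<Phi> y) f"
        using ab c w by (simp add: T.chart_inv[OF t w(1), unfolded c] T.coord_vec_apply[OF f])
    qed
  qed
qed

lemma J_fst: "smooth_fun M g \<Longrightarrow> J X w (g \<circ> fst) = 0"
  by (simp add: vertical_endo_def ivert_fst)

text \<open>Together with \<open>J_fst\<close> this describes \<open>J\<close> on test functions: J
  X kills g \<circ> \<pi> and sends dg to X (g \<circ> \<pi>). The algebraic identities for
  \<open>J\<close> are computed from these two rules.\<close>

lemma J_differential: "vf X \<Longrightarrow> smooth_fun M g \<Longrightarrow> J X w (differential_fun g) = X w (g \<circ> fst)"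
  using vector_field_outside[of "slit M" X w] by (simp add: vertical_endo_def ivert_differential dpi_apply)

lemma J_fadd: "vf X \<Longrightarrow> vf Y \<Longrightarrow> J (fadd X Y) = fadd (J X) (J Y)"
  by (rule vf_test_eq) (simp_all add: vf_vertical_endo T.vector_field_fadd J_fst J_differential, simp_all add: fadd_def J_fst J_differential)

lemma J_fmul: "smooth_fun (slit M) h \<Longrightarrow> vf X \<Longrightarrow> J (fmul h X) = fmul h (J X)"
  by (rule vf_test_eq) (simp_all add: vf_vertical_endo T.vector_field_fmul J_fst J_differential, simp_all add: fmul_def J_fst J_differential)

lemma tensorial_J: "tensorial (slit M) J"
  by (simp add: tensorial_def J_fadd J_fmul)

lemma J_J: "vf X \<Longrightarrow> J (J X) = (\<lambda>_ _. 0)"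
  by (rule vf_test_eq) (simp_all add: vf_vertical_endo vector_field_zero J_fst J_differential)

text \<open>Any lift of u = \<open>ivert_inv M w x\<close> extends to a suitable \<open>Y\<close>.
  Through this, an identity of tensors known on fields J Y passes to every vertical vector.\<close>

lemma vertical_extension:
  assumes w: "w \<in> points (slit M)" and x: "x \<in> vertical_space M w"
  obtains Y where "vf Y" "J Y w = x"
proof -
  obtain u where u: "u \<in> tangent_space M (fst w)" "x = ivert M w u"
    using x vertical_space_eq[OF w] by auto
  obtain y where y: "y \<in> tangent_space (slit M) w" "dpi M y = u" using dpi_surj[OF w u(1)] .
  obtain Y where "vf Y" "Y w = y" using T.vector_field_extension[OF w y(1)] by blast
  then show ?thesis using that[of Y] u y w by (simp add: vertical_endo_def)
qed

lemma vertical_spaceI: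
  assumes "w \<in> points (slit M)" "vf X" "\<And>g. smooth_fun M g \<Longrightarrow> X w (g \<circ> fst) = 0"
  shows "X w \<in> vertical_space M w"
  using assms by (auto simp: vertical_space_def dpi_def vector_field_tangent)

lemma vertical_spaceD: "x \<in> vertical_space M w \<Longrightarrow> smooth_fun M g \<Longrightarrow> x (g \<circ> fst) = 0"
  using dpi_apply[of g x] by (simp add: vertical_space_def)

lemma vertical_fieldI:
  "vf X \<Longrightarrow> (\<And>w g. w \<in> points (slit M) \<Longrightarrow> smooth_fun M g \<Longrightarrow> X w (g \<circ> fst) = 0) \<Longrightarrow> vertical_field M X"
  by (simp add: vertical_field_def vertical_spaceI)

lemma ivert_ivert_inv:
  assumes "w \<in> points (slit M)" "x \<in> vertical_space M w"
  shows "ivert M w (ivert_inv M w x) = x" and "ivert_inv M w x \<in> tangent_space M (fst w)"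
  using assms ivert_inv_ivert[of _ w] by (auto simp: vertical_space_eq)

end

section \<open>Sprays and lifts of the canonical connection\<close>

locale spray_bundle = slit_bundle M
  for M :: "('a, 'e::euclidean_space) chart set" +
  fixes S :: "('a \<times> 'a tvec) vfield"
  assumes spray: "spray M S"
begin

abbreviation "C \<equiv> canonical_field M"
abbreviation "\<Gamma> \<equiv> spray_connection M S"

lemma vf_S: "vf S" and J_S: "J S = C" and C_S: "lie_bracket C S = S"
  using spray by (auto simp: spray_def)

text \<open>The second-order condition on sprays, d\<pi>(S) = w at \<open>w\<close>, obtained by
  evaluating J S = C on dg.\<close>

lemma S_fst:
  assumes "w \<in> points (slit M)" "smooth_fun M g"
  shows "S w (g \<circ> fst) = differential_fun g w"
  using J_differential[OF vf_S assms(2), of w] assms ivert_differential[OF assms(2), of w "snd w"]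
  by (simp add: J_S canonical_field_def differential_fun_def)

text \<open>On dg the left side is [S, J X] (g \<circ> \<pi>). There J X (g \<circ> \<pi>) = 0 and S
  (g \<circ> \<pi>) = dg, so only - (J X) (dg) remains.\<close>

lemma J_S_bracket_J:
  assumes X: "vf X"
  shows "J (lie_bracket S (J X)) = fmul (\<lambda>_. - 1) (J X)"
proof (rule vf_test_eq)
  have b: "vf (lie_bracket S (J X))" by (intro T.vector_field_lie_bracket vf_S vf_vertical_endo X)
  show "vf (J (lie_bracket S (J X)))" by (rule vf_vertical_endo[OF b])
  show "vf (fmul (\<lambda>_. - 1) (J X))"
    by (rule T.vector_field_fmul[OF smooth_fun_const vf_vertical_endo[OF X]])
  fix g w assume g: "smooth_fun M g"
  show "J (lie_bracket S (J X)) w (g \<circ> fst) = fmul (\<lambda>_. - 1) (J X) w (g \<circ> fst)"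
    by (simp add: fmul_def J_fst g)
  \<comment> \<open>S (g \<circ> \<pi>) and dg agree at the points of \<open>slit M\<close> but
    possibly not elsewhere on the type; \<open>tangent_cong\<close> says that a tangent vector does
    not notice.\<close>
  have "J X w (\<lambda>q. S q (g \<circ> fst)) = J X w (differential_fun g)"
  proof (cases "w \<in> points (slit M)")
    case True
    show ?thesis
      by (rule T.tangent_cong[OF True vector_field_tangent[OF vf_vertical_endo[OF X] True]
            vector_field_smooth[OF vf_S smooth_fun_fst[OF g]] smooth_fun_differential[OF g] S_fst[OF _ g]])
  qed (simp add: vertical_endo_def)
  then show "J (lie_bracket S (J X)) w (differential_fun g) = fmul (\<lambda>_. - 1) (J X) w (differential_fun g)"
    using J_differential[OF b g, of w]
    by (simp add: fmul_def lie_bracket_def J_fst[OF g] T.vector_field_const[OF vf_S])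
qed

section \<open>The canonical connection as a tensor field\<close>

lemma vf_\<Gamma>:
  assumes X: "vf X"
  shows "vf (\<Gamma> X)"
  unfolding spray_connection_def
  by (rule T.vector_field_fsub[OF vf_vertical_endo[OF T.vector_field_lie_bracket[OF vf_S X]]
        T.vector_field_lie_bracket[OF vf_S vf_vertical_endo[OF X]]])

text \<open>Replacing \<open>X\<close> by h X contributes the extra term (S h) J X both to J [S, X]
  and to [S, J X]; it cancels in the difference.\<close>

lemma tensorial_\<Gamma>: "tensorial (slit M) \<Gamma>"
  unfolding tensorial_def
proof (intro conjI allI impI)
  fix X Y assume X: "vf X" and Y: "vf Y"
  show "\<Gamma> (fadd X Y) = fadd (\<Gamma> X) (\<Gamma> Y)"
    unfolding spray_connection_def J_fadd[OF X Y] T.lie_bracket_fadd[OF vf_S X Y]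
      T.lie_bracket_fadd[OF vf_S vf_vertical_endo[OF X] vf_vertical_endo[OF Y]]
      J_fadd[OF T.vector_field_lie_bracket[OF vf_S X] T.vector_field_lie_bracket[OF vf_S Y]]
    by (simp add: fadd_def fsub_def algebra_simps)
next
  fix h X assume h: "smooth_fun (slit M) h" and X: "vf X"
  have b: "vf (lie_bracket S X)" by (rule T.vector_field_lie_bracket[OF vf_S X])
  have Sh: "smooth_fun (slit M) (\<lambda>w. S w h)" by (rule vector_field_smooth[OF vf_S h])
  show "\<Gamma> (fmul h X) = fmul h (\<Gamma> X)"
    unfolding spray_connection_def J_fmul[OF h X] T.lie_bracket_fmul[OF vf_S X h]
      T.lie_bracket_fmul[OF vf_S vf_vertical_endo[OF X] h]
      J_fadd[OF T.vector_field_fmul[OF h b] T.vector_field_fmul[OF Sh X]] J_fmul[OF h b] J_fmul[OF Sh X]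
    by (simp add: fadd_def fsub_def fmul_def algebra_simps)
qed

lemma \<Gamma>_J:
  assumes X: "vf X"
  shows "\<Gamma> (J X) = fmul (\<lambda>_. - 1) (J X)"
  unfolding spray_connection_def J_J[OF X] J_S_bracket_J[OF X] T.lie_bracket_zero[OF vf_S]
  by (simp add: fsub_def)

text \<open>Says that \<Gamma> does not change d\<pi>. Since J [S, X] kills g \<circ> \<pi>, only -
  [S, J X] (g \<circ> \<pi>) counts; this equals - (J [S, J X]) (dg), and
  \<open>J_S_bracket_J\<close> turns it into (J X) (dg) = X (g \<circ> \<pi>).\<close>

lemma \<Gamma>_fst:
  assumes X: "vf X" and g: "smooth_fun M g"
  shows "\<Gamma> X w (g \<circ> fst) = X w (g \<circ> fst)"
proof -
  have "J (lie_bracket S (J X)) w (differential_fun g) = lie_bracket S (J X) w (g \<circ> fst)"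
    by (rule J_differential[OF T.vector_field_lie_bracket[OF vf_S vf_vertical_endo[OF X]] g])
  then show ?thesis
    by (simp add: spray_connection_def fsub_def J_fst[OF g] J_S_bracket_J[OF X] fmul_def J_differential[OF X g])
qed

lemma \<Gamma>_vertical:
  assumes w: "w \<in> points (slit M)" and Z: "vf Z" "Z w \<in> vertical_space M w"
  shows "\<Gamma> Z w = (\<lambda>f. - Z w f)"
proof -
  obtain Y where Y: "vf Y" "J Y w = Z w" using vertical_extension[OF w Z(2)] .
  then have "\<Gamma> Z w = \<Gamma> (J Y) w"
    by (intro T.tensorial_cong_at[OF tensorial_\<Gamma> Z(1) vf_vertical_endo w]) auto
  then show ?thesis using \<Gamma>_J[OF Y(1)] Y(2) by (simp add: fmul_def)
qed

text \<open>As \<Gamma> preserves d\<pi>, the field \<Gamma> X - X is vertical, where \<Gamma> acts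
  as - 1: hence \<Gamma> (\<Gamma> X) - \<Gamma> X = X - \<Gamma> X.\<close>

lemma \<Gamma>_\<Gamma>:
  assumes X: "vf X"
  shows "\<Gamma> (\<Gamma> X) = X"
proof
  fix w
  show "\<Gamma> (\<Gamma> X) w = X w"
  proof (cases "w \<in> points (slit M)")
    case True
    have Z: "vf (fsub (\<Gamma> X) X)" by (rule T.vector_field_fsub[OF vf_\<Gamma>[OF X] X])
    have "fsub (\<Gamma> X) X w \<in> vertical_space M w"
      by (rule vertical_spaceI[OF True Z]) (simp add: fsub_def \<Gamma>_fst[OF X])
    from \<Gamma>_vertical[OF True Z this] show ?thesis
      unfolding T.tensorial_fsub[OF tensorial_\<Gamma> vf_\<Gamma>[OF X] X] by (simp add: fsub_def fun_eq_iff)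
  next
    case False
    then show ?thesis using vector_field_outside[OF X] vector_field_outside[OF vf_\<Gamma>[OF vf_\<Gamma>[OF X]]] by simp
  qed
qed

section \<open>Vertical and horizontal projections\<close>

text \<open>A formula in \<Gamma>, hence visibly smooth and tensorial;
  \<open>vertical_part_eq\<close> identifies it with the projection given by definite
  description.\<close>

definition vpart :: "('a \<times> 'a tvec) vfield \<Rightarrow> ('a \<times> 'a tvec) vfield" where
  "vpart X = fmul (\<lambda>_. 1 / 2) (fsub X (\<Gamma> X))"

definition hpart :: "('a \<times> 'a tvec) vfield \<Rightarrow> ('a \<times> 'a tvec) vfield" where
  "hpart X = fmul (\<lambda>_. 1 / 2) (fadd X (\<Gamma> X))"

lemma vf_vpart: "vf X \<Longrightarrow> vf (vpart X)"
  unfolding vpart_def by (intro T.vector_field_fmul smooth_fun_const T.vector_field_fsub vf_\<Gamma>)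

lemma vf_hpart: "vf X \<Longrightarrow> vf (hpart X)"
  unfolding hpart_def by (intro T.vector_field_fmul smooth_fun_const T.vector_field_fadd vf_\<Gamma>)

lemma vpart_eq: "vpart X = (\<lambda>w f. (X w f - \<Gamma> X w f) / 2)"
  by (simp add: vpart_def fmul_def fsub_def)

lemma hpart_eq: "hpart X = (\<lambda>w f. (X w f + \<Gamma> X w f) / 2)"
  by (simp add: hpart_def fmul_def fadd_def)

lemma tensorial_vpart: "tensorial (slit M) vpart"
  using tensorial_\<Gamma> by (simp add: tensorial_def vpart_eq fadd_def fmul_def diff_divide_distrib add_divide_distrib algebra_simps)

lemma \<Gamma>_hpart:
  assumes X: "vf X"
  shows "\<Gamma> (hpart X) = hpart X"
  unfolding hpart_def tensorial_mul[OF tensorial_\<Gamma> smooth_fun_const T.vector_field_fadd[OF X vf_\<Gamma>[OF X]]]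
    tensorial_add[OF tensorial_\<Gamma> X vf_\<Gamma>[OF X]] \<Gamma>_\<Gamma>[OF X]
  by (simp add: fadd_def add.commute)

lemma vpart_J: "vf X \<Longrightarrow> vpart (J X) = J X"
  by (simp add: vpart_eq \<Gamma>_J fmul_def)

lemma vpart_\<Gamma>: "vf X \<Longrightarrow> vpart (\<Gamma> X) = fmul (\<lambda>_. - 1) (vpart X)"
  by (simp add: vpart_eq \<Gamma>_\<Gamma> fmul_def diff_divide_distrib)

lemma hpart_add_vpart: "X = fadd (hpart X) (vpart X)"
  by (simp add: hpart_eq vpart_eq fadd_def field_simps)

lemma vertical_field_vpart: "vf X \<Longrightarrow> vertical_field M (vpart X)"
  by (rule vertical_fieldI[OF vf_vpart]) (simp_all add: vpart_eq \<Gamma>_fst)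

text \<open>With [S, S] = 0 and J S = C the definition reduces to - [S, C] = [C, S], which is S by
  homogeneity of the spray.\<close>

lemma \<Gamma>_S: "\<Gamma> S = S"
proof -
  have "\<Gamma> S = fsub (J (lie_bracket S S)) (lie_bracket S C)" by (simp add: spray_connection_def J_S)
  also have "lie_bracket S S = (\<lambda>_ _. 0)" by (simp add: lie_bracket_def)
  also have "J (\<lambda>_ _. 0) = (\<lambda>_ _. 0)" by (rule T.tensorial_zero[OF tensorial_J])
  also have "lie_bracket S C = (\<lambda>w f. - lie_bracket C S w f)" by (simp add: lie_bracket_def)
  finally show ?thesis by (simp add: C_S fsub_def)
qed

lemma horizontal_iff:
  assumes w: "w \<in> points (slit M)" and X: "vf X"
  shows "X w \<in> horizontal_space M S w \<longleftrightarrow> \<Gamma> X w = X w"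
  using T.value_at_eq[OF tensorial_\<Gamma> X w] vector_field_tangent[OF X w] by (simp add: horizontal_space_def)

lemma horizontal_tangent: "x \<in> horizontal_space M S w \<Longrightarrow> x \<in> tangent_space (slit M) w"
  by (simp add: horizontal_space_def)

text \<open>If v is vertical and x - v is fixed by \<Gamma>, then \<Gamma> x + v = x - v, which
  forces v = (x - \<Gamma> x) / 2. The vector \<open>v\<close> is extended to a field so that
  \<Gamma> can be applied to it.\<close>

lemma vertical_proj_eq:
  assumes w: "w \<in> points (slit M)" and X: "vf X"
  shows "vertical_proj M S w (X w) = vpart X w"
  unfolding vertical_proj_def
proof (rule the_equality)
  have "(\<lambda>f. X w f - vpart X w f) = hpart X w" by (simp add: vpart_eq hpart_eq field_simps)
  then show "vpart X w \<in> vertical_space M w \<and> (\<lambda>f. X w f - vpart X w f) \<in> horizontal_space M S w"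
    using vertical_field_vpart[OF X] w horizontal_iff[OF w vf_hpart[OF X]] \<Gamma>_hpart[OF X]
    by (simp add: vertical_field_def)
next
  fix v assume v: "v \<in> vertical_space M w \<and> (\<lambda>f. X w f - v f) \<in> horizontal_space M S w"
  then have "v \<in> tangent_space (slit M) w" by (simp add: vertical_space_def)
  then obtain V where V: "vf V" "V w = v" using T.vector_field_extension[OF w] by blast
  have "fsub X V w \<in> horizontal_space M S w" using v V by (simp add: fsub_def)
  then have "\<Gamma> (fsub X V) w = fsub X V w" using horizontal_iff[OF w T.vector_field_fsub[OF X V(1)]] by blast
  then have "fsub (\<Gamma> X) (\<Gamma> V) w = fsub X V w"
    unfolding T.tensorial_fsub[OF tensorial_\<Gamma> X V(1)] .
  then have "\<Gamma> X w f + v f = X w f - v f" for f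
    using \<Gamma>_vertical[OF w V(1)] v V(2) by (simp add: fsub_def fun_eq_iff)
  then have "2 * v f = X w f - \<Gamma> X w f" for f by (smt (verit))
  then show "v = vpart X w" by (simp add: vpart_eq fun_eq_iff field_simps)
qed

lemma vertical_part_eq:
  assumes X: "vf X"
  shows "vertical_part M S X = vpart X"
proof
  show "vertical_part M S X w = vpart X w" for w
    using vertical_proj_eq[OF _ X] vector_field_outside[OF vf_vpart[OF X]] by (simp add: vertical_part_def)
qed

text \<open>The difference is vertical and horizontal at once, so \<Gamma> acts on it both as - 1
  and as 1.\<close>

lemma horizontal_unique:
  assumes w: "w \<in> points (slit M)" and x: "x \<in> horizontal_space M S w" and y: "y \<in> horizontal_space M S w"
    and eq: "dpi M x = dpi M y"
  shows "x = y"
proof -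
  obtain X where X: "vf X" "X w = x" using T.vector_field_extension[OF w horizontal_tangent[OF x]] by blast
  obtain Y where Y: "vf Y" "Y w = y" using T.vector_field_extension[OF w horizontal_tangent[OF y]] by blast
  have Z: "vf (fsub X Y)" by (rule T.vector_field_fsub[OF X(1) Y(1)])
  have "fsub X Y w \<in> vertical_space M w"
    using X Y fun_cong[OF eq] by (intro vertical_spaceI[OF w Z]) (simp add: fsub_def dpi_apply[symmetric])
  from \<Gamma>_vertical[OF w Z this] have "fsub (\<Gamma> X) (\<Gamma> Y) w = (\<lambda>f. - fsub X Y w f)"
    unfolding T.tensorial_fsub[OF tensorial_\<Gamma> X(1) Y(1)] .
  then have "\<Gamma> X w f - \<Gamma> Y w f = - (x f - y f)" for f
    using X Y by (simp add: fsub_def fun_eq_iff)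
  moreover have "\<Gamma> X w = x" "\<Gamma> Y w = y"
    using horizontal_iff[OF w X(1)] horizontal_iff[OF w Y(1)] X Y x y by auto
  ultimately have "x f - y f = - (x f - y f)" for f by metis
  then show ?thesis by (simp add: fun_eq_iff)
qed

lemma horizontal_lift_eq:
  assumes w: "w \<in> points (slit M)" and x: "x \<in> horizontal_space M S w" "dpi M x = u"
  shows "horizontal_lift M S w u = x"
  unfolding horizontal_lift_def
  by (rule the_equality) (use x horizontal_unique[OF w] in auto)

text \<open>Any field over \<open>u\<close> at \<open>w\<close> will do: \<open>hpart\<close> keeps
  its projection and makes it fixed by \<Gamma>.\<close>

lemma horizontal_lift_hpart:
  assumes w: "w \<in> points (slit M)" and X: "vf X" "dpi M (X w) = u"
  shows "horizontal_lift M S w u = hpart X w"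
proof (rule horizontal_lift_eq[OF w])
  show "hpart X w \<in> horizontal_space M S w"
    using horizontal_iff[OF w vf_hpart[OF X(1)]] \<Gamma>_hpart[OF X(1)] by simp
  show "dpi M (hpart X w) = u" using X by (auto simp: dpi_def hpart_eq \<Gamma>_fst)
qed

lemma horizontal_field_exists:
  assumes w: "w \<in> points (slit M)" and u: "u \<in> tangent_space M (fst w)"
  obtains X where "vf X" "\<Gamma> X = X" "horizontal_lift M S w u = X w"
proof -
  obtain x where x: "x \<in> tangent_space (slit M) w" "dpi M x = u" using dpi_surj[OF w u] .
  obtain X where X: "vf X" "X w = x" using T.vector_field_extension[OF w x(1)] by blast
  show ?thesis
    using that[OF vf_hpart[OF X(1)] \<Gamma>_hpart[OF X(1)] horizontal_lift_hpart[OF w X(1)]] X x by simp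
qed

lemma horizontal_lift_in_horizontal:
  assumes w: "w \<in> points (slit M)" and u: "u \<in> tangent_space M (fst w)"
  shows "horizontal_lift M S w u \<in> horizontal_space M S w" "dpi M (horizontal_lift M S w u) = u"
proof -
  obtain x where x: "x \<in> tangent_space (slit M) w" "dpi M x = u" using dpi_surj[OF w u] .
  obtain X where X: "vf X" "X w = x" using T.vector_field_extension[OF w x(1)] by blast
  have h: "horizontal_lift M S w u = hpart X w" using horizontal_lift_hpart[OF w X(1)] X x by simp
  show "horizontal_lift M S w u \<in> horizontal_space M S w"
    unfolding h using horizontal_iff[OF w vf_hpart[OF X(1)]] \<Gamma>_hpart[OF X(1)] by simp
  show "dpi M (horizontal_lift M S w u) = u"
    unfolding h using X x by (auto simp: dpi_def hpart_eq \<Gamma>_fst)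
qed

end

section \<open>Curvature of a lift of the canonical connection\<close>

lemma linear_connectionD:
  assumes "linear_connection M D" "vector_field (slit M) X" "vertical_field M V"
  shows connection_vertical: "vertical_field M (D X V)"
    and connection_add: "vertical_field M W \<Longrightarrow> D X (fadd V W) = fadd (D X V) (D X W)"
    and connection_fmul: "smooth_fun (slit M) h \<Longrightarrow>
      D X (fmul h V) = fadd (fmul (\<lambda>w. X w h) V) (fmul h (D X V))"
  using assms by (simp_all add: linear_connection_def)

locale spray_lift = spray_bundle M S
  for M :: "('a, 'e::euclidean_space) chart set" and S +
  fixes D :: "('a \<times> 'a tvec) connection"
  assumes lift: "lift_of_spray_connection M S D"
begin

lemma connection: "linear_connection M D"
  and D_C: "vf X \<Longrightarrow> D X C = vpart X"
  using lift by (simp_all add: lift_of_spray_connection_def vertical_part_eq)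

abbreviation "K \<equiv> \<lambda>X. curvature D S X C"

lemma vertical_field_zero: "vertical_field M (\<lambda>_ _. 0)"
  by (rule vertical_fieldI[OF vector_field_zero]) simp

lemma D_zero:
  assumes "vf X"
  shows "D X (\<lambda>_ _. 0) = (\<lambda>_ _. 0)"
  using connection_fmul[OF connection assms vertical_field_zero smooth_fun_const, of 0]
    T.vector_field_const[OF assms] by (simp add: fmul_def fadd_def)

lemma K_eq:
  assumes X: "vf X"
  shows "K X = fsub (vpart (lie_bracket S X)) (D S (vpart X))"
proof -
  have "vpart S = (\<lambda>_ _. 0)" by (simp add: vpart_eq \<Gamma>_S)
  then show ?thesis
    by (simp add: curvature_def D_C[OF T.vector_field_lie_bracket[OF vf_S X]] D_C[OF X] D_C[OF vf_S]
        D_zero[OF X] fsub_def)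
qed

text \<open>\<open>ivert_inv\<close> is a genuine inverse of \<open>ivert\<close> on vertical
  vectors only, so the curvature has to take its values there.\<close>

lemma vertical_K:
  assumes X: "vf X" and w: "w \<in> points (slit M)"
  shows "K X w \<in> vertical_space M w"
proof -
  have v: "vertical_field M (vpart (lie_bracket S X))" "vertical_field M (D S (vpart X))"
    using vertical_field_vpart[OF T.vector_field_lie_bracket[OF vf_S X]]
      connection_vertical[OF connection vf_S vertical_field_vpart[OF X]] by auto
  then have "vf (vpart (lie_bracket S X))" "vf (D S (vpart X))"
    and m: "vpart (lie_bracket S X) w \<in> vertical_space M w" "D S (vpart X) w \<in> vertical_space M w"
    using w by (auto simp: vertical_field_def)
  then have "vf (fsub (vpart (lie_bracket S X)) (D S (vpart X)))" by (intro T.vector_field_fsub)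
  then show ?thesis
    unfolding K_eq[OF X] by (rule vertical_spaceI[OF w]) (simp only: fsub_def m[THEN vertical_spaceD] diff_self)
qed

text \<open>Replacing \<open>X\<close> by h X adds (S h) V X to V [S, X], through the bracket, and
  to D_S (V X), through the Leibniz rule of the connection; the two cancel.\<close>

lemma tensorial_K: "tensorial (slit M) K"
  unfolding tensorial_def
proof (intro conjI allI impI)
  fix X Y assume X: "vf X" and Y: "vf Y"
  show "K (fadd X Y) = fadd (K X) (K Y)"
    unfolding K_eq[OF X] K_eq[OF Y] K_eq[OF T.vector_field_fadd[OF X Y]] T.lie_bracket_fadd[OF vf_S X Y]
      tensorial_add[OF tensorial_vpart X Y]
      tensorial_add[OF tensorial_vpart T.vector_field_lie_bracket[OF vf_S X] T.vector_field_lie_bracket[OF vf_S Y]]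
      connection_add[OF connection vf_S vertical_field_vpart[OF X] vertical_field_vpart[OF Y]]
    by (simp add: fadd_def fsub_def algebra_simps)
next
  fix h X assume h: "smooth_fun (slit M) h" and X: "vf X"
  have b: "vf (lie_bracket S X)" by (rule T.vector_field_lie_bracket[OF vf_S X])
  have Sh: "smooth_fun (slit M) (\<lambda>w. S w h)" by (rule vector_field_smooth[OF vf_S h])
  show "K (fmul h X) = fmul h (K X)"
    unfolding K_eq[OF X] K_eq[OF T.vector_field_fmul[OF h X]] T.lie_bracket_fmul[OF vf_S X h]
      tensorial_mul[OF tensorial_vpart h X] tensorial_mul[OF tensorial_vpart h b]
      tensorial_mul[OF tensorial_vpart Sh X]
      tensorial_add[OF tensorial_vpart T.vector_field_fmul[OF h b] T.vector_field_fmul[OF Sh X]]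
      connection_fmul[OF connection vf_S vertical_field_vpart[OF X] h]
    by (simp add: fadd_def fsub_def fmul_def algebra_simps)
qed

lemma curvature_S_C_eq: "w \<in> points (slit M) \<Longrightarrow> vf X \<Longrightarrow> curvature_S_C M S D w (X w) = K X w"
  unfolding curvature_S_C_def by (rule T.value_at_eq[OF tensorial_K])

lemma curvature_S_C_horizontal:
  assumes "w \<in> points (slit M)" "vf X" "\<Gamma> X = X"
  shows "curvature_S_C M S D w (X w) = vpart (lie_bracket S X) w"
proof -
  have "vpart X = (\<lambda>_ _. 0)" using assms(3) by (simp add: vpart_eq)
  then show ?thesis
    using assms(1,2) by (simp add: curvature_S_C_eq K_eq D_zero[OF vf_S] fsub_def)
qed

text \<open>Because J S = C, the term D_Y (J S) of the torsion is V Y; so T(S, Y) = 0 expresses D_S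
  (J Y) without the connection, and the result is exactly V [S, J Y].\<close>

lemma K_J_torsion_free:
  assumes Y: "vf Y" and T: "torsion M D S Y = (\<lambda>_ _. 0)"
  shows "K (J Y) = (\<lambda>_ _. 0)"
proof -
  have b: "vf (lie_bracket S Y)" by (rule T.vector_field_lie_bracket[OF vf_S Y])
  have "D S (J Y) w f = vpart Y w f + J (lie_bracket S Y) w f" for w f
    using fun_cong[OF fun_cong[OF T, of w], of f] by (simp add: torsion_def fsub_def J_S D_C[OF Y])
  moreover have "lie_bracket S (J Y) = fsub (J (lie_bracket S Y)) (\<Gamma> Y)"
    by (simp add: spray_connection_def fsub_def)
  then have "vpart (lie_bracket S (J Y)) = fsub (J (lie_bracket S Y)) (fmul (\<lambda>_. - 1) (vpart Y))"
    by (simp add: T.tensorial_fsub[OF tensorial_vpart vf_vertical_endo[OF b] vf_\<Gamma>[OF Y]] vpart_J[OF b] vpart_\<Gamma>[OF Y])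
  ultimately show ?thesis
    by (simp add: K_eq[OF vf_vertical_endo[OF Y]] vpart_J[OF Y] fsub_def fmul_def)
qed

section \<open>The endomorphisms of the tangent spaces of the base\<close>

lemma R_endo_eq:
  assumes w: "w \<in> points (slit M)" and u: "u \<in> tangent_space M (fst w)"
    and X: "vf X" "X w = horizontal_lift M S w u"
  shows "R_endo M S D w u = ivert_inv M w (K X w)"
  using curvature_S_C_eq[OF w X(1)] X(2) by (simp add: R_endo_def)

text \<open>Linearity is inherited from \<open>K\<close> as a tensor, from the uniqueness of
  horizontal lifts, and from the linearity of \<open>ivert\<close>.\<close>

lemma tangent_endomorphism_R_endo:
  assumes w: "w \<in> points (slit M)"
  shows "tangent_endomorphism M (fst w) (R_endo M S D w)"
  unfolding tangent_endomorphism_def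
proof (intro conjI ballI allI)
  have field: "\<exists>X. vf X \<and> X w = horizontal_lift M S w u" if "u \<in> tangent_space M (fst w)" for u
    using horizontal_field_exists[OF w that] by metis
  have hor: "X w \<in> horizontal_space M S w" "dpi M (X w) = u" "\<Gamma> X w = X w"
    if "u \<in> tangent_space M (fst w)" "vf X" "X w = horizontal_lift M S w u" for u X
    using horizontal_lift_in_horizontal[OF w that(1)] horizontal_iff[OF w that(2)] that(3) by auto
  fix u assume u: "u \<in> tangent_space M (fst w)"
  obtain X where X: "vf X" "X w = horizontal_lift M S w u" using field[OF u] by blast
  note KX = vertical_K[OF X(1) w]
  show "R_endo M S D w u \<in> tangent_space M (fst w)"
    unfolding R_endo_eq[OF w u X] by (rule ivert_ivert_inv(2)[OF w KX])
  show "R_endo M S D w (\<lambda>f. u f + v f) = (\<lambda>f. R_endo M S D w u f + R_endo M S D w v f)"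
    if v: "v \<in> tangent_space M (fst w)" for v
  proof -
    obtain Y where Y: "vf Y" "Y w = horizontal_lift M S w v" using field[OF v] by blast
    note KY = vertical_K[OF Y(1) w]
    have XY: "vf (fadd X Y)" by (rule T.vector_field_fadd[OF X(1) Y(1)])
    \<comment> \<open>The lift is a definite description, so its additivity comes from uniqueness:
      the sum of the lifts is horizontal and projects to the sum.\<close>
    have "horizontal_lift M S w (\<lambda>f. u f + v f) = fadd X Y w"
    proof (rule horizontal_lift_eq[OF w])
      show "fadd X Y w \<in> horizontal_space M S w"
        unfolding horizontal_iff[OF w XY] tensorial_add[OF tensorial_\<Gamma> X(1) Y(1)]
        using hor(3)[OF u X] hor(3)[OF v Y] by (simp add: fadd_def)
      have "dpi M (fadd X Y w) = (\<lambda>g. dpi M (X w) g + dpi M (Y w) g)" by (auto simp: dpi_def fadd_def)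
      then show "dpi M (fadd X Y w) = (\<lambda>f. u f + v f)" by (simp add: hor(2)[OF u X] hor(2)[OF v Y])
    qed
    then have "R_endo M S D w (\<lambda>f. u f + v f) = ivert_inv M w (\<lambda>f. K X w f + K Y w f)"
      using R_endo_eq[OF w tangent_space_add[OF u v] XY] tensorial_add[OF tensorial_K X(1) Y(1)]
      by (simp add: fadd_def)
    \<comment> \<open>Written as a value of \<open>ivert\<close>, the argument can be inverted;
      additivity of \<open>ivert\<close> thus yields that of \<open>ivert_inv\<close>.\<close>
    also have "(\<lambda>f. K X w f + K Y w f) = ivert M w (\<lambda>g. ivert_inv M w (K X w) g + ivert_inv M w (K Y w) g)"
      by (simp add: ivert_add[OF w ivert_ivert_inv(2)[OF w KX] ivert_ivert_inv(2)[OF w KY]]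
          ivert_ivert_inv(1)[OF w KX] ivert_ivert_inv(1)[OF w KY])
    finally show ?thesis
      using ivert_inv_ivert[OF tangent_space_add[OF ivert_ivert_inv(2)[OF w KX] ivert_ivert_inv(2)[OF w KY]]]
      by (simp add: R_endo_eq[OF w u X] R_endo_eq[OF w v Y])
  qed
  fix c
  have cX: "vf (fmul (\<lambda>_. c) X)" by (rule T.vector_field_fmul[OF smooth_fun_const X(1)])
  have "horizontal_lift M S w (\<lambda>f. c * u f) = fmul (\<lambda>_. c) X w"
  proof (rule horizontal_lift_eq[OF w])
    show "fmul (\<lambda>_. c) X w \<in> horizontal_space M S w"
      unfolding horizontal_iff[OF w cX] tensorial_mul[OF tensorial_\<Gamma> smooth_fun_const X(1)]
      using hor(3)[OF u X] by (simp add: fmul_def)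
    have "dpi M (fmul (\<lambda>_. c) X w) = (\<lambda>g. c * dpi M (X w) g)" by (auto simp: dpi_def fmul_def)
    then show "dpi M (fmul (\<lambda>_. c) X w) = (\<lambda>f. c * u f)" by (simp add: hor(2)[OF u X])
  qed
  then have "R_endo M S D w (\<lambda>f. c * u f) = ivert_inv M w (\<lambda>f. c * K X w f)"
    using R_endo_eq[OF w tangent_space_scale[OF u] cX] tensorial_mul[OF tensorial_K smooth_fun_const X(1)]
    by (simp add: fmul_def)
  also have "(\<lambda>f. c * K X w f) = ivert M w (\<lambda>g. c * ivert_inv M w (K X w) g)"
    by (simp add: ivert_scale[OF w ivert_ivert_inv(2)[OF w KX]] ivert_ivert_inv(1)[OF w KX])
  finally show "R_endo M S D w (\<lambda>f. c * u f) = (\<lambda>f. c * R_endo M S D w u f)"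
    using ivert_inv_ivert[OF tangent_space_scale[OF ivert_ivert_inv(2)[OF w KX]]]
    by (simp add: R_endo_eq[OF w u X])
qed

text \<open>Split an extension of \<open>x\<close> as \<open>hpart X\<close> plus
  \<open>vpart X\<close>. The first summand realises the horizontal lift of d\<pi>(x), and the
  second contributes no curvature.\<close>

lemma R_endo_any_lift:
  assumes T: "\<And>Y. vf Y \<Longrightarrow> torsion M D S Y = (\<lambda>_ _. 0)"
    and w: "w \<in> points (slit M)" and x: "x \<in> tangent_space (slit M) w"
  shows "R_endo M S D w (dpi M x) = ivert_inv M w (curvature_S_C M S D w x)"
proof -
  obtain X where X: "vf X" "X w = x" using T.vector_field_extension[OF w x] by blast
  have "vpart X w \<in> vertical_space M w" using vertical_field_vpart[OF X(1)] w by (simp add: vertical_field_def)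
  then obtain Y where Y: "vf Y" "J Y w = vpart X w" using vertical_extension[OF w] by blast
  \<comment> \<open>The fields \<open>vpart X\<close> and \<open>J Y\<close> need to agree at
    \<open>w\<close> only, since \<open>K\<close> is tensorial.\<close>
  have "K (vpart X) w = K (J Y) w"
    by (rule T.tensorial_cong_at[OF tensorial_K vf_vpart[OF X(1)] vf_vertical_endo[OF Y(1)] w Y(2)[symmetric]])
  then have "K (vpart X) w = (\<lambda>_. 0)" using K_J_torsion_free[OF Y(1) T[OF Y(1)]] by simp
  moreover have "K X = fadd (K (hpart X)) (K (vpart X))"
    using tensorial_add[OF tensorial_K vf_hpart[OF X(1)] vf_vpart[OF X(1)]] hpart_add_vpart[of X] by simp
  ultimately have "K X w = K (hpart X) w" by (simp add: fadd_def)
  moreover have "horizontal_lift M S w (dpi M x) = hpart X w"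
    using horizontal_lift_hpart[OF w X(1)] X(2) by simp
  ultimately show ?thesis
    using curvature_S_C_eq[OF w X(1)] curvature_S_C_eq[OF w vf_hpart[OF X(1)]] X(2) by (simp add: R_endo_def)
qed

end

theorem corollary2p12:
  fixes M :: "('a, 'e::euclidean_space) chart set"
    and S :: "('a \<times> 'a tvec) vfield"
  assumes "smooth_manifold M"
    and "spray M S"
  shows "(\<forall>D. lift_of_spray_connection M S D \<longrightarrow>
            (\<forall>w\<in>points (slit M). tangent_endomorphism M (fst w) (R_endo M S D w))) \<and>
         (\<forall>D D'. lift_of_spray_connection M S D \<longrightarrow> lift_of_spray_connection M S D' \<longrightarrow>
            (\<forall>w\<in>points (slit M). \<forall>u\<in>tangent_space M (fst w).
               R_endo M S D w u = R_endo M S D' w u)) \<and>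
         (\<forall>D. lift_of_spray_connection M S D \<longrightarrow>
            (\<forall>Y. vector_field (slit M) Y \<longrightarrow> torsion M D S Y = (\<lambda>_ _. 0)) \<longrightarrow>
            (\<forall>w\<in>points (slit M). \<forall>u\<in>tangent_space M (fst w).
             \<forall>x\<in>tangent_space (slit M) w. dpi M x = u \<longrightarrow>
               R_endo M S D w u = ivert_inv M w (curvature_S_C M S D w x)))"
proof -
  interpret spray_bundle M S
    using assms by unfold_locales (auto simp: smooth_manifold_def)
  have lift: "spray_lift M S D" if "lift_of_spray_connection M S D" for D
    using that by unfold_locales
  show ?thesis
  proof (intro conjI allI impI ballI)
    fix D w assume "lift_of_spray_connection M S D" "w \<in> points (slit M)"
    then show "tangent_endomorphism M (fst w) (R_endo M S D w)"
      using spray_lift.tangent_endomorphism_R_endo lift by blast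
  next
    fix D D' w u
    assume D: "lift_of_spray_connection M S D" "lift_of_spray_connection M S D'"
      and w: "w \<in> points (slit M)" and u: "u \<in> tangent_space M (fst w)"
    \<comment> \<open>A single horizontal field, chosen from \<open>S\<close> alone, evaluates both
      curvatures; each becomes V [S, X] at \<open>w\<close>.\<close>
    obtain X where X: "vf X" "\<Gamma> X = X" "horizontal_lift M S w u = X w"
      using horizontal_field_exists[OF w u] .
    show "R_endo M S D w u = R_endo M S D' w u"
      by (simp add: R_endo_def X(3) D[THEN lift, THEN spray_lift.curvature_S_C_horizontal, OF w X(1,2)])
  next
    fix D w u x
    assume D: "lift_of_spray_connection M S D"
      and T: "\<forall>Y. vector_field (slit M) Y \<longrightarrow> torsion M D S Y = (\<lambda>_ _. 0)"
      and w: "w \<in> points (slit M)" and x: "x \<in> tangent_space (slit M) w" and u: "dpi M x = u"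
    show "R_endo M S D w u = ivert_inv M w (curvature_S_C M S D w x)"
      using spray_lift.R_endo_any_lift[OF lift[OF D] _ w x] T u by blast
  qed
qed

end
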